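(* Let $T$ be an expanding rational map of degree at least $2$ of the Riemann sphere $\overline{\mathbb C}$, let $J(T)$ be its Julia set, $\delta=\dim J(T)$, and fix $z_0\in J(T)$. Let $$\mathrm{Bad}_{z_0}(J)=\{z\in J(T):\ \exists c(z)>0 \text{ such that } T^n(z)\notin B(z_0,c(z)) \text{ for all } n\in\mathbb N\}.$$ Then $\dim\mathrm{Bad}_{z_0}(J)=\delta$.
   Context: $\dim$ is Hausdorff dimension, with respect to the spherical metric on $\overline{\mathbb C}$ (balls $B(z_0,r)$ are taken in this metric). $T$ is expanding if there exist $C>0$ and $\lambda>1$ such that $|(T^n)'(z)|\ge C\lambda^n$ for all $z\in J(T)$ and $n\ge1$ (derivative with respect to the spherical metric). *)

theory Defs
  imports "HOL-Analysis.Analysis" "HOL-Computational_Algebra.Polynomial"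
begin

text \<open>The Riemann sphere is modelled as complex option, None being the point at infinity.\<close>

fun chordal :: "complex option \<Rightarrow> complex option \<Rightarrow> real" where
  "chordal (Some z) (Some w) = 2 * cmod (z - w) / sqrt ((1 + (cmod z)^2) * (1 + (cmod w)^2))"
| "chordal (Some z) None = 2 / sqrt (1 + (cmod z)^2)"
| "chordal None (Some w) = 2 / sqrt (1 + (cmod w)^2)"
| "chordal None None = 0"

definition sph_ball :: "complex option \<Rightarrow> real \<Rightarrow> complex option set" where
  "sph_ball z0 r = {z. chordal z0 z < r}"

definition is_rational_map :: "(complex option \<Rightarrow> complex option) \<Rightarrow> nat \<Rightarrow> bool" where
  "is_rational_map T d \<longleftrightarrow>
     (\<exists>p q :: complex poly. q \<noteq> 0 \<and> coprime p q \<and> max (degree p) (degree q) = d \<and>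
        (\<forall>z. T (Some z) = (if poly q z = 0 then None else Some (poly p z / poly q z))) \<and>
        T None = (if degree p > degree q then None
                  else if degree p = degree q then Some (lead_coeff p / lead_coeff q)
                  else Some 0))"

text \<open>Fatou set: points with a neighbourhood on which the iterates form an equicontinuous
  family with respect to the spherical metric (Beardon's definition).\<close>

definition fatou_set :: "(complex option \<Rightarrow> complex option) \<Rightarrow> complex option set" where
  "fatou_set T = {z. \<exists>r>0. \<forall>x\<in>sph_ball z r. \<forall>e>0. \<exists>h>0. \<forall>y\<in>sph_ball z r.
       chordal x y < h \<longrightarrow> (\<forall>n. chordal ((T^^n) x) ((T^^n) y) < e)}"

definition julia_set :: "(complex option \<Rightarrow> complex option) \<Rightarrow> complex option set" where
  "julia_set T = UNIV - fatou_set T"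

definition has_sph_deriv :: "(complex option \<Rightarrow> complex option) \<Rightarrow> complex option \<Rightarrow> real \<Rightarrow> bool" where
  "has_sph_deriv f z L \<longleftrightarrow> (\<forall>e>0. \<exists>h>0. \<forall>w. w \<noteq> z \<and> chordal w z < h \<longrightarrow>
       \<bar>chordal (f w) (f z) / chordal w z - L\<bar> < e)"

definition expanding :: "(complex option \<Rightarrow> complex option) \<Rightarrow> bool" where
  "expanding T \<longleftrightarrow> (\<exists>C>0. \<exists>lam>1. \<forall>z\<in>julia_set T. \<forall>n\<ge>1.
       \<exists>L. has_sph_deriv (T^^n) z L \<and> L \<ge> C * lam ^ n)"

definition mdiam :: "('a \<Rightarrow> 'a \<Rightarrow> real) \<Rightarrow> 'a set \<Rightarrow> real" where
  "mdiam d U = Sup {d x y | x y. x \<in> U \<and> y \<in> U}"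

definition hcontrib :: "('a \<Rightarrow> 'a \<Rightarrow> real) \<Rightarrow> real \<Rightarrow> 'a set \<Rightarrow> real" where
  "hcontrib d s U = (if U = {} then 0 else if s = 0 then 1 else mdiam d U powr s)"

definition hausdorff_content :: "('a \<Rightarrow> 'a \<Rightarrow> real) \<Rightarrow> real \<Rightarrow> real \<Rightarrow> 'a set \<Rightarrow> ennreal" where
  "hausdorff_content d s \<delta> A =
     (INF U \<in> {U :: nat \<Rightarrow> 'a set. A \<subseteq> (\<Union>i. U i) \<and>
                 (\<forall>i. U i \<noteq> {} \<longrightarrow> bdd_above {d x y | x y. x \<in> U i \<and> y \<in> U i} \<and> mdiam d (U i) \<le> \<delta>)}.
        (\<Sum>i. ennreal (hcontrib d s (U i))))"

definition hausdorff_measure :: "('a \<Rightarrow> 'a \<Rightarrow> real) \<Rightarrow> real \<Rightarrow> 'a set \<Rightarrow> ennreal" where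
  "hausdorff_measure d s A = (SUP \<delta> \<in> {0<..}. hausdorff_content d s \<delta> A)"

definition hausdorff_dim :: "('a \<Rightarrow> 'a \<Rightarrow> real) \<Rightarrow> 'a set \<Rightarrow> real" where
  "hausdorff_dim d A = Inf {s. s \<ge> 0 \<and> hausdorff_measure d s A = 0}"

definition bad_set :: "(complex option \<Rightarrow> complex option) \<Rightarrow> complex option \<Rightarrow> complex option set" where
  "bad_set T z0 = {z \<in> julia_set T. \<exists>c>0. \<forall>n\<ge>1. (T^^n) z \<notin> sph_ball z0 c}"

end

theory Submission
  imports Defs "HOL-Complex_Analysis.Complex_Analysis" "HOL-Real_Asymp.Real_Asymp"
begin

text \<open>Let \<open>s < t\<close> with \<open>H\<^sup>t(J) \<noteq> 0\<close>. Replace \<open>T\<close> by an iterate that expands \<open>J\<close> by a factor of at least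
  2, choose a fine finite net of \<open>J\<close>, and follow the inverse branches from net point to net point. They
  form a finite directed graph whose paths of length \<open>n\<close> code covers of \<open>J\<close> by small, nearly conformal
  copies of balls. As \<open>H\<^sup>t(J) \<noteq> 0\<close>, the sums of \<open>ratio\<^sup>s\<close> over these paths grow
  exponentially. If all sums over closed paths at a single vertex were at most 1, they would grow only
  polynomially; hence at some net point \<open>c\<close> the closed paths of some length form a separated iterated
  function system on a ball around \<open>c\<close> with \<open>\<Sum> ratio\<^sup>s > 1\<close>. No transitivity of \<open>T\<close> on \<open>J\<close> is
  needed. Passing to words of length \<open>m\<close> and deleting the few words which code orbits that meet one of the
  finitely many relevant preimages of \<open>z0\<close> keeps this sum above 1, so the limit set of the remaining
  words has positive \<open>H\<^sup>s\<close> measure, and its compact orbit misses \<open>z0\<close>.\<close>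

section \<open>Hausdorff measure and finite covers\<close>

text \<open>The distortion of a branch is never bounded uniformly: each step may cost a factor
  \<open>(1 + \<epsilon>)^2\<close>. This exponential loss is affordable because
  \<open>s < t\<close> leaves room. Every step contracts by at least 2, so lowering the exponent
  from \<open>t\<close> to \<open>s\<close> gains \<open>2 powr (t - s)\<close> per step, and
  \<epsilon> is chosen so small that the loss \<open>(1 + \<epsilon>) powr (2 * t)\<close> per step
  stays below this gain. Cells may overlap, since covers of the Julia set are used only to bound
  sums from below; disjointness matters only among paths with a common starting vertex and length.
  Nonzero measure of the limit set is obtained without constructing a measure on it, by induction on
  the size of finite covers. Expansion enters twice: it excludes critical points on the Julia set,
  so that the map is nearly conformal there, and it makes inverse branches contract from one cell
  into the next. The limit set is constructed for a nearly conformal open map of a compact metric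
  space; the sphere joins this setting through its embedding as the unit sphere of
  \<open>complex \<times> real\<close>.\<close>

lemma hcontrib_nonneg: "hcontrib d s U \<ge> 0"
  by (simp add: hcontrib_def)

text \<open>Serves three purposes: monotonicity in the set (\<open>f\<close> the identity), and
  transfer in both directions between \<open>chordal\<close> on the sphere and \<open>dist\<close>
  on its embedded image.\<close>

lemma hausdorff_measure_isometric_le:
  fixes d :: "'a \<Rightarrow> 'a \<Rightarrow> real" and e :: "'b \<Rightarrow> 'b \<Rightarrow> real"
  assumes iso: "\<And>x y. x \<in> A \<Longrightarrow> y \<in> A \<Longrightarrow> e (f x) (f y) = d x y"
    and d0: "\<And>x y. d x y \<ge> 0" and s: "s \<ge> 0" and B: "B \<subseteq> f ` A"
  shows "hausdorff_measure e s B \<le> hausdorff_measure d s A"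
proof -
  have "hausdorff_content e s \<delta> B \<le> hausdorff_content d s \<delta> A" for \<delta>
    unfolding hausdorff_content_def
  proof (rule INF_greatest)
    fix U assume "U \<in> {U :: nat \<Rightarrow> 'a set. A \<subseteq> (\<Union>i. U i) \<and>
                 (\<forall>i. U i \<noteq> {} \<longrightarrow> bdd_above {d x y | x y. x \<in> U i \<and> y \<in> U i} \<and> mdiam d (U i) \<le> \<delta>)}"
    then have U: "A \<subseteq> (\<Union>i. U i)"
      and Ub: "\<And>i. U i \<noteq> {} \<Longrightarrow> bdd_above {d x y | x y. x \<in> U i \<and> y \<in> U i}"
      and Ud: "\<And>i. U i \<noteq> {} \<Longrightarrow> mdiam d (U i) \<le> \<delta>" by auto
    \<comment> \<open>The covering sets are cut down to \<open>A\<close> because \<open>f\<close> is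
      isometric only there; cutting does not increase diameters.\<close>
    define V where "V = (\<lambda>i. f ` (U i \<inter> A))"
    have eq: "{e x y | x y. x \<in> V i \<and> y \<in> V i} = {d x y | x y. x \<in> U i \<inter> A \<and> y \<in> U i \<inter> A}" for i
    proof (intro set_eqI iffI; clarify)
      fix x y assume "x \<in> V i" "y \<in> V i"
      then obtain x' y' where "x = f x'" "x' \<in> U i \<inter> A" "y = f y'" "y' \<in> U i \<inter> A"
        unfolding V_def by blast
      then show "\<exists>x' y'. e x y = d x' y' \<and> x' \<in> U i \<inter> A \<and> y' \<in> U i \<inter> A"
        using iso by (intro exI[of _ x'] exI[of _ y']) auto
    next
      fix x y assume "x \<in> U i" "x \<in> A" "y \<in> U i" "y \<in> A"
      then show "\<exists>x' y'. d x y = e x' y' \<and> x' \<in> V i \<and> y' \<in> V i"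
        using iso unfolding V_def by (intro exI[of _ "f x"] exI[of _ "f y"]) auto
    qed
    have sub: "{d x y | x y. x \<in> U i \<inter> A \<and> y \<in> U i \<inter> A} \<subseteq> {d x y | x y. x \<in> U i \<and> y \<in> U i}" for i
      by blast
    have bnd: "U i \<noteq> {} \<and> bdd_above {e x y | x y. x \<in> V i \<and> y \<in> V i} \<and>
        0 \<le> mdiam e (V i) \<and> mdiam e (V i) \<le> mdiam d (U i)" if ne: "V i \<noteq> {}" for i
    proof -
      from ne obtain z where z: "z \<in> U i \<inter> A" unfolding V_def by blast
      then have "U i \<noteq> {}" by blast
      note bd = bdd_above_mono[OF Ub[OF this] sub[of i]]
      have "d z z \<le> Sup {d x y | x y. x \<in> U i \<inter> A \<and> y \<in> U i \<inter> A}"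
        by (rule cSup_upper[OF _ bd]) (use z in blast)
      then have "0 \<le> mdiam e (V i)"
        unfolding mdiam_def eq using d0[of z z] by linarith
      moreover have "mdiam e (V i) \<le> mdiam d (U i)"
        unfolding mdiam_def eq
        by (rule cSup_subset_mono[OF _ Ub[OF \<open>U i \<noteq> {}\<close>] sub]) (use z in blast)
      ultimately show ?thesis using \<open>U i \<noteq> {}\<close> bd unfolding eq by blast
    qed
    have "V \<in> {U :: nat \<Rightarrow> 'b set. B \<subseteq> (\<Union>i. U i) \<and>
                 (\<forall>i. U i \<noteq> {} \<longrightarrow> bdd_above {e x y | x y. x \<in> U i \<and> y \<in> U i} \<and> mdiam e (U i) \<le> \<delta>)}"
    proof (intro CollectI conjI allI impI)
      show "B \<subseteq> (\<Union>i. V i)"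
      proof
        fix b assume "b \<in> B"
        then obtain a where a: "a \<in> A" "b = f a" using B by auto
        with U obtain i where "a \<in> U i" by auto
        with a show "b \<in> (\<Union>i. V i)" unfolding V_def by auto
      qed
      fix i assume ne: "V i \<noteq> {}"
      show "bdd_above {e x y | x y. x \<in> V i \<and> y \<in> V i}" using bnd[OF ne] by (elim conjE)
      show "mdiam e (V i) \<le> \<delta>" using bnd[OF ne] Ud[of i] by linarith
    qed
    then have "(INF U \<in> {U :: nat \<Rightarrow> 'b set. B \<subseteq> (\<Union>i. U i) \<and>
                 (\<forall>i. U i \<noteq> {} \<longrightarrow> bdd_above {e x y | x y. x \<in> U i \<and> y \<in> U i} \<and> mdiam e (U i) \<le> \<delta>)}.
        (\<Sum>i. ennreal (hcontrib e s (U i)))) \<le> (\<Sum>i. ennreal (hcontrib e s (V i)))"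
      by (rule INF_lower)
    also have "\<dots> \<le> (\<Sum>i. ennreal (hcontrib d s (U i)))"
    proof (rule suminf_le)
      show "ennreal (hcontrib e s (V i)) \<le> ennreal (hcontrib d s (U i))" for i
        using bnd[of i] s by (auto simp: hcontrib_def intro!: ennreal_leI powr_mono2)
    qed auto
    finally show "(INF U \<in> {U :: nat \<Rightarrow> 'b set. B \<subseteq> (\<Union>i. U i) \<and>
                 (\<forall>i. U i \<noteq> {} \<longrightarrow> bdd_above {e x y | x y. x \<in> U i \<and> y \<in> U i} \<and> mdiam e (U i) \<le> \<delta>)}.
        (\<Sum>i. ennreal (hcontrib e s (U i)))) \<le> (\<Sum>i. ennreal (hcontrib d s (U i)))" .
  qed
  then show ?thesis
    unfolding hausdorff_measure_def by (intro SUP_mono') auto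
qed

text \<open>Nonzero measure means positive content at some scale \<delta>, and a finite cover is a
  countable one padded with empty sets, which contribute 0. The index type is free because the
  covers are later indexed by pairs of a vertex and a path.\<close>

lemma hausdorff_measure_pos_finite_covers:
  fixes K :: "'a::metric_space set"
  assumes nz: "hausdorff_measure dist s K \<noteq> 0" and s: "s > 0"
  shows "\<exists>\<kappa>>0. \<exists>\<delta>>0. \<forall>(I :: 'i set) U D. finite I \<and> K \<subseteq> (\<Union>i\<in>I. U i) \<and>
    (\<forall>i\<in>I. 0 \<le> D i \<and> D i \<le> \<delta> \<and> (\<forall>x\<in>U i. \<forall>y\<in>U i. dist x y \<le> D i)) \<longrightarrow> \<kappa> \<le> (\<Sum>i\<in>I. D i powr s)"
proof -
  from nz obtain \<delta> where \<delta>: "\<delta> > 0" "hausdorff_content dist s \<delta> K \<noteq> 0"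
    unfolding hausdorff_measure_def by (metis (no_types, lifting) SUP_bot_conv(2) bot_ennreal greaterThan_iff)
  \<comment> \<open>The content may be infinite, where \<open>enn2real\<close> would return 0;
    capping at 1 keeps \<kappa> positive.\<close>
  define \<kappa> where "\<kappa> = enn2real (min 1 (hausdorff_content dist s \<delta> K))"
  have \<kappa>0: "\<kappa> > 0"
    using \<delta> unfolding \<kappa>_def enn2real_positive_iff by (auto simp: min_def zero_less_iff_neq_zero not_le less_top intro: less_trans[OF _ ennreal_one_less_top])
  have \<kappa>le: "ennreal \<kappa> \<le> hausdorff_content dist s \<delta> K"
    unfolding \<kappa>_def by (subst ennreal_enn2real) (auto simp: min_less_iff_disj)
  show ?thesis
  proof (rule exI[of _ \<kappa>], rule conjI[OF \<kappa>0], rule exI[of _ \<delta>], rule conjI[OF \<delta>(1)], intro allI impI)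
    fix I :: "'i set" and U :: "'i \<Rightarrow> 'a set" and D
    assume *: "finite I \<and> K \<subseteq> (\<Union>i\<in>I. U i) \<and>
      (\<forall>i\<in>I. 0 \<le> D i \<and> D i \<le> \<delta> \<and> (\<forall>x\<in>U i. \<forall>y\<in>U i. dist x y \<le> D i))"
    note fin = *[THEN conjunct1] and cov = *[THEN conjunct2, THEN conjunct1]
    have D: "\<And>i. i \<in> I \<Longrightarrow> 0 \<le> D i \<and> D i \<le> \<delta>"
      and dist: "\<And>i x y. i \<in> I \<Longrightarrow> x \<in> U i \<Longrightarrow> y \<in> U i \<Longrightarrow> dist x y \<le> D i"
      using *[THEN conjunct2, THEN conjunct2] by blast+
    obtain h where h: "bij_betw h {..<card I} I"
      using ex_bij_betw_nat_finite[OF fin] by (auto simp: atLeast0LessThan)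
    define V where "V k = (if k < card I then U (h k) else {})" for k
    have hI: "h k \<in> I" if "k < card I" for k using h that by (auto simp: bij_betw_def)
    have b: "bdd_above {dist x y | x y. x \<in> U i \<and> y \<in> U i}" if "i \<in> I" for i
      by (rule bdd_aboveI[of _ "D i"]) (use dist[OF that] in auto)
    have md: "mdiam dist (U i) \<le> D i" if "i \<in> I" "U i \<noteq> {}" for i
      unfolding mdiam_def by (rule cSup_least) (use dist[OF that(1)] that(2) in blast)+
    have md0: "0 \<le> mdiam dist (U i)" if i: "i \<in> I" and ne: "U i \<noteq> {}" for i
    proof -
      obtain x where "x \<in> U i" using ne by blast
      then have "dist x x \<le> mdiam dist (U i)"
        unfolding mdiam_def using b[OF i] by (intro cSup_upper) auto
      then show ?thesis by simp
    qed
    have "V \<in> {U. K \<subseteq> (\<Union>i. U i) \<and>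
                 (\<forall>i. U i \<noteq> {} \<longrightarrow> bdd_above {dist x y | x y. x \<in> U i \<and> y \<in> U i} \<and> mdiam dist (U i) \<le> \<delta>)}"
    proof (intro CollectI conjI allI impI)
      show "K \<subseteq> (\<Union>i. V i)"
      proof
        fix x assume "x \<in> K"
        then obtain i where "i \<in> I" "x \<in> U i" using cov by blast
        moreover then obtain k where "k < card I" "h k = i" using h by (metis bij_betw_iff_bijections lessThan_iff)
        ultimately show "x \<in> (\<Union>i. V i)" by (auto simp: V_def)
      qed
      fix k assume ne: "V k \<noteq> {}"
      then have k: "V k = U (h k)" "h k \<in> I" "U (h k) \<noteq> {}"
        using hI by (auto simp: V_def split: if_splits)
      show "bdd_above {dist x y | x y. x \<in> V k \<and> y \<in> V k}" unfolding k(1) by (rule b[OF k(2)])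
      show "mdiam dist (V k) \<le> \<delta>" unfolding k(1) using md[OF k(2,3)] D[OF k(2)] by linarith
    qed
    then have "hausdorff_content dist s \<delta> K \<le> (\<Sum>k. ennreal (hcontrib dist s (V k)))"
      unfolding hausdorff_content_def by (rule INF_lower)
    also have "\<dots> = (\<Sum>k<card I. ennreal (hcontrib dist s (V k)))"
      by (rule suminf_finite) (auto simp: V_def hcontrib_def)
    also have "\<dots> \<le> (\<Sum>k<card I. ennreal (D (h k) powr s))"
      by (rule sum_mono) (use s md md0 hI in \<open>auto simp: V_def hcontrib_def intro!: ennreal_leI powr_mono2\<close>)
    also have "\<dots> = ennreal (\<Sum>k<card I. D (h k) powr s)" by simp
    also have "(\<Sum>k<card I. D (h k) powr s) = (\<Sum>i\<in>I. D i powr s)"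
      by (rule sum.reindex_bij_betw[OF h])
    finally have "ennreal \<kappa> \<le> ennreal (\<Sum>i\<in>I. D i powr s)" using \<kappa>le by (rule order_trans[rotated])
    then show "\<kappa> \<le> (\<Sum>i\<in>I. D i powr s)"
      by (subst (asm) ennreal_le_iff) (auto intro: sum_nonneg)
  qed
qed

lemma powr_enlarge:
  fixes D s \<eta> :: real
  assumes "D \<ge> 0" "s > 0" "\<eta> > 0"
  obtains \<epsilon> where "\<epsilon> > 0" "(D + 2 * \<epsilon>) powr s \<le> D powr s + \<eta>"
proof -
  have "((\<lambda>e. (D + 2 * e) powr s) \<longlongrightarrow> (D + 2 * 0) powr s) (at_right 0)"
    using assms by (intro tendsto_powr' tendsto_intros) (auto simp: eventually_at_right_less intro!: eventually_mono[OF eventually_at_right_less])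
  then have "\<forall>\<^sub>F e in at_right 0. (D + 2 * e) powr s < D powr s + \<eta>"
    using assms by (intro order_tendstoD(2)) auto
  then have "\<forall>\<^sub>F e in at_right 0. e > 0 \<and> (D + 2 * e) powr s < D powr s + \<eta>"
    by (intro eventually_conj eventually_at_right_less)
  then obtain e where "e > 0" "(D + 2 * e) powr s < D powr s + \<eta>"
    by (metis (no_types, lifting) eventually_happens trivial_limit_at_right_real)
  then show thesis by (intro that[of e]) auto
qed

text \<open>By compactness countable covers reduce to finite ones, once every covering set is
  enlarged to an open set at a total cost of at most \<open>\<kappa> / 2\<close>. A lower bound for
  the content at scale 1 is enough, since the measure is the supremum over all scales.\<close>

lemma hausdorff_measure_nonzero_finite_covers:
  fixes K :: "'a::metric_space set"
  assumes comp: "compact K" and s: "s \<ge> 0" and \<kappa>: "\<kappa> > 0"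
    and fc: "\<And>(I :: nat set) U D. finite I \<Longrightarrow> K \<subseteq> (\<Union>i\<in>I. U i) \<Longrightarrow> (\<And>i. i \<in> I \<Longrightarrow> 0 < D i) \<Longrightarrow>
       (\<And>i x y. i \<in> I \<Longrightarrow> x \<in> U i \<Longrightarrow> y \<in> U i \<Longrightarrow> dist x y \<le> D i) \<Longrightarrow> \<kappa> \<le> (\<Sum>i\<in>I. D i powr s)"
  shows "hausdorff_measure dist s K \<noteq> 0"
proof -
  have "ennreal (\<kappa> / 2) \<le> hausdorff_content dist s 1 K"
    unfolding hausdorff_content_def
  proof (rule INF_greatest)
    fix U assume "U \<in> {U :: nat \<Rightarrow> 'a set. K \<subseteq> (\<Union>i. U i) \<and>
                 (\<forall>i. U i \<noteq> {} \<longrightarrow> bdd_above {dist x y | x y. x \<in> U i \<and> y \<in> U i} \<and> mdiam dist (U i) \<le> 1)}"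
    then have U: "K \<subseteq> (\<Union>i. U i)"
      and Ub: "\<And>i. U i \<noteq> {} \<Longrightarrow> bdd_above {dist x y | x y. x \<in> U i \<and> y \<in> U i}" by auto
    have md: "dist x y \<le> mdiam dist (U i)" if "x \<in> U i" "y \<in> U i" for x y i
      unfolding mdiam_def by (rule cSup_upper[OF _ Ub]) (use that in blast)+
    define M where "M i = (if U i = {} then 0 else mdiam dist (U i))" for i
    have M0: "M i \<ge> 0" for i
      using md[of _ i] by (auto simp: M_def) (metis dist_self)
    \<comment> \<open>The costs \<open>\<kappa> / 2 * (1/2) ^ Suc i\<close> add up to
      \<open>\<kappa> / 2\<close>. For \<open>s = 0\<close> enlarging is free, because
      \<open>hcontrib\<close> is then 1 for every nonempty set.\<close>
    have "\<exists>\<epsilon>>0. U i \<noteq> {} \<longrightarrow> (M i + 2 * \<epsilon>) powr s \<le> hcontrib dist s (U i) + \<kappa> / 2 * (1/2) ^ Suc i" for i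
    proof (cases "s = 0")
      case True
      then show ?thesis using M0[of i] \<kappa> by (intro exI[of _ 1]) (auto simp: hcontrib_def powr_def)
    next
      case False
      obtain e where "e > 0" "(M i + 2 * e) powr s \<le> M i powr s + \<kappa> / 2 * (1/2) ^ Suc i"
        using powr_enlarge[OF M0[of i], of s "\<kappa> / 2 * (1/2) ^ Suc i"] False s \<kappa> by auto
      then show ?thesis using False by (intro exI[of _ e]) (cases "U i = {}"; simp add: hcontrib_def M_def)
    qed
    then obtain \<epsilon> where \<epsilon>: "\<And>i. \<epsilon> i > 0"
      "\<And>i. U i \<noteq> {} \<Longrightarrow> (M i + 2 * \<epsilon> i) powr s \<le> hcontrib dist s (U i) + \<kappa> / 2 * (1/2) ^ Suc i"
      by metis
    define V where "V i = (\<Union>x\<in>U i. ball x (\<epsilon> i))" for i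
    have "K \<subseteq> (\<Union>i\<in>UNIV. V i)"
    proof
      fix x assume "x \<in> K"
      with U obtain i where "x \<in> U i" by auto
      then have "x \<in> V i" unfolding V_def using \<epsilon>(1)[of i] by (intro UN_I[of x]) auto
      then show "x \<in> (\<Union>i\<in>UNIV. V i)" by auto
    qed
    moreover have "open (V i)" for i unfolding V_def by auto
    ultimately obtain I0 where I0: "finite I0" "K \<subseteq> (\<Union>i\<in>I0. V i)"
      by (meson compactE_image[OF comp])
    \<comment> \<open>Empty sets are dropped because the cost of \<open>\<epsilon> i\<close> is
      controlled only for nonempty \<open>U i\<close>.\<close>
    define I where "I = {i\<in>I0. U i \<noteq> {}}"
    have I: "finite I" "K \<subseteq> (\<Union>i\<in>I. V i)" using I0 unfolding I_def V_def by (auto dest!: subsetD)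
    have "\<kappa> \<le> (\<Sum>i\<in>I. (M i + 2 * \<epsilon> i) powr s)"
    proof (rule fc[OF I])
      show "0 < M i + 2 * \<epsilon> i" for i using M0[of i] \<epsilon>(1)[of i] by linarith
      show "dist x y \<le> M i + 2 * \<epsilon> i" if i: "i \<in> I" and xy: "x \<in> V i" "y \<in> V i" for i x y
      proof -
        from xy obtain x' y' where *: "x' \<in> U i" "dist x' x < \<epsilon> i" "y' \<in> U i" "dist y' y < \<epsilon> i"
          unfolding V_def by auto
        have "dist x y \<le> dist x' x + dist x' y' + dist y' y" by metric
        also have "dist x' y' \<le> M i" using md[of x' i y'] * by (auto simp: M_def)
        finally show ?thesis using * by linarith
      qed
    qed
    also have "\<dots> \<le> (\<Sum>i\<in>I. hcontrib dist s (U i) + \<kappa> / 2 * (1/2) ^ Suc i)"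
      by (rule sum_mono) (use \<epsilon>(2) in \<open>auto simp: I_def\<close>)
    also have "\<dots> = (\<Sum>i\<in>I. hcontrib dist s (U i)) + \<kappa> / 2 * (\<Sum>i\<in>I. (1/2) ^ Suc i)"
      by (simp add: sum.distrib sum_distrib_left)
    also have "(\<Sum>i\<in>I. (1/2::real) ^ Suc i) \<le> 1"
      using sum_le_suminf[OF sums_summable[OF power_half_series] I(1)] sums_unique[OF power_half_series] by simp
    finally have "\<kappa> / 2 \<le> (\<Sum>i\<in>I. hcontrib dist s (U i))"
      using \<kappa> by (simp add: mult_le_cancel_left1)
    then have "ennreal (\<kappa> / 2) \<le> ennreal (\<Sum>i\<in>I. hcontrib dist s (U i))" by (rule ennreal_leI)
    also have "\<dots> = (\<Sum>i\<in>I. ennreal (hcontrib dist s (U i)))"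
      by (simp add: hcontrib_nonneg)
    also have "\<dots> \<le> (\<Sum>i. ennreal (hcontrib dist s (U i)))"
      by (rule sum_le_suminf) (use I(1) in auto)
    finally show "ennreal (\<kappa> / 2) \<le> (\<Sum>i. ennreal (hcontrib dist s (U i)))" .
  qed
  also have "\<dots> \<le> hausdorff_measure dist s K"
    unfolding hausdorff_measure_def by (rule SUP_upper) simp
  finally show ?thesis using \<kappa> by (auto simp: ennreal_eq_0_iff)
qed

section \<open>Separated iterated function systems\<close>

lemma finite_disjoint_compact_separated:
  fixes C :: "'i \<Rightarrow> 'a::heine_borel set"
  assumes "finite I" and "\<And>i. i \<in> I \<Longrightarrow> compact (C i)"
    and "\<And>i j. i \<in> I \<Longrightarrow> j \<in> I \<Longrightarrow> i \<noteq> j \<Longrightarrow> C i \<inter> C j = {}"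
  obtains \<Delta> :: real where "\<Delta> > 0"
    "\<And>i j x y. i \<in> I \<Longrightarrow> j \<in> I \<Longrightarrow> i \<noteq> j \<Longrightarrow> x \<in> C i \<Longrightarrow> y \<in> C j \<Longrightarrow> \<Delta> \<le> dist x y"
proof -
  define P where "P = {p \<in> I \<times> I. fst p \<noteq> snd p}"
  have fin: "finite P" using assms(1) unfolding P_def by auto
  have "\<exists>d>0. \<forall>x\<in>C (fst p). \<forall>y\<in>C (snd p). d \<le> dist x y" if "p \<in> P" for p
    using separate_compact_closed[of "C (fst p)" "C (snd p)"] assms(2,3) that
    by (auto simp: P_def compact_imp_closed)
  then obtain d where d: "\<And>p. p \<in> P \<Longrightarrow> d p > 0"
    "\<And>p x y. p \<in> P \<Longrightarrow> x \<in> C (fst p) \<Longrightarrow> y \<in> C (snd p) \<Longrightarrow> d p \<le> dist x y"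
    by metis
  show thesis
  \<comment> \<open>The 1 keeps the minimum meaningful when there are no two distinct
    indices.\<close>
  proof (rule that[of "Min (insert 1 (d ` P))"])
    show "Min (insert 1 (d ` P)) > 0" using fin d(1) by auto
    fix i j x y assume *: "i \<in> I" "j \<in> I" "i \<noteq> j" "x \<in> C i" "y \<in> C j"
    then have P: "(i, j) \<in> P" by (auto simp: P_def)
    then have "Min (insert 1 (d ` P)) \<le> d (i, j)" using fin by (intro Min_le) auto
    also have "\<dots> \<le> dist x y" using d(2)[OF P] * by auto
    finally show "Min (insert 1 (d ` P)) \<le> dist x y" .
  qed
qed

text \<open>The limit set is the intersection of the decreasing compact sets obtained by iterating
  the Hutchinson operator \<Psi> on \<open>X\<close>. That it lies in its own image uses
  disjointness and injectivity: they fix the first symbol and the preimage of a point independently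
  of the level.\<close>

lemma ifs_limit_set:
  fixes g :: "'i \<Rightarrow> 'a::heine_borel \<Rightarrow> 'a"
  assumes fin: "finite I" and ne: "I \<noteq> {}" and X: "compact X" "X \<noteq> {}"
    and gX: "\<And>i. i \<in> I \<Longrightarrow> g i ` X \<subseteq> X"
    and cont: "\<And>i. i \<in> I \<Longrightarrow> continuous_on X (g i)"
    and inj: "\<And>i. i \<in> I \<Longrightarrow> inj_on (g i) X"
    and disj: "\<And>i j. i \<in> I \<Longrightarrow> j \<in> I \<Longrightarrow> i \<noteq> j \<Longrightarrow> g i ` X \<inter> g j ` X = {}"
  obtains \<Lambda> where "compact \<Lambda>" "\<Lambda> \<noteq> {}" "\<Lambda> \<subseteq> X" "\<Lambda> = (\<Union>i\<in>I. g i ` \<Lambda>)"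
proof -
  define \<Psi> where "\<Psi> Z = (\<Union>i\<in>I. g i ` Z)" for Z
  define A where "A n = (\<Psi> ^^ n) X" for n
  have A0: "A 0 = X" and AS: "A (Suc n) = \<Psi> (A n)" for n by (simp_all add: A_def)
  have \<Psi>_mono: "\<Psi> Z \<subseteq> \<Psi> Z'" if "Z \<subseteq> Z'" for Z Z' using that unfolding \<Psi>_def by blast
  have dec: "A (Suc n) \<subseteq> A n" for n
  proof (induction n)
    case 0 then show ?case using gX unfolding AS A0 \<Psi>_def by blast
  next
    case (Suc n) then show ?case unfolding AS[of "Suc n"] AS[of n] using \<Psi>_mono[of "A (Suc n)" "A n"] AS by simp
  qed
  have AX: "A n \<subseteq> X" for n
    by (induction n) (use dec A0 in auto)
  have comp: "compact (A n)" for n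
  proof (induction n)
    case (Suc n)
    then show ?case unfolding AS \<Psi>_def
      by (intro compact_UN fin compact_continuous_image continuous_on_subset[OF cont AX])
  qed (use X A0 in auto)
  have Ane: "A n \<noteq> {}" for n
    by (induction n) (use X A0 ne in \<open>auto simp: AS \<Psi>_def\<close>)
  define \<Lambda> where "\<Lambda> = (\<Inter>n. A n)"
  have "\<Lambda> \<noteq> {}"
    unfolding \<Lambda>_def by (rule compact_nest[of A, OF comp Ane]) (use lift_Suc_antimono_le[of A] dec in auto)
  moreover have "\<Lambda> \<subseteq> X" using A0 unfolding \<Lambda>_def by blast
  moreover have "compact \<Lambda>"
    unfolding \<Lambda>_def by (rule compact_Inter) (use comp in auto)
  moreover have "\<Lambda> = (\<Union>i\<in>I. g i ` \<Lambda>)"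
  proof (intro equalityI subsetI)
    fix x assume x: "x \<in> \<Lambda>"
    then have "x \<in> A (Suc 0)" unfolding \<Lambda>_def by blast
    then obtain i y where i: "i \<in> I" "y \<in> X" "x = g i y" unfolding AS A0 \<Psi>_def by blast
    have "y \<in> A n" for n
    proof -
      have "x \<in> \<Psi> (A n)" using x unfolding \<Lambda>_def AS[symmetric] by blast
      then obtain j z where j: "j \<in> I" "z \<in> A n" "x = g j z" unfolding \<Psi>_def by blast
      have "z \<in> X" using j(2) AX by blast
      then have "j = i" using disj[of i j] i j by blast
      then have "z = y" using inj i j \<open>z \<in> X\<close> by (auto simp: inj_on_def)
      with j show ?thesis by simp
    qed
    then show "x \<in> (\<Union>i\<in>I. g i ` \<Lambda>)" using i unfolding \<Lambda>_def by blast
  next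
    fix x assume "x \<in> (\<Union>i\<in>I. g i ` \<Lambda>)"
    then obtain i y where i: "i \<in> I" "y \<in> \<Lambda>" "x = g i y" by blast
    have "x \<in> A (Suc n)" for n
      using i unfolding AS \<Psi>_def \<Lambda>_def by blast
    moreover then have "x \<in> A 0" using dec by blast
    ultimately have "x \<in> A n" for n by (cases n) auto
    then show "x \<in> \<Lambda>" unfolding \<Lambda>_def by blast
  qed
  ultimately show thesis using that by blast
qed

text \<open>Replaces a mass distribution on \<Lambda> by induction on the number of covering sets.
  Either one of them meets two first-level pieces, so that its bound is at least \<Delta>, or the
  cover splits into disjoint subcovers of the pieces. Pulling a subcover back by \<open>g i\<close>
  divides its bounds by \<open>r i\<close>, so induction gives
  \<open>r i powr s * \<Delta> powr s\<close> for each piece, and these add up to more than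
  \<open>\<Delta> powr s\<close>. Diameters are bounded inside \<Lambda> only, because pulled-back
  sets are uncontrolled outside it.\<close>

lemma separated_ifs_cover_bound:
  fixes g :: "'i \<Rightarrow> 'a::heine_borel \<Rightarrow> 'a" and J :: "nat set"
  assumes fin: "finite I" and \<Lambda>: "\<Lambda> \<noteq> {}" "\<Lambda> = (\<Union>i\<in>I. g i ` \<Lambda>)"
    and r: "\<And>i. i \<in> I \<Longrightarrow> 0 < r i \<and> r i \<le> 1"
    and low: "\<And>i x y. i \<in> I \<Longrightarrow> x \<in> \<Lambda> \<Longrightarrow> y \<in> \<Lambda> \<Longrightarrow> r i * dist x y \<le> dist (g i x) (g i y)"
    and sum: "(\<Sum>i\<in>I. r i powr s) > 1" and s: "s \<ge> 0" and \<Delta>: "\<Delta> > 0"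
    and sep: "\<And>i j x y. i \<in> I \<Longrightarrow> j \<in> I \<Longrightarrow> i \<noteq> j \<Longrightarrow> x \<in> g i ` \<Lambda> \<Longrightarrow> y \<in> g j ` \<Lambda> \<Longrightarrow> \<Delta> \<le> dist x y"
    and J: "finite J" "\<Lambda> \<subseteq> (\<Union>k\<in>J. U k)" "\<And>k. k \<in> J \<Longrightarrow> 0 < D k"
      "\<And>k x y. k \<in> J \<Longrightarrow> x \<in> U k \<inter> \<Lambda> \<Longrightarrow> y \<in> U k \<inter> \<Lambda> \<Longrightarrow> dist x y \<le> D k"
  shows "\<Delta> powr s \<le> (\<Sum>k\<in>J. D k powr s)"
  using J
proof (induction "card J" arbitrary: J U D rule: less_induct)
  case less
  note J = less.prems
  have g\<Lambda>: "g i ` \<Lambda> \<subseteq> \<Lambda>" if "i \<in> I" for i using \<Lambda>(2) that by blast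
  show ?case
  proof (cases "\<exists>k\<in>J. \<exists>i\<in>I. \<exists>j\<in>I. i \<noteq> j \<and> U k \<inter> g i ` \<Lambda> \<noteq> {} \<and> U k \<inter> g j ` \<Lambda> \<noteq> {}")
    case True
    then obtain k i j x y where k: "k \<in> J" "i \<in> I" "j \<in> I" "i \<noteq> j"
      and xy: "x \<in> U k \<inter> g i ` \<Lambda>" "y \<in> U k \<inter> g j ` \<Lambda>" by blast
    have "\<Delta> \<le> dist x y" using sep k xy by blast
    also have "dist x y \<le> D k" using J(4)[OF k(1), of x y] xy g\<Lambda> k by blast
    finally have "\<Delta> powr s \<le> D k powr s" using \<Delta> s by (intro powr_mono2) auto
    also have "\<dots> \<le> (\<Sum>k\<in>J. D k powr s)" by (rule member_le_sum) (use J k in auto)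
    finally show ?thesis .
  next
    case False
    define P where "P i = {k \<in> J. U k \<inter> g i ` \<Lambda> \<noteq> {}}" for i
    have Pfin: "finite (P i)" for i using J(1) unfolding P_def by auto
    have Pdisj: "P i \<inter> P j = {}" if "i \<in> I" "j \<in> I" "i \<noteq> j" for i j
      using False that unfolding P_def by blast
    have Pne: "P i \<noteq> {}" if "i \<in> I" for i
    proof -
      obtain z where "z \<in> \<Lambda>" using \<Lambda>(1) by blast
      then have "g i z \<in> \<Lambda>" using g\<Lambda> that by blast
      then obtain k where "k \<in> J" "g i z \<in> U k" using J(2) by blast
      then have "k \<in> P i" using \<open>z \<in> \<Lambda>\<close> unfolding P_def by blast
      then show ?thesis by blast
    qed
    \<comment> \<open>Since every ratio is at most 1, a sum above 1 needs two maps. Hence each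
      subcover omits some set of the cover, and the induction parameter drops.\<close>
    have other: "\<exists>j\<in>I. j \<noteq> i" if i: "i \<in> I" for i
    proof (rule ccontr)
      assume "\<not> ?thesis"
      then have "I = {i}" using i by blast
      then have "r i powr s > 1" using sum by simp
      moreover have "r i powr s \<le> 1 powr s" using r[OF i] s by (intro powr_mono2) auto
      ultimately show False by simp
    qed
    have Plt: "card (P i) < card J" if iI: "i \<in> I" for i
    proof -
      obtain j where j: "j \<in> I" "j \<noteq> i" using other[OF iI] by blast
      then obtain k where "k \<in> P j" using Pne by blast
      then have "k \<in> J" "k \<notin> P i" using Pdisj[of i j] j iI unfolding P_def by blast+
      then have "P i \<subset> J" unfolding P_def by blast
      then show ?thesis by (rule psubset_card_mono[OF J(1)])
    qed
    have step: "r i powr s * \<Delta> powr s \<le> (\<Sum>k\<in>P i. D k powr s)" if i: "i \<in> I" for i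
    proof -
      have "\<Delta> powr s \<le> (\<Sum>k\<in>P i. (D k / r i) powr s)"
      proof (rule less.hyps[where U = "\<lambda>k. {x. g i x \<in> U k}"])
        show "card (P i) < card J" by (rule Plt[OF i])
        show "finite (P i)" by (rule Pfin)
        show "\<Lambda> \<subseteq> (\<Union>k\<in>P i. {x. g i x \<in> U k})"
        proof
          fix x assume x: "x \<in> \<Lambda>"
          then have "g i x \<in> \<Lambda>" using g\<Lambda> i by blast
          then obtain k where "k \<in> J" "g i x \<in> U k" using J(2) by blast
          then show "x \<in> (\<Union>k\<in>P i. {x. g i x \<in> U k})" using x unfolding P_def by blast
        qed
        show "0 < D k / r i" if "k \<in> P i" for k
          using that J(3) r[OF i] unfolding P_def by auto
        show "dist x y \<le> D k / r i" if k: "k \<in> P i"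
          and x: "x \<in> {x. g i x \<in> U k} \<inter> \<Lambda>" and y: "y \<in> {x. g i x \<in> U k} \<inter> \<Lambda>" for k x y
        proof -
          have "r i * dist x y \<le> dist (g i x) (g i y)" using low i x y by blast
          also have "\<dots> \<le> D k"
            by (rule J(4)) (use k x y g\<Lambda>[OF i] in \<open>auto simp: P_def\<close>)
          finally show ?thesis using r[OF i] by (simp add: field_simps)
        qed
      qed
      also have "\<dots> = (\<Sum>k\<in>P i. D k powr s / r i powr s)"
        by (simp add: powr_divide)
      also have "\<dots> = (\<Sum>k\<in>P i. D k powr s) / r i powr s" by (simp add: sum_divide_distrib)
      finally show ?thesis using r[OF i] by (simp add: field_simps)
    qed
    have "\<Delta> powr s \<le> (\<Sum>i\<in>I. r i powr s) * \<Delta> powr s"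
      using sum by (simp add: mult_le_cancel_right1)
    also have "\<dots> = (\<Sum>i\<in>I. r i powr s * \<Delta> powr s)" by (rule sum_distrib_right)
    also have "\<dots> \<le> (\<Sum>i\<in>I. \<Sum>k\<in>P i. D k powr s)" by (rule sum_mono) (rule step)
    also have "\<dots> = (\<Sum>k\<in>(\<Union>i\<in>I. P i). D k powr s)"
      by (rule sum.UNION_disjoint[symmetric]) (use fin Pfin Pdisj in auto)
    also have "\<dots> \<le> (\<Sum>k\<in>J. D k powr s)"
      by (rule sum_mono2) (use J in \<open>auto simp: P_def\<close>)
    finally show ?thesis .
  qed
qed

text \<open>Disjoint compact images have a positive mutual distance \<Delta>, which feeds the cover
  bound. The upper estimate \<open>up\<close> serves continuity; the lower estimate
  \<open>low\<close> serves injectivity and the measure.\<close>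

lemma separated_ifs_hausdorff_measure:
  fixes g :: "'i \<Rightarrow> 'a::heine_borel \<Rightarrow> 'a"
  assumes fin: "finite I" and X: "compact X" "X \<noteq> {}"
    and gX: "\<And>i. i \<in> I \<Longrightarrow> g i ` X \<subseteq> X"
    and up: "\<And>i x y. i \<in> I \<Longrightarrow> x \<in> X \<Longrightarrow> y \<in> X \<Longrightarrow> dist (g i x) (g i y) \<le> dist x y"
    and r: "\<And>i. i \<in> I \<Longrightarrow> 0 < r i \<and> r i \<le> 1"
    and low: "\<And>i x y. i \<in> I \<Longrightarrow> x \<in> X \<Longrightarrow> y \<in> X \<Longrightarrow> r i * dist x y \<le> dist (g i x) (g i y)"
    and disj: "\<And>i j. i \<in> I \<Longrightarrow> j \<in> I \<Longrightarrow> i \<noteq> j \<Longrightarrow> g i ` X \<inter> g j ` X = {}"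
    and sum: "(\<Sum>i\<in>I. r i powr s) > 1" and s: "s \<ge> 0"
  obtains \<Lambda> where "compact \<Lambda>" "\<Lambda> \<subseteq> X" "\<Lambda> = (\<Union>i\<in>I. g i ` \<Lambda>)" "hausdorff_measure dist s \<Lambda> \<noteq> 0"
proof -
  have ne: "I \<noteq> {}" using sum by auto
  have cont: "continuous_on X (g i)" if "i \<in> I" for i
    unfolding continuous_on_iff using up[OF that] by (meson le_less_trans)
  have inj: "inj_on (g i) X" if "i \<in> I" for i
  proof (rule inj_onI)
    fix x y assume "x \<in> X" "y \<in> X" "g i x = g i y"
    then have "r i * dist x y \<le> 0" using low[OF that, of x y] by simp
    then show "x = y" using r[OF that] by (simp add: mult_le_0_iff)
  qed
  obtain \<Lambda> where \<Lambda>: "compact \<Lambda>" "\<Lambda> \<noteq> {}" "\<Lambda> \<subseteq> X" "\<Lambda> = (\<Union>i\<in>I. g i ` \<Lambda>)"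
    by (rule ifs_limit_set[OF fin ne X gX cont inj disj])
  obtain \<Delta> :: real where \<Delta>: "\<Delta> > 0"
    "\<And>i j x y. i \<in> I \<Longrightarrow> j \<in> I \<Longrightarrow> i \<noteq> j \<Longrightarrow> x \<in> g i ` X \<Longrightarrow> y \<in> g j ` X \<Longrightarrow> \<Delta> \<le> dist x y"
    by (rule finite_disjoint_compact_separated[OF fin, of "\<lambda>i. g i ` X"])
      (use compact_continuous_image[OF cont X(1)] disj in auto)
  have "hausdorff_measure dist s \<Lambda> \<noteq> 0"
  proof (rule hausdorff_measure_nonzero_finite_covers[OF \<Lambda>(1) s])
    show "\<Delta> powr s > 0" using \<Delta>(1) by simp
    fix J :: "nat set" and U D
    assume J: "finite J" "\<Lambda> \<subseteq> (\<Union>i\<in>J. U i)" "\<And>i. i \<in> J \<Longrightarrow> 0 < D i"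
       "\<And>i x y. i \<in> J \<Longrightarrow> x \<in> U i \<Longrightarrow> y \<in> U i \<Longrightarrow> dist x y \<le> D i"
    show "\<Delta> powr s \<le> (\<Sum>i\<in>J. D i powr s)"
    proof (rule separated_ifs_cover_bound[OF fin \<Lambda>(2,4) r _ sum s \<Delta>(1) _ J(1,2,3)])
      show "r i * dist x y \<le> dist (g i x) (g i y)" if "i \<in> I" "x \<in> \<Lambda>" "y \<in> \<Lambda>" for i x y
        using low that \<Lambda>(3) by blast
      show "\<Delta> \<le> dist x y" if "i \<in> I" "j \<in> I" "i \<noteq> j" "x \<in> g i ` \<Lambda>" "y \<in> g j ` \<Lambda>" for i j x y
        by (rule \<Delta>(2)[OF that(1-3)]) (use that(4,5) \<Lambda>(3) in blast)+
    qed (use J in auto)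
  qed
  then show thesis using that \<Lambda> by blast
qed

text \<open>The forbidden words of length \<open>m\<close> are those whose cylinder contains one of the points
  \<open>G\<^sup>j y\<close> with \<open>j < m\<close>; there are at most \<open>m * card Y\<close> of them, while the total
  weight of all words grows exponentially in \<open>m\<close>.\<close>

lemma separated_ifs_avoid_finite_set:
  fixes g :: "'i \<Rightarrow> 'a::heine_borel \<Rightarrow> 'a"
  assumes fin: "finite I" and X: "compact X" "X \<noteq> {}"
    and gX: "\<And>i. i \<in> I \<Longrightarrow> g i ` X \<subseteq> X"
    and up: "\<And>i x y. i \<in> I \<Longrightarrow> x \<in> X \<Longrightarrow> y \<in> X \<Longrightarrow> dist (g i x) (g i y) \<le> dist x y"
    and r: "\<And>i. i \<in> I \<Longrightarrow> 0 < r i \<and> r i \<le> 1"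
    and low: "\<And>i x y. i \<in> I \<Longrightarrow> x \<in> X \<Longrightarrow> y \<in> X \<Longrightarrow> r i * dist x y \<le> dist (g i x) (g i y)"
    and disj: "\<And>i j. i \<in> I \<Longrightarrow> j \<in> I \<Longrightarrow> i \<noteq> j \<Longrightarrow> g i ` X \<inter> g j ` X = {}"
    and G: "\<And>i x. i \<in> I \<Longrightarrow> x \<in> X \<Longrightarrow> G (g i x) = x"
    and sum: "(\<Sum>i\<in>I. r i powr s) > 1" and s: "s \<ge> 0" and Y: "finite Y"
  obtains \<Lambda> m where "compact \<Lambda>" "\<Lambda> \<subseteq> X" "m \<ge> 1" "(G ^^ m) ` \<Lambda> \<subseteq> \<Lambda>"
    "\<And>a. a < m \<Longrightarrow> (G ^^ a) ` \<Lambda> \<inter> Y = {}" "hausdorff_measure dist s \<Lambda> \<noteq> 0"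
proof -
  define h where "h w = foldr (\<lambda>i f. g i \<circ> f) w id" for w
  have h_simps: "h [] x = x" "h (i # w) x = g i (h w x)" for i w x by (auto simp: h_def)
  define R where "R w = prod_list (map r w)" for w
  have R_simps: "R [] = 1" "R (i # w) = r i * R w" for i w by (auto simp: R_def)
  define W where "W m = {w. set w \<subseteq> I \<and> length w = m}" for m
  have Wfin: "finite (W m)" for m unfolding W_def by (rule finite_lists_length_eq[OF fin])
  have WS: "W (Suc m) = (\<lambda>(i, w). i # w) ` (I \<times> W m)" for m
    unfolding W_def by (force simp: length_Suc_conv)
  have hX: "h w x \<in> X" if "set w \<subseteq> I" "x \<in> X" for w x
    using that by (induction w) (use gX in \<open>auto simp: h_simps\<close>)
  have hup: "dist (h w x) (h w y) \<le> dist x y" if "set w \<subseteq> I" "x \<in> X" "y \<in> X" for w x y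
    using that
  proof (induction w)
    case (Cons i w)
    then have "dist (h (i # w) x) (h (i # w) y) \<le> dist (h w x) (h w y)"
      using up hX by (simp add: h_simps)
    then show ?case using Cons by force
  qed (simp add: h_simps)
  have Rb: "0 < R w \<and> R w \<le> 1" if "set w \<subseteq> I" for w
    using that
  proof (induction w)
    case (Cons i w)
    then have "0 < r i \<and> r i \<le> 1" "0 < R w \<and> R w \<le> 1" using r by auto
    then show ?case using mult_le_one[of "r i" "R w"] by (simp add: R_simps)
  qed (simp add: R_simps)
  have hlow: "R w * dist x y \<le> dist (h w x) (h w y)" if "set w \<subseteq> I" "x \<in> X" "y \<in> X" for w x y
    using that
  proof (induction w)
    case (Cons i w)
    have "R (i # w) * dist x y = r i * (R w * dist x y)" by (simp add: R_simps)
    also have "\<dots> \<le> r i * dist (h w x) (h w y)"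
      using Cons r[of i] by (intro mult_left_mono) auto
    also have "\<dots> \<le> dist (h (i # w) x) (h (i # w) y)"
      using Cons low hX by (simp add: h_simps)
    finally show ?case .
  qed (simp add: h_simps R_simps)
  have hinj: "w = w'" if "length w = length w'" "set w \<subseteq> I" "set w' \<subseteq> I" "x \<in> X" "x' \<in> X" "h w x = h w' x'"
    for w w' x x' using that
  proof (induction w w' rule: list_induct2)
    case (Cons i w j w')
    have *: "h w x \<in> X" "h w' x' \<in> X" using Cons hX by auto
    have eq: "g i (h w x) = g j (h w' x')" using Cons.prems by (simp add: h_simps)
    then have "i = j" using disj[of i j] Cons.prems * by auto
    moreover have "h w x = h w' x'"
      using G[of i "h w x"] G[of j "h w' x'"] eq Cons.prems * by simp
    ultimately show ?case using Cons by auto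
  qed simp
  have hG: "(G ^^ length w) (h w x) = x" if "set w \<subseteq> I" "x \<in> X" for w x
    using that
  proof (induction w)
    case (Cons i w)
    then show ?case using G[of i "h w x"] hX by (simp add: h_simps funpow_Suc_right del: funpow.simps)
  qed (simp add: h_simps)
  have Wsum: "(\<Sum>w\<in>W m. R w powr s) = (\<Sum>i\<in>I. r i powr s) ^ m" for m
  proof (induction m)
    case 0
    have "W 0 = {[]}" by (auto simp: W_def)
    then show ?case by (simp add: R_simps)
  next
    case (Suc m)
    have "(\<Sum>w\<in>W (Suc m). R w powr s) = (\<Sum>(i, w)\<in>I \<times> W m. R (i # w) powr s)"
      unfolding WS by (subst sum.reindex) (auto simp: inj_on_def case_prod_unfold)
    also have "\<dots> = (\<Sum>i\<in>I. \<Sum>w\<in>W m. r i powr s * R w powr s)"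
      unfolding sum.cartesian_product[symmetric]
      by (intro sum.cong refl) (use r Rb in \<open>auto simp: R_simps W_def powr_mult less_imp_le\<close>)
    also have "\<dots> = (\<Sum>i\<in>I. r i powr s) * (\<Sum>w\<in>W m. R w powr s)" by (simp add: sum_product)
    finally show ?case using Suc by simp
  qed
  define \<theta> where "\<theta> = (\<Sum>i\<in>I. r i powr s)"
  have "\<theta> > 1" using sum by (simp add: \<theta>_def)
  \<comment> \<open>Every word has weight at most 1, so removing at most \<open>m * card Y\<close>
    words costs at most that much of the total weight \<open>\<theta> ^ m\<close>.\<close>
  then have "filterlim (\<lambda>m::nat. \<theta> ^ m - real m * real (card Y)) at_top at_top"
    by real_asymp
  then have "\<forall>\<^sub>F m in at_top. 1 < \<theta> ^ m - real m * real (card Y)"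
    by (simp add: filterlim_at_top_dense)
  then have "\<forall>\<^sub>F m in at_top. 1 < \<theta> ^ m - real m * real (card Y) \<and> 1 \<le> m"
    by (intro eventually_conj eventually_ge_at_top)
  then obtain m where m: "1 < \<theta> ^ m - real m * real (card Y)" "1 \<le> m"
    by (auto simp: eventually_at_top_linorder)
  define C where "C p = {w \<in> W m. (G ^^ snd p) (fst p) \<in> h w ` X}" for p
  define Bad where "Bad = (\<Union>p\<in>Y \<times> {..<m}. C p)"
  \<comment> \<open>Cylinders of words of equal length are disjoint, so a point determines its
    word.\<close>
  have "card (C p) \<le> 1" for p
  proof -
    have "w = w'" if "w \<in> C p" "w' \<in> C p" for w w'
      using that hinj[of w w'] unfolding C_def W_def by auto
    moreover have "finite (C p)" unfolding C_def using Wfin by auto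
    ultimately show ?thesis by (simp add: card_le_Suc0_iff_eq)
  qed
  then have "card Bad \<le> card (Y \<times> {..<m}) * 1"
    unfolding Bad_def using Y sum_bounded_above[of "Y \<times> {..<m}" "\<lambda>p. card (C p)" 1]
    by (intro order_trans[OF card_UN_le]) auto
  then have cardBad: "real (card Bad) \<le> real m * real (card Y)"
    by (simp add: card_cartesian_product mult.commute flip: of_nat_mult)
  have BadW: "Bad \<subseteq> W m" unfolding Bad_def C_def by blast
  define V where "V = W m - Bad"
  have VW: "set w \<subseteq> I \<and> length w = m" if "w \<in> V" for w using that unfolding V_def W_def by blast
  have "(\<Sum>w\<in>Bad. R w powr s) \<le> real (card Bad) * 1"
  proof (rule sum_bounded_above)
    fix w assume "w \<in> Bad"
    then have "R w powr s \<le> 1 powr s" using Rb[of w] BadW s by (intro powr_mono2) (auto simp: W_def)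
    then show "R w powr s \<le> 1" by simp
  qed
  moreover have "(\<Sum>w\<in>V. R w powr s) = (\<Sum>w\<in>W m. R w powr s) - (\<Sum>w\<in>Bad. R w powr s)"
    unfolding V_def by (rule sum_diff[OF Wfin BadW])
  ultimately have Vsum: "(\<Sum>w\<in>V. R w powr s) > 1"
    using m cardBad Wsum[of m] by (simp add: \<theta>_def)
  obtain \<Lambda> where \<Lambda>: "compact \<Lambda>" "\<Lambda> \<subseteq> X" "\<Lambda> = (\<Union>w\<in>V. h w ` \<Lambda>)" "hausdorff_measure dist s \<Lambda> \<noteq> 0"
  proof (rule separated_ifs_hausdorff_measure[of V X h R s])
    show "finite V" unfolding V_def using Wfin by auto
    show "h i ` X \<inter> h j ` X = {}" if "i \<in> V" "j \<in> V" "i \<noteq> j" for i j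
      using hinj[of i j] VW that by auto
  qed (use X VW hX hup Rb hlow Vsum s in auto)
  have \<Lambda>E: "\<exists>w x'. w \<in> V \<and> x' \<in> \<Lambda> \<and> x = h w x' \<and> (G ^^ m) x = x'" if "x \<in> \<Lambda>" for x
  proof -
    have "x \<in> (\<Union>w\<in>V. h w ` \<Lambda>)" using that \<Lambda>(3) by blast
    then obtain w x' where *: "w \<in> V" "x' \<in> \<Lambda>" "x = h w x'" by blast
    moreover have "(G ^^ m) x = x'" using hG[of w x'] VW[OF *(1)] * \<Lambda>(2) by auto
    ultimately show ?thesis by blast
  qed
  show thesis
  proof (rule that[OF \<Lambda>(1,2) m(2) _ _ \<Lambda>(4)])
    show "(G ^^ m) ` \<Lambda> \<subseteq> \<Lambda>" using \<Lambda>E by fastforce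
    fix a assume a: "a < m"
    show "(G ^^ a) ` \<Lambda> \<inter> Y = {}"
    proof (rule ccontr)
      assume "\<not> ?thesis"
      then obtain x where x: "x \<in> \<Lambda>" "(G ^^ a) x \<in> Y" by blast
      \<comment> \<open>From the point \<open>(G ^^ a) x\<close> of \<open>Y\<close> the orbit is
        back in \<Lambda> after \<open>j\<close> more steps, and there it lies in the cylinder of a
        kept word, which the point and \<open>j\<close> forbid. For \<open>a = 0\<close> the orbit
        is already in \<Lambda>, and \<open>j = m\<close> would fall outside the range of forbidden
        times.\<close>
      define j where "j = (if a = 0 then 0 else m - a)"
      have j: "j < m" using a unfolding j_def by auto
      have "(G ^^ j) ((G ^^ a) x) \<in> \<Lambda>"
      proof (cases "a = 0")
        case False
        then have "(G ^^ j) ((G ^^ a) x) = (G ^^ m) x"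
          using a by (simp add: j_def flip: funpow_add[THEN fun_cong, unfolded comp_apply])
        then show ?thesis using \<Lambda>E[OF x(1)] by auto
      qed (use x j_def in auto)
      then obtain w x' where w: "w \<in> V" "x' \<in> \<Lambda>" "(G ^^ j) ((G ^^ a) x) = h w x'" using \<Lambda>E by blast
      then have "w \<in> C ((G ^^ a) x, j)" unfolding C_def V_def using \<Lambda>(2) by auto
      then have "w \<in> Bad" unfolding Bad_def using x j by auto
      then show False using w unfolding V_def by blast
    qed
  qed
qed

section \<open>Growth of weighted path sums\<close>

text \<open>\<open>path_sum F w n c c'\<close> is the \<open>(c, c')\<close> entry of the \<open>n\<close>-th power of the weight matrix
  \<open>w\<close>, except that all vertices of a path after the first have to lie in \<open>F\<close>.\<close>

fun path_sum :: "'v set \<Rightarrow> ('v \<Rightarrow> 'v \<Rightarrow> real) \<Rightarrow> nat \<Rightarrow> 'v \<Rightarrow> 'v \<Rightarrow> real" where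
  "path_sum F w 0 c c' = (if c = c' then 1 else 0)"
| "path_sum F w (Suc n) c c' = (\<Sum>e\<in>F. w c e * path_sum F w n e c')"

lemma path_sum_nonneg:
  assumes "\<And>c e. w c e \<ge> 0"
  shows "path_sum F w n c c' \<ge> 0"
  using assms by (induction n arbitrary: c) (auto intro!: sum_nonneg)

lemma path_sum_Suc_outside:
  assumes "c' \<notin> F"
  shows "path_sum F w (Suc n) c c' = 0"
proof (induction n arbitrary: c)
  case 0
  show ?case using assms by (auto intro!: sum.neutral)
next
  case (Suc n)
  show ?case by (subst path_sum.simps) (use Suc in simp)
qed

text \<open>The recursive definition peels off the first edge, this peels off the last. The sum runs
  over \<open>E\<close> rather than \<open>F\<close> because for \<open>n = 0\<close> the vertex
  before the last edge is the start, which need not lie in \<open>F\<close>.\<close>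

lemma path_sum_Suc_right:
  assumes "finite E" "F \<subseteq> E" "c \<in> E" "c' \<in> F"
  shows "path_sum F w (Suc n) c c' = (\<Sum>e\<in>E. path_sum F w n c e * w e c')"
  using assms(3)
proof (induction n arbitrary: c)
  case 0
  have F: "finite F" using assms finite_subset by blast
  have "path_sum F w (Suc 0) c c' = (\<Sum>e\<in>F. if e = c' then w c e else 0)"
    by (auto intro!: sum.cong)
  also have "\<dots> = w c c'" using F assms(4) by simp
  also have "\<dots> = (\<Sum>e\<in>E. if c = e then w e c' else 0)" using assms(1) 0 by simp
  also have "\<dots> = (\<Sum>e\<in>E. path_sum F w 0 c e * w e c')" by (auto intro!: sum.cong)
  finally show ?case .
next
  case (Suc n)
  have "path_sum F w (Suc (Suc n)) c c' = (\<Sum>f\<in>F. w c f * (\<Sum>e\<in>E. path_sum F w n f e * w e c'))"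
    by (subst path_sum.simps) (use Suc assms(2) in \<open>auto intro!: sum.cong\<close>)
  also have "\<dots> = (\<Sum>f\<in>F. \<Sum>e\<in>E. w c f * path_sum F w n f e * w e c')"
    by (simp add: sum_distrib_left mult.assoc)
  also have "\<dots> = (\<Sum>e\<in>E. \<Sum>f\<in>F. w c f * path_sum F w n f e * w e c')"
    by (rule sum.swap)
  also have "\<dots> = (\<Sum>e\<in>E. path_sum F w (Suc n) c e * w e c')"
    by (simp add: sum_distrib_right)
  finally show ?case .
qed

lemma path_sum_mono:
  assumes w: "\<And>c e. w c e \<ge> 0" and "finite F'" "F \<subseteq> F'"
  shows "path_sum F w n c c' \<le> path_sum F' w n c c'"
proof (induction n arbitrary: c)
  case (Suc n)
  have "(\<Sum>e\<in>F. w c e * path_sum F w n e c') \<le> (\<Sum>e\<in>F. w c e * path_sum F' w n e c')"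
    by (intro sum_mono mult_left_mono Suc w)
  also have "\<dots> \<le> (\<Sum>e\<in>F'. w c e * path_sum F' w n e c')"
    using assms by (intro sum_mono2) (auto intro!: mult_nonneg_nonneg path_sum_nonneg)
  finally show ?case by simp
qed simp

text \<open>Splits the paths by the first time after the start at which they enter \<open>f\<close>;
  before that they use only vertices of \<open>F\<close>. The first summand collects the paths that
  never enter \<open>f\<close>.\<close>

lemma path_sum_insert_first_visit:
  assumes E: "finite E" "insert f F \<subseteq> E" and f: "f \<notin> F" and c: "c \<in> E"
  shows "path_sum (insert f F) w n c c' = path_sum F w n c c' +
    (\<Sum>i<n. (\<Sum>e\<in>E. path_sum F w i c e * w e f) * path_sum (insert f F) w (n - Suc i) f c')"
  using c
proof (induction n arbitrary: c)
  case (Suc n)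
  let ?P = "path_sum (insert f F) w" and ?Q = "path_sum F w"
  let ?T = "\<lambda>i c. \<Sum>e\<in>E. ?Q i c e * w e f"
  have fin: "finite F" using E finite_subset[of F E] by auto
  have T0: "?T 0 c = w c f"
  proof -
    have "?T 0 c = (\<Sum>e\<in>E. if c = e then w e f else 0)" by (auto intro!: sum.cong)
    then show ?thesis using E Suc.prems by simp
  qed
  have TS: "?T (Suc i) c = (\<Sum>g\<in>F. w c g * ?T i g)" for i
  proof -
    have "?T (Suc i) c = (\<Sum>e\<in>E. \<Sum>g\<in>F. w c g * (?Q i g e * w e f))"
      by (simp add: sum_distrib_right mult.assoc)
    also have "\<dots> = (\<Sum>g\<in>F. \<Sum>e\<in>E. w c g * (?Q i g e * w e f))" by (rule sum.swap)
    finally show ?thesis by (simp add: sum_distrib_left)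
  qed
  have "?P (Suc n) c c' = w c f * ?P n f c' + (\<Sum>g\<in>F. w c g * ?P n g c')"
    using f fin by simp
  also have "(\<Sum>g\<in>F. w c g * ?P n g c') =
      (\<Sum>g\<in>F. w c g * (?Q n g c' + (\<Sum>i<n. ?T i g * ?P (n - Suc i) f c')))"
    by (intro sum.cong refl arg_cong2[where f = "(*)"] Suc.IH) (use E in auto)
  also have "\<dots> = ?Q (Suc n) c c' + (\<Sum>g\<in>F. \<Sum>i<n. w c g * (?T i g * ?P (n - Suc i) f c'))"
    by (simp add: distrib_left sum.distrib sum_distrib_left)
  also have "(\<Sum>g\<in>F. \<Sum>i<n. w c g * (?T i g * ?P (n - Suc i) f c')) =
      (\<Sum>i<n. \<Sum>g\<in>F. w c g * (?T i g * ?P (n - Suc i) f c'))" by (rule sum.swap)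
  also have "\<dots> = (\<Sum>i<n. ?T (Suc i) c * ?P (n - Suc i) f c')"
    unfolding TS by (simp add: sum_distrib_right mult.assoc)
  finally have "?P (Suc n) c c' = ?Q (Suc n) c c' +
      (?T 0 c * ?P n f c' + (\<Sum>i<n. ?T (Suc i) c * ?P (n - Suc i) f c'))"
    unfolding T0 by linarith
  also have "?T 0 c * ?P n f c' + (\<Sum>i<n. ?T (Suc i) c * ?P (n - Suc i) f c') =
      (\<Sum>i<Suc n. ?T i c * ?P (Suc n - Suc i) f c')"
    by (subst sum.lessThan_Suc_shift) simp
  finally show ?case .
qed simp

text \<open>Splits a path from \<open>f\<close> at its last visit to \<open>f\<close>, into a loop
  at \<open>f\<close> and a path that does not return. The induction runs along the last edge; end
  vertices outside \<open>insert f F\<close> are harmless because only an upper bound is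
  claimed.\<close>

lemma path_sum_insert_last_visit:
  assumes E: "finite E" "insert f F \<subseteq> E" and f: "f \<notin> F" and w: "\<And>c e. w c e \<ge> 0" and c': "c' \<in> E"
  shows "path_sum (insert f F) w n f c' \<le>
    (\<Sum>i\<le>n. path_sum (insert f F) w i f f * path_sum F w (n - i) f c')"
  using c'
proof (induction n arbitrary: c')
  case (Suc n)
  let ?P = "path_sum (insert f F) w" and ?Q = "path_sum F w"
  have rhs: "0 \<le> (\<Sum>i\<le>m. ?P i f f * ?Q (m - i) f c')" for m
    by (intro sum_nonneg mult_nonneg_nonneg path_sum_nonneg w)
  consider "c' = f" | "c' \<in> F" | "c' \<notin> insert f F" by blast
  then show ?case
  proof cases
    case 1
    have "?P (Suc n) f f * ?Q (Suc n - Suc n) f f \<le> (\<Sum>i\<le>Suc n. ?P i f f * ?Q (Suc n - i) f f)"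
      by (rule member_le_sum) (auto intro!: mult_nonneg_nonneg path_sum_nonneg w simp del: path_sum.simps)
    then show ?thesis using 1 by simp
  next
    case 2
    have "?P (Suc n) f c' = (\<Sum>e\<in>E. ?P n f e * w e c')"
      by (rule path_sum_Suc_right) (use E 2 in auto)
    also have "\<dots> \<le> (\<Sum>e\<in>E. (\<Sum>i\<le>n. ?P i f f * ?Q (n - i) f e) * w e c')"
      by (intro sum_mono mult_right_mono Suc.IH w)
    also have "\<dots> = (\<Sum>e\<in>E. \<Sum>i\<le>n. ?P i f f * (?Q (n - i) f e * w e c'))"
      by (simp add: sum_distrib_right mult.assoc)
    also have "\<dots> = (\<Sum>i\<le>n. \<Sum>e\<in>E. ?P i f f * (?Q (n - i) f e * w e c'))" by (rule sum.swap)
    also have "\<dots> = (\<Sum>i\<le>n. ?P i f f * (\<Sum>e\<in>E. ?Q (n - i) f e * w e c'))"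
      by (simp add: sum_distrib_left)
    also have "\<dots> = (\<Sum>i\<le>n. ?P i f f * ?Q (Suc (n - i)) f c')"
      by (intro sum.cong refl arg_cong2[where f = "(*)"] path_sum_Suc_right[symmetric]) (use E 2 in auto)
    also have "\<dots> = (\<Sum>i\<le>n. ?P i f f * ?Q (Suc n - i) f c')"
      by (intro sum.cong refl) (simp add: Suc_diff_le del: path_sum.simps)
    also have "\<dots> \<le> (\<Sum>i\<le>Suc n. ?P i f f * ?Q (Suc n - i) f c')"
      by (rule sum_mono2) (auto intro!: mult_nonneg_nonneg path_sum_nonneg w simp del: path_sum.simps)
    finally show ?thesis .
  next
    case 3
    then have "?P (Suc n) f c' = 0" by (rule path_sum_Suc_outside)
    then show ?thesis using rhs[of "Suc n"] by (simp only:)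
  qed
qed simp

lemma path_sum_polynomial_bound:
  assumes E: "finite E" and w: "\<And>c e. w c e \<ge> 0"
    and loops: "\<And>n c. c \<in> E \<Longrightarrow> path_sum E w n c c \<le> 1"
  shows "\<exists>C D. \<forall>n. \<forall>c\<in>E. \<forall>c'\<in>E. path_sum E w n c c' \<le> C * real (n + 1) ^ D"
proof -
  have "\<exists>C D. C \<ge> 0 \<and> (\<forall>n. \<forall>c\<in>E. \<forall>c'\<in>E. path_sum F w n c c' \<le> C * real (n + 1) ^ D)"
    if "F \<subseteq> E" for F
    using finite_subset[OF that E] that
  proof (induction F rule: finite_induct)
    case empty
    have "path_sum {} w n c c' \<le> 1" for n c c' by (cases n) auto
    then show ?case by (intro exI[of _ 1] exI[of _ 0]) auto
  next
    case (insert f F)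
    then obtain C D where C: "C \<ge> 0"
      and CD: "\<And>n c c'. c \<in> E \<Longrightarrow> c' \<in> E \<Longrightarrow> path_sum F w n c c' \<le> C * real (n + 1) ^ D" by blast
    let ?P = "path_sum (insert f F) w" and ?Q = "path_sum F w"
    have fE: "f \<in> E" using insert by auto
    have mono: "C * real (i + 1) ^ D \<le> C * real (n + 1) ^ D" if "i \<le> n" for i n
      using that C by (intro mult_left_mono power_mono) auto
    have Pf: "?P n f c' \<le> C * real (n + 1) ^ Suc D" if c': "c' \<in> E" for n c'
    proof -
      have "?P n f c' \<le> (\<Sum>i\<le>n. ?P i f f * ?Q (n - i) f c')"
        by (rule path_sum_insert_last_visit) (use E insert w c' in auto)
      also have "\<dots> \<le> (\<Sum>i\<le>n. 1 * (C * real (n + 1) ^ D))"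
      proof (intro sum_mono mult_mono)
        fix i assume "i \<in> {..n}"
        show "?P i f f \<le> 1"
          using path_sum_mono[OF w E insert.prems] loops[OF fE] by (rule order_trans)
        show "?Q (n - i) f c' \<le> C * real (n + 1) ^ D"
          using CD[OF fE c', of "n - i"] mono[of "n - i" n] by linarith
      qed (auto intro: path_sum_nonneg w)
      also have "\<dots> = C * real (n + 1) ^ Suc D" by simp
      finally show ?thesis .
    qed
    define M where "M = (\<Sum>e\<in>E. w e f)"
    have M: "M \<ge> 0" unfolding M_def by (intro sum_nonneg w)
    have "?P n c c' \<le> (C + C * M * C) * real (n + 1) ^ (2 * D + 2)" if c: "c \<in> E" and c': "c' \<in> E" for n c c'
    proof -
      let ?N = "real (n + 1)"
      have "?P n c c' = ?Q n c c' + (\<Sum>i<n. (\<Sum>e\<in>E. ?Q i c e * w e f) * ?P (n - Suc i) f c')"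
        by (rule path_sum_insert_first_visit) (use E insert c in auto)
      also have "\<dots> \<le> C * ?N ^ D + (\<Sum>i<n. (C * ?N ^ D * M) * (C * ?N ^ Suc D))"
      proof (intro add_mono sum_mono mult_mono CD c c')
        fix i assume i: "i \<in> {..<n}"
        have "(\<Sum>e\<in>E. ?Q i c e * w e f) \<le> (\<Sum>e\<in>E. (C * ?N ^ D) * w e f)"
        proof (intro sum_mono mult_right_mono w)
          fix e assume "e \<in> E"
          then show "?Q i c e \<le> C * ?N ^ D" using CD[OF c, of e i] mono[of i n] i by auto
        qed
        then show "(\<Sum>e\<in>E. ?Q i c e * w e f) \<le> C * ?N ^ D * M"
          by (simp add: M_def sum_distrib_left)
        have "C * real (n - Suc i + 1) ^ Suc D \<le> C * ?N ^ Suc D"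
          using C by (intro mult_left_mono power_mono) auto
        then show "?P (n - Suc i) f c' \<le> C * ?N ^ Suc D" using Pf[OF c', of "n - Suc i"] by linarith
      qed (use C M in \<open>auto intro!: path_sum_nonneg w simp del: power_Suc\<close>)
      also have "(\<Sum>i<n. (C * ?N ^ D * M) * (C * ?N ^ Suc D)) = real n * ((C * M * C) * ?N ^ (2 * D + 1))"
      proof -
        have "(C * x ^ D * M) * (C * x ^ Suc D) = (C * M * C) * x ^ (2 * D + 1)" for x
          by (simp add: mult_2 power_add)
        from this[of ?N] show ?thesis by (simp only: sum_constant card_lessThan)
      qed
      also have "\<dots> \<le> ?N * ((C * M * C) * ?N ^ (2 * D + 1))"
        using C M by (intro mult_right_mono) auto
      also have "?N * ((C * M * C) * ?N ^ (2 * D + 1)) = (C * M * C) * ?N ^ (2 * D + 2)"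
        by simp
      also have "C * ?N ^ D \<le> C * ?N ^ (2 * D + 2)"
        using C by (intro mult_left_mono power_increasing) auto
      finally show ?thesis by (simp add: algebra_simps)
    qed
    moreover have "C + C * M * C \<ge> 0" using C M by simp
    ultimately show ?case by blast
  qed
  from this[OF subset_refl] show ?thesis by blast
qed

lemma path_sum_exponential_loop:
  assumes E: "finite E" and w: "\<And>c e. w c e \<ge> 0" and \<kappa>: "\<kappa> > 0" and q: "q > 1"
    and growth: "\<And>n. n \<ge> n0 \<Longrightarrow> \<kappa> * q ^ n \<le> (\<Sum>c\<in>E. \<Sum>c'\<in>E. path_sum E w n c c')"
  obtains n c where "c \<in> E" "path_sum E w n c c > 1"
proof (rule ccontr)
  note found = that
  assume "\<not> thesis"
  then have "path_sum E w n c c \<le> 1" if c: "c \<in> E" for n c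
    using found[OF c, of n] by (cases "path_sum E w n c c \<le> 1") auto
  with path_sum_polynomial_bound[of E w, OF E w] obtain C D where
    CD: "\<And>n c c'. c \<in> E \<Longrightarrow> c' \<in> E \<Longrightarrow> path_sum E w n c c' \<le> C * real (n + 1) ^ D" by blast
  define B where "B = real (card E) * (real (card E) * C)"
  have le: "\<kappa> * q ^ n \<le> B * real (n + 1) ^ D" if "n \<ge> n0" for n
  proof -
    have "\<kappa> * q ^ n \<le> (\<Sum>c\<in>E. \<Sum>c'\<in>E. path_sum E w n c c')" by (rule growth[OF that])
    also have "\<dots> \<le> (\<Sum>c\<in>E. \<Sum>c'\<in>E. C * real (n + 1) ^ D)" by (intro sum_mono CD)
    also have "\<dots> = B * real (n + 1) ^ D" by (simp add: B_def)
    finally show ?thesis .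
  qed
  have "((\<lambda>n::nat. B * real (n + 1) ^ D / (\<kappa> * q ^ n)) \<longlongrightarrow> 0) at_top"
    using q \<kappa> by real_asymp
  then have "\<forall>\<^sub>F n in at_top. B * real (n + 1) ^ D / (\<kappa> * q ^ n) < 1"
    by (rule order_tendstoD) simp
  then have "\<forall>\<^sub>F n in at_top. B * real (n + 1) ^ D / (\<kappa> * q ^ n) < 1 \<and> n \<ge> n0"
    by (intro eventually_conj eventually_ge_at_top)
  then obtain n where n: "B * real (n + 1) ^ D / (\<kappa> * q ^ n) < 1" "n \<ge> n0"
    by (auto simp: eventually_at_top_linorder)
  have "\<kappa> * q ^ n > 0" using \<kappa> q by simp
  then show False using le[OF n(2)] n(1) by (simp add: divide_less_eq del: zero_less_mult_iff)
qed

section \<open>Inverse branches of an expanding open map\<close>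

lemma finite_separated_subset_compact:
  fixes K :: "'a::metric_space set"
  assumes K: "compact K" "A \<subseteq> K" and r: "r > 0"
    and sep: "\<And>x y. x \<in> A \<Longrightarrow> y \<in> A \<Longrightarrow> dist x y < r \<Longrightarrow> x = y"
  shows "finite A"
proof -
  obtain k where k: "finite k" "K \<subseteq> (\<Union>x\<in>k. ball x (r/2))"
    using compact_imp_seq_compact[OF K(1)] seq_compact_imp_totally_bounded r by (metis half_gt_zero)
  then have "\<exists>c\<in>k. dist c x < r/2" if "x \<in> A" for x using that K(2) by (auto dest!: subsetD)
  then obtain c where c: "\<And>x. x \<in> A \<Longrightarrow> c x \<in> k \<and> dist (c x) x < r/2" by metis
  have "inj_on c A"
  proof (rule inj_onI)
    fix x y assume xy: "x \<in> A" "y \<in> A" "c x = c y"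
    have "dist x y \<le> dist (c x) x + dist (c y) y" using xy(3) by (metis dist_commute dist_triangle)
    also have "\<dots> < r" using c[OF xy(1)] c[OF xy(2)] by linarith
    finally show "x = y" by (rule sep[OF xy(1,2)])
  qed
  moreover have "c ` A \<subseteq> k" using c by auto
  ultimately show ?thesis using k(1) by (metis finite_imageD finite_subset)
qed

text \<open>In use \<open>S\<close> is an iterate of the map, \<open>L\<close> its derivative, and
  \<tau> picks a nearby vertex of the finite net \<open>E\<close>. The constants fit together as
  follows: \<open>\<epsilon> \<le> 1/3\<close> and \<open>L x \<ge> 2\<close> give expansion by 3/2,
  so inverse branches contract by 2/3; \<open>2/3 * \<rho> + \<rho> / 3 = \<rho>\<close> sends cells
  into cells; \<open>2 * \<rho> \<le> r0\<close> keeps the branches at different points of a fibre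
  apart.\<close>

locale open_expanding_net =
  fixes K :: "'a::heine_borel set" and S :: "'a \<Rightarrow> 'a" and L :: "'a \<Rightarrow> real"
    and \<epsilon> r0 \<rho> :: real and E :: "'a set" and \<tau> :: "'a \<Rightarrow> 'a"
  assumes K: "compact K" and SK: "\<And>x. x \<in> K \<Longrightarrow> S x \<in> K"
    and \<epsilon>: "0 < \<epsilon>" "\<epsilon> \<le> 1/3"
    and L2: "\<And>x. x \<in> K \<Longrightarrow> L x \<ge> 2"
    and ratio: "\<And>u v v'. u \<in> K \<Longrightarrow> v \<in> K \<Longrightarrow> v' \<in> K \<Longrightarrow> dist u v < r0 \<Longrightarrow> dist u v' < r0 \<Longrightarrow>
      L u / (1 + \<epsilon>) * dist v v' \<le> dist (S v) (S v') \<and> dist (S v) (S v') \<le> (1 + \<epsilon>) * L u * dist v v'"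
    and lift: "\<And>x w. x \<in> K \<Longrightarrow> w \<in> K \<Longrightarrow> dist (S x) w \<le> \<rho> \<Longrightarrow> \<exists>\<xi>\<in>K. dist x \<xi> < r0 \<and> S \<xi> = w"
    and \<rho>: "0 < \<rho>" "2 * \<rho> \<le> r0"
    and E: "finite E" "E \<subseteq> K"
    and \<tau>: "\<And>x. x \<in> K \<Longrightarrow> \<tau> x \<in> E \<and> dist x (\<tau> x) \<le> \<rho> / 3"
begin

definition fibre :: "'a \<Rightarrow> 'a set" where "fibre c = {\<xi> \<in> K. S \<xi> = c}"
definition cell :: "'a \<Rightarrow> 'a set" where "cell c = K \<inter> cball c \<rho>"
text \<open>The branch of the inverse of \<open>S\<close> near \<xi>, meaningful on
  \<open>cell (S \<xi>)\<close>: existence comes from \<open>lift\<close>, uniqueness from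
  injectivity of \<open>S\<close> on \<open>r0\<close>-balls.\<close>

definition inv_branch :: "'a \<Rightarrow> 'a \<Rightarrow> 'a" where
  "inv_branch \<xi> y = (SOME x. x \<in> K \<and> dist \<xi> x < r0 \<and> S x = y)"

lemma r0: "r0 > 0" using \<rho> by linarith

lemma expand:
  assumes "u \<in> K" "v \<in> K" "v' \<in> K" "dist u v < r0" "dist u v' < r0"
  shows "3/2 * dist v v' \<le> dist (S v) (S v')"
proof -
  have "3/2 * (1 + \<epsilon>) \<le> 2" using \<epsilon> by (simp add: field_simps)
  then have "3/2 * (1 + \<epsilon>) \<le> L u" using L2[OF assms(1)] by (rule order_trans)
  then have "3/2 \<le> L u / (1 + \<epsilon>)" using \<epsilon> by (simp add: field_simps)
  then have "3/2 * dist v v' \<le> L u / (1 + \<epsilon>) * dist v v'" by (rule mult_right_mono) simp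
  then show ?thesis using ratio[OF assms] by linarith
qed

lemma S_inj:
  assumes "u \<in> K" "v \<in> K" "v' \<in> K" "dist u v < r0" "dist u v' < r0" "S v = S v'"
  shows "v = v'"
  using expand[OF assms(1-5)] assms(6) by simp

lemma fibre_eq:
  assumes "\<xi> \<in> fibre c" "\<xi>' \<in> fibre c" "dist \<xi> \<xi>' < r0"
  shows "\<xi> = \<xi>'"
  by (rule S_inj[of \<xi>]) (use assms r0 in \<open>auto simp: fibre_def\<close>)

lemma finite_fibre: "finite (fibre c)"
  by (rule finite_separated_subset_compact[OF K _ r0 fibre_eq]) (auto simp: fibre_def)

lemma inv_branch:
  assumes "\<xi> \<in> K" "y \<in> cell (S \<xi>)"
  shows "inv_branch \<xi> y \<in> K" "dist \<xi> (inv_branch \<xi> y) \<le> 2/3 * \<rho>" "S (inv_branch \<xi> y) = y"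
    "dist \<xi> (inv_branch \<xi> y) < r0"
proof -
  have "\<exists>x. x \<in> K \<and> dist \<xi> x < r0 \<and> S x = y"
    using lift[of \<xi> y] assms by (auto simp: cell_def)
  then have *: "inv_branch \<xi> y \<in> K \<and> dist \<xi> (inv_branch \<xi> y) < r0 \<and> S (inv_branch \<xi> y) = y"
    unfolding inv_branch_def by (rule someI_ex)
  have "3/2 * dist \<xi> (inv_branch \<xi> y) \<le> dist (S \<xi>) (S (inv_branch \<xi> y))"
    by (rule expand[of \<xi>]) (use * assms r0 in auto)
  then have "3/2 * dist \<xi> (inv_branch \<xi> y) \<le> \<rho>" using * assms by (auto simp: cell_def)
  then show "inv_branch \<xi> y \<in> K" "dist \<xi> (inv_branch \<xi> y) \<le> 2/3 * \<rho>" "S (inv_branch \<xi> y) = y"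
    "dist \<xi> (inv_branch \<xi> y) < r0" using * by auto
qed

lemma inv_branch_eq:
  assumes "\<xi> \<in> K" "x \<in> K" "dist \<xi> x < r0" "S x \<in> cell (S \<xi>)"
  shows "inv_branch \<xi> (S x) = x"
  by (rule S_inj[of \<xi>]) (use assms inv_branch[OF assms(1,4)] in auto)

text \<open>Values of the branch lie within \<open>2/3 * \<rho>\<close> of \<xi>, and
  \<open>\<tau> \<xi>\<close> within \<open>\<rho> / 3\<close> of it. This is what allows branches
  to be composed along the graph.\<close>

lemma inv_branch_cell:
  assumes "\<xi> \<in> K" "y \<in> cell (S \<xi>)"
  shows "inv_branch \<xi> y \<in> cell (\<tau> \<xi>)"
proof -
  have "dist (\<tau> \<xi>) (inv_branch \<xi> y) \<le> dist \<xi> (\<tau> \<xi>) + dist \<xi> (inv_branch \<xi> y)"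
    by (metis dist_commute dist_triangle)
  then show ?thesis using inv_branch[OF assms] \<tau>[OF assms(1)] by (auto simp: cell_def)
qed

text \<open>The guaranteed contraction ratio of \<open>inv_branch \<xi>\<close>; the upper ratio is
  larger by \<open>(1 + \<epsilon>)^2\<close>. Weights use the lower ratio because the measure bound
  for the limit set needs it.\<close>

definition contr :: "'a \<Rightarrow> real" where "contr \<xi> = 1 / ((1 + \<epsilon>) * L \<xi>)"

lemma contr: "\<xi> \<in> K \<Longrightarrow> 0 < contr \<xi>" "\<xi> \<in> K \<Longrightarrow> contr \<xi> \<le> 1/2"
    "\<xi> \<in> K \<Longrightarrow> (1 + \<epsilon>)\<^sup>2 * contr \<xi> \<le> 2/3"
proof -
  assume "\<xi> \<in> K"
  then have L: "L \<xi> \<ge> 2" by (rule L2)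
  show "0 < contr \<xi>" using L \<epsilon> by (simp add: contr_def)
  have "1 * 2 \<le> (1 + \<epsilon>) * L \<xi>" using L \<epsilon> by (intro mult_mono) auto
  then show "contr \<xi> \<le> 1/2" unfolding contr_def by (simp add: field_simps)
  have "(1 + \<epsilon>)\<^sup>2 * contr \<xi> = (1 + \<epsilon>) / L \<xi>" using L \<epsilon> by (simp add: contr_def power2_eq_square)
  also have "\<dots> \<le> 2/3" using L \<epsilon> by (simp add: field_simps)
  finally show "(1 + \<epsilon>)\<^sup>2 * contr \<xi> \<le> 2/3" .
qed

lemma inv_branch_dist:
  assumes "\<xi> \<in> K" "y \<in> cell (S \<xi>)" "y' \<in> cell (S \<xi>)"
  shows "contr \<xi> * dist y y' \<le> dist (inv_branch \<xi> y) (inv_branch \<xi> y')"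
    "dist (inv_branch \<xi> y) (inv_branch \<xi> y') \<le> (1 + \<epsilon>)\<^sup>2 * contr \<xi> * dist y y'"
proof -
  have L: "L \<xi> > 0" using L2[OF assms(1)] by simp
  have pos: "0 < (1 + \<epsilon>) * L \<xi>" using L \<epsilon> by simp
  let ?d = "dist (inv_branch \<xi> y) (inv_branch \<xi> y')"
  have *: "L \<xi> / (1 + \<epsilon>) * ?d \<le> dist y y'" "dist y y' \<le> (1 + \<epsilon>) * L \<xi> * ?d"
    using ratio[OF assms(1) inv_branch(1)[OF assms(1,2)] inv_branch(1)[OF assms(1,3)]
      inv_branch(4)[OF assms(1,2)] inv_branch(4)[OF assms(1,3)]]
    using inv_branch(3)[OF assms(1,2)] inv_branch(3)[OF assms(1,3)] by auto
  show "contr \<xi> * dist y y' \<le> ?d"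
    using *(2) pos by (simp add: contr_def divide_le_eq mult.commute)
  have "?d \<le> (1 + \<epsilon>) / L \<xi> * dist y y'" using *(1) L \<epsilon> by (simp add: field_simps)
  also have "(1 + \<epsilon>) / L \<xi> = (1 + \<epsilon>)\<^sup>2 * contr \<xi>" using L \<epsilon> by (simp add: contr_def power2_eq_square)
  finally show "?d \<le> (1 + \<epsilon>)\<^sup>2 * contr \<xi> * dist y y'" .
qed

text \<open>Both fibre points lie within \<open>2/3 * \<rho>\<close> of the common value, hence
  within \<open>4/3 * \<rho> < r0\<close> of each other.\<close>

lemma inv_branch_disjoint:
  assumes "\<xi> \<in> fibre c" "\<xi>' \<in> fibre c" "y \<in> cell c" "y' \<in> cell c" "inv_branch \<xi> y = inv_branch \<xi>' y'"
  shows "\<xi> = \<xi>'"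
proof (rule fibre_eq[OF assms(1,2)])
  have *: "dist \<xi> (inv_branch \<xi> y) \<le> 2/3 * \<rho>" "dist \<xi>' (inv_branch \<xi>' y') \<le> 2/3 * \<rho>"
    using assms inv_branch(2)[of \<xi> y] inv_branch(2)[of \<xi>' y'] by (auto simp: fibre_def)
  have "dist \<xi> \<xi>' \<le> dist \<xi> (inv_branch \<xi> y) + dist \<xi>' (inv_branch \<xi>' y')"
    unfolding assms(5) by (metis dist_commute dist_triangle)
  then show "dist \<xi> \<xi>' < r0" using * \<rho> by linarith
qed

text \<open>A path is a list of fibre points \<open>\<xi>\<^sub>1, \<xi>\<^sub>2, \<dots>\<close>, where \<open>S \<xi>\<^sub>1\<close> is the starting vertex and
  \<open>S \<xi>\<^sub>k\<^sub>+\<^sub>1 = \<tau> \<xi>\<^sub>k\<close>. Paths with the same starting vertex and length have disjoint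
  branches, so that nothing is counted twice although the cells overlap.\<close>

fun paths :: "nat \<Rightarrow> 'a \<Rightarrow> 'a list set" where
  "paths 0 c = {[]}"
| "paths (Suc n) c = (\<lambda>(\<xi>, ps). \<xi> # ps) ` (SIGMA \<xi>:fibre c. paths n (\<tau> \<xi>))"

fun endpoint :: "'a \<Rightarrow> 'a list \<Rightarrow> 'a" where
  "endpoint c [] = c"
| "endpoint c (\<xi> # ps) = endpoint (\<tau> \<xi>) ps"

text \<open>The head acts first, so a path runs backwards in time under \<open>S\<close>: a path of
  length \<open>n\<close> from \<open>c\<close> maps \<open>cell c\<close> into the cell of its
  endpoint, and \<open>S ^^ n\<close> undoes it.\<close>

fun branch :: "'a list \<Rightarrow> 'a \<Rightarrow> 'a" where
  "branch [] y = y"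
| "branch (\<xi> # ps) y = branch ps (inv_branch \<xi> y)"

definition path_contr :: "'a list \<Rightarrow> real" where "path_contr ps = prod_list (map contr ps)"

lemma path_contr_simps: "path_contr [] = 1" "path_contr (\<xi> # ps) = contr \<xi> * path_contr ps"
  by (auto simp: path_contr_def)

lemma fibre_K: "\<xi> \<in> fibre c \<Longrightarrow> \<xi> \<in> K" and fibre_S: "\<xi> \<in> fibre c \<Longrightarrow> S \<xi> = c"
  by (auto simp: fibre_def)

lemma \<tau>E: "x \<in> K \<Longrightarrow> \<tau> x \<in> E" using \<tau> by blast

lemma finite_paths: "finite (paths n c)"
  by (induction n arbitrary: c) (auto intro!: finite_imageI finite_SigmaI finite_fibre)

lemma endpoint_E: "ps \<in> paths n c \<Longrightarrow> c \<in> E \<Longrightarrow> endpoint c ps \<in> E"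
proof (induction n arbitrary: c ps)
  case (Suc n)
  then obtain \<xi> qs where q: "ps = \<xi> # qs" "\<xi> \<in> fibre c" "qs \<in> paths n (\<tau> \<xi>)" by auto
  then show ?case using Suc.IH[OF q(3) \<tau>E[OF fibre_K[OF q(2)]]] by simp
qed simp

lemma branch_cell:
  "ps \<in> paths n c \<Longrightarrow> y \<in> cell c \<Longrightarrow> branch ps y \<in> cell (endpoint c ps) \<and> (S ^^ n) (branch ps y) = y"
proof (induction n arbitrary: c ps y)
  case (Suc n)
  then obtain \<xi> qs where q: "ps = \<xi> # qs" "\<xi> \<in> fibre c" "qs \<in> paths n (\<tau> \<xi>)" by auto
  have y: "y \<in> cell (S \<xi>)" using Suc.prems q fibre_S by simp
  show ?case using Suc.IH[OF q(3) inv_branch_cell[OF fibre_K[OF q(2)] y]] q inv_branch(3)[OF fibre_K[OF q(2)] y]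
    by simp
qed auto

text \<open>Even when the distortion of every step is charged, each step contracts by 2/3; this
  makes the level-\<open>n\<close> covers arbitrarily fine.\<close>

lemma path_contr_bounds:
  "ps \<in> paths n c \<Longrightarrow> 0 < path_contr ps \<and> path_contr ps \<le> (1/2) ^ n \<and> (1 + \<epsilon>) ^ (2 * n) * path_contr ps \<le> (2/3) ^ n"
proof (induction n arbitrary: c ps)
  case (Suc n)
  then obtain \<xi> qs where q: "ps = \<xi> # qs" "\<xi> \<in> fibre c" "qs \<in> paths n (\<tau> \<xi>)" by auto
  note IH = Suc.IH[OF q(3)] and c = contr[OF fibre_K[OF q(2)]]
  have "contr \<xi> * path_contr qs \<le> 1/2 * (1/2) ^ n" using IH c by (intro mult_mono) auto
  moreover have "(1 + \<epsilon>)\<^sup>2 * contr \<xi> * ((1 + \<epsilon>) ^ (2 * n) * path_contr qs) \<le> 2/3 * (2/3) ^ n"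
    using IH c \<epsilon> by (intro mult_mono) auto
  ultimately show ?case using IH c by (simp add: q(1) path_contr_simps power_add power2_eq_square mult.assoc mult.left_commute)
qed (auto simp: path_contr_simps)

text \<open>The bounds of the single steps multiply, so upper and lower bound drift apart by
  \<open>(1 + \<epsilon>) ^ (2 * n)\<close>; \<open>loops_exist\<close> absorbs this factor.\<close>

lemma branch_dist:
  "ps \<in> paths n c \<Longrightarrow> y \<in> cell c \<Longrightarrow> y' \<in> cell c \<Longrightarrow>
    path_contr ps * dist y y' \<le> dist (branch ps y) (branch ps y') \<and>
    dist (branch ps y) (branch ps y') \<le> (1 + \<epsilon>) ^ (2 * n) * path_contr ps * dist y y'"
proof (induction n arbitrary: c ps y y')
  case (Suc n)
  then obtain \<xi> qs where q: "ps = \<xi> # qs" "\<xi> \<in> fibre c" "qs \<in> paths n (\<tau> \<xi>)" by auto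
  have y: "y \<in> cell (S \<xi>)" "y' \<in> cell (S \<xi>)" using Suc.prems q fibre_S by auto
  note \<xi> = fibre_K[OF q(2)]
  let ?z = "inv_branch \<xi> y" and ?z' = "inv_branch \<xi> y'"
  note IH = Suc.IH[OF q(3) inv_branch_cell[OF \<xi> y(1)] inv_branch_cell[OF \<xi> y(2)]]
  note b = path_contr_bounds[OF q(3)]
  have "path_contr qs * (contr \<xi> * dist y y') \<le> path_contr qs * dist ?z ?z'"
    using inv_branch_dist(1)[OF \<xi> y] b by (intro mult_left_mono) auto
  moreover have "(1 + \<epsilon>) ^ (2 * n) * path_contr qs * dist ?z ?z' \<le>
      (1 + \<epsilon>) ^ (2 * n) * path_contr qs * ((1 + \<epsilon>)\<^sup>2 * contr \<xi> * dist y y')"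
    using inv_branch_dist(2)[OF \<xi> y] b \<epsilon> by (intro mult_left_mono) auto
  ultimately show ?case using IH
    by (simp add: q(1) path_contr_simps power_add power2_eq_square algebra_simps)
qed (auto simp: path_contr_simps)

text \<open>Applying \<open>S ^^ n\<close> to the common point recovers the values after the first
  edge, and these determine that edge by disjointness of the inverse branches; the tails follow by
  induction.\<close>

lemma branch_disjoint:
  "ps \<in> paths n c \<Longrightarrow> ps' \<in> paths n c \<Longrightarrow> y \<in> cell c \<Longrightarrow> y' \<in> cell c \<Longrightarrow> branch ps y = branch ps' y' \<Longrightarrow> ps = ps'"
proof (induction n arbitrary: c ps ps' y y')
  case (Suc n)
  then obtain \<xi> qs where q: "ps = \<xi> # qs" "\<xi> \<in> fibre c" "qs \<in> paths n (\<tau> \<xi>)" by auto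
  from Suc obtain \<xi>' qs' where q': "ps' = \<xi>' # qs'" "\<xi>' \<in> fibre c" "qs' \<in> paths n (\<tau> \<xi>')" by auto
  have y: "y \<in> cell (S \<xi>)" "y' \<in> cell (S \<xi>')" using Suc.prems q q' fibre_S by auto
  note z = inv_branch_cell[OF fibre_K[OF q(2)] y(1)] inv_branch_cell[OF fibre_K[OF q'(2)] y(2)]
  have eq: "branch qs (inv_branch \<xi> y) = branch qs' (inv_branch \<xi>' y')" using Suc.prems q q' by simp
  have "inv_branch \<xi> y = (S ^^ n) (branch qs (inv_branch \<xi> y))"
    using branch_cell[OF q(3) z(1)] by simp
  also have "\<dots> = inv_branch \<xi>' y'"
    unfolding eq using branch_cell[OF q'(3) z(2)] by simp
  finally have "\<xi> = \<xi>'" by (rule inv_branch_disjoint[OF q(2) q'(2) Suc.prems(3,4)])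
  then show ?case using Suc.IH[of qs "\<tau> \<xi>" qs'] q q' z eq by auto
qed auto

lemma funpow_K: "x \<in> K \<Longrightarrow> (S ^^ n) x \<in> K"
  by (induction n) (auto intro: SK)

text \<open>Openness supplies the next edge: lifting the vertex \<open>c\<close> near
  \<open>z = (S ^^ n) x\<close> gives a fibre point \<xi> whose branch carries \<open>S z\<close>
  back to \<open>z\<close>. Then \<open>z\<close> lies in \<open>cell (\<tau> \<xi>)\<close>, and
  the argument repeats from there.\<close>

lemma branch_cover:
  "x \<in> K \<Longrightarrow> (S ^^ n) x \<in> cell c \<Longrightarrow> c \<in> K \<Longrightarrow> \<exists>ps\<in>paths n c. branch ps ((S ^^ n) x) = x"
proof (induction n arbitrary: c)
  case (Suc n)
  define z where "z = (S ^^ n) x"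
  have z: "z \<in> K" "S z \<in> cell c" using Suc.prems funpow_K by (auto simp: z_def)
  obtain \<xi> where \<xi>: "\<xi> \<in> K" "dist z \<xi> < r0" "S \<xi> = c"
    using lift[of z c] z Suc.prems by (auto simp: cell_def dist_commute)
  have c: "S z \<in> cell (S \<xi>)" using z \<xi> by simp
  have eq: "inv_branch \<xi> (S z) = z"
    by (rule inv_branch_eq) (use z \<xi> in \<open>auto simp: dist_commute\<close>)
  then have "z \<in> cell (\<tau> \<xi>)" using inv_branch_cell[OF \<xi>(1) c] by simp
  then obtain ps where ps: "ps \<in> paths n (\<tau> \<xi>)" "branch ps z = x"
    using Suc.IH[of "\<tau> \<xi>"] Suc.prems(1) \<tau>E[OF \<xi>(1)] E(2) by (auto simp: z_def)
  have "\<xi> # ps \<in> paths (Suc n) c" using ps \<xi> by (auto simp: fibre_def)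
  moreover have "branch (\<xi> # ps) (S z) = x" using eq ps by simp
  ultimately show ?case unfolding z_def by (intro bexI[of _ "\<xi> # ps"]) simp_all
qed simp

text \<open>Parallel edges from \<open>c\<close> to \<open>e\<close> are merged into one matrix
  entry, since \<open>path_sum\<close> sees only vertices.\<close>

definition weight :: "real \<Rightarrow> 'a \<Rightarrow> 'a \<Rightarrow> real" where
  "weight s c e = (\<Sum>\<xi> | \<xi> \<in> fibre c \<and> \<tau> \<xi> = e. contr \<xi> powr s)"

lemma path_sum_weight:
  assumes "c \<in> E"
  shows "(\<Sum>ps | ps \<in> paths n c \<and> endpoint c ps = c'. path_contr ps powr s) = path_sum E (weight s) n c c'"
  using assms
proof (induction n arbitrary: c)
  case 0
  have "{ps. ps \<in> paths 0 c \<and> endpoint c ps = c'} = (if c = c' then {[]} else {})" by auto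
  then show ?case by (simp add: path_contr_simps)
next
  case (Suc n)
  let ?Q = "\<lambda>\<xi>. {ps. ps \<in> paths n (\<tau> \<xi>) \<and> endpoint (\<tau> \<xi>) ps = c'}"
  have eq: "{ps. ps \<in> paths (Suc n) c \<and> endpoint c ps = c'} = (\<lambda>(\<xi>, ps). \<xi> # ps) ` (SIGMA \<xi>:fibre c. ?Q \<xi>)"
    by auto
  have "(\<Sum>ps | ps \<in> paths (Suc n) c \<and> endpoint c ps = c'. path_contr ps powr s) =
      (\<Sum>(\<xi>, ps)\<in>(SIGMA \<xi>:fibre c. ?Q \<xi>). (contr \<xi> * path_contr ps) powr s)"
    unfolding eq by (subst sum.reindex) (auto simp: inj_on_def path_contr_simps case_prod_unfold)
  also have "\<dots> = (\<Sum>\<xi>\<in>fibre c. \<Sum>ps\<in>?Q \<xi>. (contr \<xi> * path_contr ps) powr s)"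
    by (rule sum.Sigma[symmetric]) (use finite_fibre finite_paths in auto)
  also have "\<dots> = (\<Sum>\<xi>\<in>fibre c. contr \<xi> powr s * path_sum E (weight s) n (\<tau> \<xi>) c')"
  proof (intro sum.cong refl)
    fix \<xi> assume \<xi>: "\<xi> \<in> fibre c"
    show "(\<Sum>ps\<in>?Q \<xi>. (contr \<xi> * path_contr ps) powr s) = contr \<xi> powr s * path_sum E (weight s) n (\<tau> \<xi>) c'"
      unfolding Suc.IH[OF \<tau>E[OF fibre_K[OF \<xi>]], symmetric] by (simp add: powr_mult sum_distrib_left)
  qed
  also have "\<dots> = (\<Sum>e\<in>E. \<Sum>\<xi> | \<xi> \<in> fibre c \<and> \<tau> \<xi> = e. contr \<xi> powr s * path_sum E (weight s) n (\<tau> \<xi>) c')"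
    by (rule sum.group[symmetric]) (use finite_fibre E \<tau>E fibre_K in auto)
  also have "\<dots> = path_sum E (weight s) (Suc n) c c'"
    by (auto simp: weight_def sum_distrib_right intro!: sum.cong)
  finally show ?case .
qed

text \<open>The level-\<open>n\<close> images of cells cover \<open>K\<close> with diameter bounds
  \<open>(1 + \<epsilon>) ^ (2 * n) * path_contr ps * (2 * \<rho>)\<close>, whose
  \<open>t\<close>-th powers sum to at least \<kappa>. Estimating
  \<open>path_contr ps powr (t - s)\<close> by \<open>(1 / b) ^ n\<close> leaves
  \<open>s\<close>-sums of at least a constant times \<open>(b / a) ^ n\<close>.\<close>

lemma loops_exist:
  assumes s: "0 \<le> s" "s < t" and H: "hausdorff_measure dist t K \<noteq> 0"
    and \<epsilon>t: "(1 + \<epsilon>) powr (2 * t) < 2 powr (t - s)"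
  obtains n c where "c \<in> E" "n \<ge> 1" "(\<Sum>ps | ps \<in> paths n c \<and> endpoint c ps = c. path_contr ps powr s) > 1"
proof -
  have t: "t > 0" using s by simp
  obtain \<kappa> \<delta> :: real where \<kappa>: "\<kappa> > 0" "\<delta> > 0" and cov:
    "\<forall>(I :: ('a \<times> 'a list) set) U D. finite I \<and> K \<subseteq> (\<Union>i\<in>I. U i) \<and>
      (\<forall>i\<in>I. 0 \<le> D i \<and> D i \<le> \<delta> \<and> (\<forall>x\<in>U i. \<forall>y\<in>U i. dist x y \<le> D i)) \<longrightarrow> \<kappa> \<le> (\<Sum>i\<in>I. D i powr t)"
    using hausdorff_measure_pos_finite_covers[OF H t] by (elim exE conjE)
  \<comment> \<open>\<open>a\<close> is the distortion loss per step and \<open>b\<close> the gain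
    per step from lowering the exponent; the hypothesis on \<epsilon> says
    \<open>a < b\<close>.\<close>
  define a where "a = (1 + \<epsilon>) powr (2 * t)"
  define b where "b = 2 powr (t - s)"
  have ab: "0 < a" "a < b" using \<epsilon>t \<epsilon> by (auto simp: a_def b_def)
  have "(\<lambda>n. (2/3) ^ n * (2 * \<rho>)) \<longlonglongrightarrow> 0 * (2 * \<rho>)"
    by (intro tendsto_intros) auto
  then have "\<forall>\<^sub>F n in at_top. (2/3) ^ n * (2 * \<rho>) < \<delta>"
    using \<kappa> by (intro order_tendstoD(2)[where y = "0 * (2 * \<rho>)"]) auto
  then obtain n0 where n0: "\<And>n. n \<ge> n0 \<Longrightarrow> (2/3) ^ n * (2 * \<rho>) < \<delta>"
    by (auto simp: eventually_at_top_linorder)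
  have growth: "\<kappa> / (2 * \<rho>) powr t * (b / a) ^ n \<le> (\<Sum>c\<in>E. \<Sum>c'\<in>E. path_sum E (weight s) n c c')"
    if n: "n \<ge> n0" for n
  proof -
    let ?I = "SIGMA c:E. paths n c"
    let ?U = "\<lambda>ps. (1 + \<epsilon>) ^ (2 * n) * path_contr ps"
    have U0: "0 \<le> ?U ps" if "ps \<in> paths n c" for ps c
      using path_contr_bounds[OF that] \<epsilon> by auto
    have "\<kappa> \<le> (\<Sum>i\<in>?I. (?U (snd i) * (2 * \<rho>)) powr t)"
    proof (rule cov[rule_format, where U = "\<lambda>i. branch (snd i) ` cell (fst i)"], intro conjI ballI)
      show "finite ?I" using E finite_paths by auto
      show "K \<subseteq> (\<Union>i\<in>?I. branch (snd i) ` cell (fst i))"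
      proof
        fix x assume x: "x \<in> K"
        define c where "c = \<tau> ((S ^^ n) x)"
        have c: "c \<in> E" unfolding c_def using funpow_K[OF x] by (rule \<tau>E)
        have "(S ^^ n) x \<in> cell c"
          using \<tau>[OF funpow_K[OF x, of n]] \<rho> funpow_K[OF x, of n] by (auto simp: cell_def c_def dist_commute)
        then obtain ps where "ps \<in> paths n c" "branch ps ((S ^^ n) x) = x"
          using branch_cover[OF x] c E(2) by blast
        then show "x \<in> (\<Union>i\<in>?I. branch (snd i) ` cell (fst i))"
          using c \<open>(S ^^ n) x \<in> cell c\<close> by (intro UN_I[of "(c, ps)"]) force+
      qed
      show "0 \<le> ?U (snd i) * (2 * \<rho>)" "?U (snd i) * (2 * \<rho>) \<le> \<delta>" if "i \<in> ?I" for i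
      proof -
        have i: "snd i \<in> paths n (fst i)" using that by auto
        have "?U (snd i) * (2 * \<rho>) \<le> (2/3) ^ n * (2 * \<rho>)"
          using path_contr_bounds[OF i] \<rho> by (intro mult_right_mono) auto
        moreover have "0 \<le> ?U (snd i) * (2 * \<rho>)" using \<rho> by (intro mult_nonneg_nonneg[OF U0[OF i]]) auto
        ultimately show "0 \<le> ?U (snd i) * (2 * \<rho>)" "?U (snd i) * (2 * \<rho>) \<le> \<delta>" using n0[OF n] by linarith+
      qed
      show "dist x y \<le> ?U (snd i) * (2 * \<rho>)" if i: "i \<in> ?I"
        and xy: "x \<in> branch (snd i) ` cell (fst i)" "y \<in> branch (snd i) ` cell (fst i)" for i x y
      proof -
        have i: "snd i \<in> paths n (fst i)" using i by auto
        from xy obtain x' y' where *: "x' \<in> cell (fst i)" "y' \<in> cell (fst i)"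
          "x = branch (snd i) x'" "y = branch (snd i) y'" by blast
        have "dist x' y' \<le> dist (fst i) x' + dist (fst i) y'" by (metis dist_commute dist_triangle)
        then have "dist x' y' \<le> 2 * \<rho>" using *(1,2) by (auto simp: cell_def)
        then have "?U (snd i) * dist x' y' \<le> ?U (snd i) * (2 * \<rho>)"
          using U0[OF i] by (intro mult_left_mono)
        then show ?thesis using branch_dist[OF i *(1,2)] *(3,4) by auto
      qed
    qed
    also have "\<dots> \<le> (\<Sum>i\<in>?I. (a / b) ^ n * (2 * \<rho>) powr t * path_contr (snd i) powr s)"
    proof (rule sum_mono)
      fix i assume "i \<in> ?I"
      then have i: "snd i \<in> paths n (fst i)" by auto
      let ?R = "path_contr (snd i)"
      note R = path_contr_bounds[OF i]
      have "((1 + \<epsilon>) ^ (2 * n)) powr t = ((1 + \<epsilon>) powr real (2 * n)) powr t"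
        using \<epsilon> by (subst powr_realpow) auto
      also have "\<dots> = a powr real n" by (simp add: a_def powr_powr mult_ac)
      also have "\<dots> = a ^ n" using ab by (simp add: powr_realpow)
      finally have A: "((1 + \<epsilon>) ^ (2 * n)) powr t = a ^ n" .
      have "?R powr (t - s) \<le> ((1/2) ^ n) powr (t - s)" using R s by (intro powr_mono2) auto
      also have "((1/2::real) ^ n) powr (t - s) = ((1/2) powr real n) powr (t - s)"
        by (subst powr_realpow) auto
      also have "\<dots> = ((1/2) powr (t - s)) powr real n" by (simp add: powr_powr mult.commute)
      also have "(1/2) powr (t - s) = 1 / b" by (simp add: b_def powr_divide)
      also have "(1 / b) powr real n = (1 / b) ^ n" using ab by (simp add: powr_realpow)
      finally have B: "?R powr (t - s) \<le> (1 / b) ^ n" .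
      have "(?U (snd i) * (2 * \<rho>)) powr t = a ^ n * ?R powr t * (2 * \<rho>) powr t"
        by (simp add: powr_mult A)
      also have "?R powr t = ?R powr (t - s) * ?R powr s" by (simp flip: powr_add)
      also have "a ^ n * (?R powr (t - s) * ?R powr s) * (2 * \<rho>) powr t \<le>
          a ^ n * ((1 / b) ^ n * ?R powr s) * (2 * \<rho>) powr t"
        using B ab by (intro mult_left_mono mult_right_mono) auto
      finally show "(?U (snd i) * (2 * \<rho>)) powr t \<le> (a / b) ^ n * (2 * \<rho>) powr t * ?R powr s"
        by (simp add: power_divide mult_ac)
    qed
    also have "\<dots> = (a / b) ^ n * (2 * \<rho>) powr t * (\<Sum>i\<in>?I. path_contr (snd i) powr s)"
      by (simp add: sum_distrib_left)
    also have "(\<Sum>i\<in>?I. path_contr (snd i) powr s) = (\<Sum>c\<in>E. \<Sum>ps\<in>paths n c. path_contr ps powr s)"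
      by (subst sum.Sigma) (use E finite_paths in \<open>auto simp: case_prod_unfold\<close>)
    also have "\<dots> = (\<Sum>c\<in>E. \<Sum>c'\<in>E. path_sum E (weight s) n c c')"
    proof (intro sum.cong refl)
      fix c assume c: "c \<in> E"
      have "(\<Sum>ps\<in>paths n c. path_contr ps powr s) =
          (\<Sum>c'\<in>E. \<Sum>ps | ps \<in> paths n c \<and> endpoint c ps = c'. path_contr ps powr s)"
        by (rule sum.group[symmetric]) (use finite_paths E endpoint_E c in auto)
      then show "(\<Sum>ps\<in>paths n c. path_contr ps powr s) = (\<Sum>c'\<in>E. path_sum E (weight s) n c c')"
        using path_sum_weight[OF c] by simp
    qed
    finally show ?thesis
      using ab \<rho> by (simp add: field_simps power_divide)
  qed
  obtain n c where nc: "c \<in> E" "path_sum E (weight s) n c c > 1"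
  proof (rule path_sum_exponential_loop[of E "weight s" "\<kappa> / (2 * \<rho>) powr t" "b / a" n0])
    show "0 \<le> weight s c e" for c e unfolding weight_def by (intro sum_nonneg) auto
    show "\<kappa> / (2 * \<rho>) powr t > 0" using \<kappa> \<rho> by simp
  qed (use E ab growth in auto)
  \<comment> \<open>The empty path contributes exactly 1, which does not exceed 1.\<close>
  then have "n \<noteq> 0" by (intro notI) simp
  with nc show thesis using that[of c n] path_sum_weight[OF nc(1)] by simp
qed

text \<open>The length \<open>n\<close> is fixed before \<open>Y\<close>: later \<open>Y\<close>
  consists of preimages of the avoided point under iterates whose number depends on
  \<open>n\<close>.\<close>

lemma avoiding_subset:
  assumes s: "0 \<le> s" "s < t" and H: "hausdorff_measure dist t K \<noteq> 0"
    and \<epsilon>t: "(1 + \<epsilon>) powr (2 * t) < 2 powr (t - s)"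
  shows "\<exists>n\<ge>1. \<forall>Y. finite Y \<longrightarrow> (\<exists>\<Lambda> m. compact \<Lambda> \<and> \<Lambda> \<subseteq> K \<and> m \<ge> 1 \<and> ((S ^^ n) ^^ m) ` \<Lambda> \<subseteq> \<Lambda> \<and>
    (\<forall>a<m. ((S ^^ n) ^^ a) ` \<Lambda> \<inter> Y = {}) \<and> hausdorff_measure dist s \<Lambda> \<noteq> 0)"
proof -
  obtain n c where nc: "c \<in> E" "n \<ge> 1" and
    sum: "(\<Sum>ps | ps \<in> paths n c \<and> endpoint c ps = c. path_contr ps powr s) > 1"
    by (rule loops_exist[OF assms])
  let ?I = "{ps. ps \<in> paths n c \<and> endpoint c ps = c}"
  show ?thesis
  proof (intro exI[of _ n] conjI allI impI nc(2))
    fix Y :: "'a set" assume Y: "finite Y"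
    have cell: "compact (cell c)" "cell c \<noteq> {}" "cell c \<subseteq> K"
      using nc E \<rho> K by (auto simp: cell_def intro!: compact_Int_closed)
    obtain \<Lambda> m where "compact \<Lambda>" "\<Lambda> \<subseteq> cell c" "m \<ge> 1" "((S ^^ n) ^^ m) ` \<Lambda> \<subseteq> \<Lambda>"
      "\<And>a. a < m \<Longrightarrow> ((S ^^ n) ^^ a) ` \<Lambda> \<inter> Y = {}" "hausdorff_measure dist s \<Lambda> \<noteq> 0"
    proof (rule separated_ifs_avoid_finite_set[of ?I "cell c" branch path_contr "S ^^ n" s Y])
      show "finite ?I" using finite_paths by auto
      show "branch i ` cell c \<subseteq> cell c" if "i \<in> ?I" for i using that branch_cell by fastforce
      show "dist (branch i x) (branch i y) \<le> dist x y" if "i \<in> ?I" "x \<in> cell c" "y \<in> cell c" for i x y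
      proof -
        have i: "i \<in> paths n c" using that by auto
        have "(1 + \<epsilon>) ^ (2 * n) * path_contr i \<le> (2/3) ^ n" using path_contr_bounds[OF i] by blast
        also have "\<dots> \<le> 1" by (intro power_le_one) auto
        finally have "(1 + \<epsilon>) ^ (2 * n) * path_contr i * dist x y \<le> 1 * dist x y"
          by (rule mult_right_mono) simp
        then show ?thesis using branch_dist[OF i that(2,3)] by auto
      qed
      show "0 < path_contr i \<and> path_contr i \<le> 1" if "i \<in> ?I" for i
      proof -
        have i: "i \<in> paths n c" using that by auto
        have "(1/2::real) ^ n \<le> 1" by (intro power_le_one) auto
        then show ?thesis using path_contr_bounds[OF i] by linarith
      qed
      show "path_contr i * dist x y \<le> dist (branch i x) (branch i y)"
        if "i \<in> ?I" "x \<in> cell c" "y \<in> cell c" for i x y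
        using branch_dist[of i n c x y] that by auto
      show "branch i ` cell c \<inter> branch j ` cell c = {}" if "i \<in> ?I" "j \<in> ?I" "i \<noteq> j" for i j
        using branch_disjoint[of i n c j] that by fastforce
      show "(S ^^ n) (branch i x) = x" if "i \<in> ?I" "x \<in> cell c" for i x
        using branch_cell[of i n c x] that by auto
    qed (use cell sum s Y in auto)
    then show "\<exists>\<Lambda> m. compact \<Lambda> \<and> \<Lambda> \<subseteq> K \<and> m \<ge> 1 \<and> ((S ^^ n) ^^ m) ` \<Lambda> \<subseteq> \<Lambda> \<and>
      (\<forall>a<m. ((S ^^ n) ^^ a) ` \<Lambda> \<inter> Y = {}) \<and> hausdorff_measure dist s \<Lambda> \<noteq> 0"
      using cell(3) by blast
  qed
qed

end

section \<open>Avoiding a point\<close>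

text \<open>The estimate concerns all pairs \<open>y\<close>, \<open>y'\<close> near
  \<open>x\<close>, not only pairs containing \<open>x\<close>, so that it controls inverse branches
  on whole cells. The relative form of the error makes it stable under composition.\<close>

definition nearly_conformal_on :: "'a::metric_space set \<Rightarrow> ('a \<Rightarrow> 'a) \<Rightarrow> ('a \<Rightarrow> real) \<Rightarrow> bool" where
  "nearly_conformal_on K f L \<longleftrightarrow> (\<forall>\<epsilon>>0. \<exists>r>0. \<forall>x\<in>K. \<forall>y\<in>K. \<forall>y'\<in>K. dist x y < r \<longrightarrow> dist x y' < r \<longrightarrow>
     L x / (1 + \<epsilon>) * dist y y' \<le> dist (f y) (f y') \<and> dist (f y) (f y') \<le> (1 + \<epsilon>) * L x * dist y y')"

text \<open>The lift \<xi> has to lie in \<open>K\<close> again; for the Julia set this is where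
  backward invariance enters.\<close>

definition uniformly_open_on :: "'a::metric_space set \<Rightarrow> ('a \<Rightarrow> 'a) \<Rightarrow> bool" where
  "uniformly_open_on K f \<longleftrightarrow>
     (\<forall>\<epsilon>>0. \<exists>\<eta>>0. \<forall>x\<in>K. \<forall>w\<in>K. dist (f x) w < \<eta> \<longrightarrow> (\<exists>\<xi>\<in>K. dist x \<xi> < \<epsilon> \<and> f \<xi> = w))"

lemma nearly_conformal_onE:
  assumes "nearly_conformal_on K f L" "\<epsilon> > 0"
  obtains r where "r > 0" "\<And>x y y'. x \<in> K \<Longrightarrow> y \<in> K \<Longrightarrow> y' \<in> K \<Longrightarrow> dist x y < r \<Longrightarrow> dist x y' < r \<Longrightarrow>
     L x / (1 + \<epsilon>) * dist y y' \<le> dist (f y) (f y')"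
    "\<And>x y y'. x \<in> K \<Longrightarrow> y \<in> K \<Longrightarrow> y' \<in> K \<Longrightarrow> dist x y < r \<Longrightarrow> dist x y' < r \<Longrightarrow>
     dist (f y) (f y') \<le> (1 + \<epsilon>) * L x * dist y y'"
  using assms unfolding nearly_conformal_on_def by metis

lemma nearly_conformal_on_imp_continuous_on:
  assumes f: "nearly_conformal_on K f L" and L: "\<And>x. x \<in> K \<Longrightarrow> L x > 0"
  shows "continuous_on K f"
proof -
  obtain r where r: "r > 0" "\<And>x y y'. x \<in> K \<Longrightarrow> y \<in> K \<Longrightarrow> y' \<in> K \<Longrightarrow> dist x y < r \<Longrightarrow> dist x y' < r \<Longrightarrow>
     dist (f y) (f y') \<le> (1 + 1) * L x * dist y y'"
    by (rule nearly_conformal_onE[OF f, of 1]) auto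
  show ?thesis
    unfolding continuous_on_iff
  proof (intro ballI allI impI)
    fix x and e :: real assume x: "x \<in> K" and e: "e > 0"
    show "\<exists>d>0. \<forall>x'\<in>K. dist x' x < d \<longrightarrow> dist (f x') (f x) < e"
    proof (intro exI[of _ "min r (e / (2 * L x))"] conjI ballI impI)
      show "min r (e / (2 * L x)) > 0" using r e L[OF x] by simp
      fix y assume y: "y \<in> K" "dist y x < min r (e / (2 * L x))"
      have "dist (f y) (f x) \<le> 2 * L x * dist y x" using r(2)[OF x y(1) x] y r(1) by (simp add: dist_commute)
      also have "\<dots> < e" using y(2) L[OF x] by (simp add: field_simps)
      finally show "dist (f y) (f x) < e" .
    qed
  qed
qed

lemma nearly_conformal_on_finite_fibre:
  assumes K: "compact K" and f: "nearly_conformal_on K f L" and L: "\<And>x. x \<in> K \<Longrightarrow> L x > 0"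
  shows "finite {x \<in> K. f x = z}"
proof -
  obtain r where r: "r > 0" "\<And>x y y'. x \<in> K \<Longrightarrow> y \<in> K \<Longrightarrow> y' \<in> K \<Longrightarrow> dist x y < r \<Longrightarrow> dist x y' < r \<Longrightarrow>
     L x / (1 + 1) * dist y y' \<le> dist (f y) (f y')"
    by (rule nearly_conformal_onE[OF f, of 1]) auto
  show ?thesis
  proof (rule finite_separated_subset_compact[OF K _ r(1)])
    fix x y assume xy: "x \<in> {x \<in> K. f x = z}" "y \<in> {x \<in> K. f x = z}" "dist x y < r"
    then have "L x * dist x y \<le> 0" using r(2)[of x x y] r(1) by simp
    then show "x = y" using L[of x] xy by (simp add: mult_le_0_iff)
  qed auto
qed

lemma nearly_conformal_on_compose:
  assumes K: "compact K" and f: "nearly_conformal_on K f L" and g: "nearly_conformal_on K g M"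
    and L: "\<And>x. x \<in> K \<Longrightarrow> L x > 0" and M: "\<And>x. x \<in> K \<Longrightarrow> M x > 0" and fK: "\<And>x. x \<in> K \<Longrightarrow> f x \<in> K"
  shows "nearly_conformal_on K (g \<circ> f) (\<lambda>x. M (f x) * L x)"
  unfolding nearly_conformal_on_def
proof (intro allI impI)
  fix \<epsilon> :: real assume \<epsilon>: "\<epsilon> > 0"
  \<comment> \<open>For \<open>e \<le> 1\<close> the product of two factors \<open>1 + e\<close> is
    at most \<open>1 + 3 * e\<close>, hence the third of \<epsilon>.\<close>
  define e where "e = min 1 (\<epsilon> / 3)"
  have e: "e > 0" "e \<le> 1" "3 * e \<le> \<epsilon>" using \<epsilon> by (auto simp: e_def)
  have "e * e \<le> e" using e by (simp add: mult_left_le)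
  moreover have "(1 + e) * (1 + e) = 1 + 2 * e + e * e" by (simp add: algebra_simps)
  ultimately have ee: "(1 + e) * (1 + e) \<le> 1 + \<epsilon>" using e by linarith
  obtain r where r: "r > 0" "\<And>x y y'. x \<in> K \<Longrightarrow> y \<in> K \<Longrightarrow> y' \<in> K \<Longrightarrow> dist x y < r \<Longrightarrow> dist x y' < r \<Longrightarrow>
     L x / (1 + e) * dist y y' \<le> dist (f y) (f y')"
    "\<And>x y y'. x \<in> K \<Longrightarrow> y \<in> K \<Longrightarrow> y' \<in> K \<Longrightarrow> dist x y < r \<Longrightarrow> dist x y' < r \<Longrightarrow>
     dist (f y) (f y') \<le> (1 + e) * L x * dist y y'"
    by (rule nearly_conformal_onE[OF f e(1)]) blast
  obtain q where q: "q > 0" "\<And>x y y'. x \<in> K \<Longrightarrow> y \<in> K \<Longrightarrow> y' \<in> K \<Longrightarrow> dist x y < q \<Longrightarrow> dist x y' < q \<Longrightarrow>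
     M x / (1 + e) * dist y y' \<le> dist (g y) (g y')"
    "\<And>x y y'. x \<in> K \<Longrightarrow> y \<in> K \<Longrightarrow> y' \<in> K \<Longrightarrow> dist x y < q \<Longrightarrow> dist x y' < q \<Longrightarrow>
     dist (g y) (g y') \<le> (1 + e) * M x * dist y y'"
    by (rule nearly_conformal_onE[OF g e(1)]) blast
  have "uniformly_continuous_on K f"
    by (rule compact_uniformly_continuous[OF nearly_conformal_on_imp_continuous_on[OF f L] K])
  then obtain d where d: "d > 0" "\<And>x y. x \<in> K \<Longrightarrow> y \<in> K \<Longrightarrow> dist x y < d \<Longrightarrow> dist (f x) (f y) < q"
    unfolding uniformly_continuous_on_def using q(1) by (metis dist_commute)
  show "\<exists>r>0. \<forall>x\<in>K. \<forall>y\<in>K. \<forall>y'\<in>K. dist x y < r \<longrightarrow> dist x y' < r \<longrightarrow>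
     M (f x) * L x / (1 + \<epsilon>) * dist y y' \<le> dist ((g \<circ> f) y) ((g \<circ> f) y') \<and>
     dist ((g \<circ> f) y) ((g \<circ> f) y') \<le> (1 + \<epsilon>) * (M (f x) * L x) * dist y y'"
  proof (intro exI[of _ "min r d"] conjI ballI impI)
    show "min r d > 0" using r d by simp
    fix x y y' assume K: "x \<in> K" "y \<in> K" "y' \<in> K" and xy: "dist x y < min r d" "dist x y' < min r d"
    note fx = fK[OF K(1)] fK[OF K(2)] fK[OF K(3)]
    have pos: "M (f x) > 0" "L x > 0" using L M K fx by auto
    have "M (f x) * L x / (1 + \<epsilon>) * dist y y' \<le> M (f x) * L x / ((1 + e) * (1 + e)) * dist y y'"
      using pos ee e by (intro mult_right_mono divide_left_mono) auto
    also have "\<dots> = M (f x) / (1 + e) * (L x / (1 + e) * dist y y')" by simp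
    also have "\<dots> \<le> M (f x) / (1 + e) * dist (f y) (f y')"
      using r(2)[OF K] xy pos e by (intro mult_left_mono) auto
    also have "\<dots> \<le> dist ((g \<circ> f) y) ((g \<circ> f) y')"
      using q(2)[OF fx] d(2)[OF K(1,2)] d(2)[OF K(1,3)] xy by simp
    finally show "M (f x) * L x / (1 + \<epsilon>) * dist y y' \<le> dist ((g \<circ> f) y) ((g \<circ> f) y')" .
    have "dist ((g \<circ> f) y) ((g \<circ> f) y') \<le> (1 + e) * M (f x) * dist (f y) (f y')"
      using q(3)[OF fx] d(2)[OF K(1,2)] d(2)[OF K(1,3)] xy by simp
    also have "\<dots> \<le> (1 + e) * M (f x) * ((1 + e) * L x * dist y y')"
      using r(3)[OF K] xy pos e by (intro mult_left_mono) auto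
    also have "\<dots> = ((1 + e) * (1 + e)) * (M (f x) * L x * dist y y')" by (simp add: mult_ac)
    also have "\<dots> \<le> (1 + \<epsilon>) * (M (f x) * L x * dist y y')"
      using pos ee by (intro mult_right_mono) auto
    finally show "dist ((g \<circ> f) y) ((g \<circ> f) y') \<le> (1 + \<epsilon>) * (M (f x) * L x) * dist y y'"
      by (simp add: mult_ac)
  qed
qed

lemma nearly_conformal_on_funpow:
  assumes K: "compact K" and f: "nearly_conformal_on K f L"
    and L: "\<And>x. x \<in> K \<Longrightarrow> L x > 0" and fK: "\<And>x. x \<in> K \<Longrightarrow> f x \<in> K"
  shows "nearly_conformal_on K (f ^^ n) (\<lambda>x. \<Prod>k<n. L ((f ^^ k) x))"
proof (induction n)
  case 0
  show ?case unfolding nearly_conformal_on_def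
  proof (intro allI impI exI[of _ "1::real"] conjI ballI)
    fix \<epsilon> :: real and x y y' :: 'a assume "\<epsilon> > 0"
    then have "1 / (1 + \<epsilon>) * dist y y' \<le> 1 * dist y y'" "1 * dist y y' \<le> (1 + \<epsilon>) * dist y y'"
      by (intro mult_right_mono; simp)+
    then show "(\<Prod>k<0. L ((f ^^ k) x)) / (1 + \<epsilon>) * dist y y' \<le> dist ((f ^^ 0) y) ((f ^^ 0) y')"
      "dist ((f ^^ 0) y) ((f ^^ 0) y') \<le> (1 + \<epsilon>) * (\<Prod>k<0. L ((f ^^ k) x)) * dist y y'" by auto
  qed simp
next
  case (Suc n)
  have it: "(f ^^ k) x \<in> K" if "x \<in> K" for k x using that by (induction k) (auto intro: fK)
  have "nearly_conformal_on K (f \<circ> (f ^^ n)) (\<lambda>x. L ((f ^^ n) x) * (\<Prod>k<n. L ((f ^^ k) x)))"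
    by (rule nearly_conformal_on_compose[OF K Suc f]) (auto intro!: prod_pos L it)
  then show ?case by (simp add: mult.commute comp_def)
qed

lemma uniformly_open_on_funpow:
  assumes f: "uniformly_open_on K f" and fK: "\<And>x. x \<in> K \<Longrightarrow> f x \<in> K"
  shows "uniformly_open_on K (f ^^ n)"
proof (induction n)
  case 0
  show ?case unfolding uniformly_open_on_def by force
next
  case (Suc n)
  have it: "(f ^^ k) x \<in> K" if "x \<in> K" for k x using that by (induction k) (auto intro: fK)
  show ?case unfolding uniformly_open_on_def
  proof (intro allI impI)
    fix \<epsilon> :: real assume "\<epsilon> > 0"
    then obtain \<eta> where \<eta>: "\<eta> > 0"
      "\<And>x w. x \<in> K \<Longrightarrow> w \<in> K \<Longrightarrow> dist ((f ^^ n) x) w < \<eta> \<Longrightarrow> \<exists>\<xi>\<in>K. dist x \<xi> < \<epsilon> \<and> (f ^^ n) \<xi> = w"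
      using Suc unfolding uniformly_open_on_def by meson
    then obtain \<theta> where \<theta>: "\<theta> > 0"
      "\<And>x w. x \<in> K \<Longrightarrow> w \<in> K \<Longrightarrow> dist (f x) w < \<theta> \<Longrightarrow> \<exists>\<xi>\<in>K. dist x \<xi> < \<eta> \<and> f \<xi> = w"
      using f unfolding uniformly_open_on_def by meson
    show "\<exists>\<eta>>0. \<forall>x\<in>K. \<forall>w\<in>K. dist ((f ^^ Suc n) x) w < \<eta> \<longrightarrow> (\<exists>\<xi>\<in>K. dist x \<xi> < \<epsilon> \<and> (f ^^ Suc n) \<xi> = w)"
    proof (intro exI[of _ \<theta>] conjI ballI impI)
      fix x w assume *: "x \<in> K" "w \<in> K" "dist ((f ^^ Suc n) x) w < \<theta>"
      then obtain y where y: "y \<in> K" "dist ((f ^^ n) x) y < \<eta>" "f y = w"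
        using \<theta>(2)[OF it[OF *(1)] *(2)] by auto
      then obtain z where "z \<in> K" "dist x z < \<epsilon>" "(f ^^ n) z = y" using \<eta>(2)[OF *(1) y(1,2)] by blast
      then show "\<exists>\<xi>\<in>K. dist x \<xi> < \<epsilon> \<and> (f ^^ Suc n) \<xi> = w" using y by auto
    qed (rule \<theta>)
  qed
qed

text \<open>The two sides agree at \<open>1 + \<epsilon> = 2 powr ((t - s) / (2 * t))\<close>, which
  exceeds 1; every smaller positive \<epsilon> works.\<close>

lemma powr_base_near_one:
  fixes s t :: real
  assumes "0 \<le> s" "s < t"
  obtains \<epsilon> where "0 < \<epsilon>" "\<epsilon> \<le> 1/3" "(1 + \<epsilon>) powr (2 * t) < 2 powr (t - s)"
proof -
  define b :: real where "b = 2 powr ((t - s) / (2 * t))"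
  have t: "t > 0" using assms by simp
  have "b > 2 powr 0" unfolding b_def using assms t by (intro powr_less_mono) auto
  then have b: "b > 1" by simp
  define \<epsilon> where "\<epsilon> = min (1/3) ((b - 1) / 2)"
  have "0 < \<epsilon>" "\<epsilon> \<le> 1/3" "1 + \<epsilon> < b" using b by (auto simp: \<epsilon>_def min_def field_simps)
  moreover have "(1 + \<epsilon>) powr (2 * t) < b powr (2 * t)"
    using calculation t by (intro powr_less_mono2) auto
  moreover have "b powr (2 * t) = 2 powr (t - s)" using t by (simp add: b_def powr_powr)
  ultimately show thesis using that by simp
qed

text \<open>Avoidance of a finite set by an iterate becomes avoidance of \<open>z0\<close> by all
  iterates of \<open>T\<close>: the finite set contains every point of \<open>K\<close> that reaches
  \<open>z0\<close> in fewer than \<open>N\<close> steps, where \<open>N\<close> counts the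
  \<open>T\<close>-steps in one step of the subsystem. The orbit of \<Lambda> then stays in a
  compact set missing \<open>z0\<close>, which yields \<open>c\<close>.\<close>

lemma exists_large_subset_avoiding_point:
  fixes K :: "'a::heine_borel set"
  assumes K: "compact K" and T: "nearly_conformal_on K T L" and L: "\<And>x. x \<in> K \<Longrightarrow> L x > 0"
    and TK: "\<And>x. x \<in> K \<Longrightarrow> T x \<in> K" and opn: "uniformly_open_on K T"
    and C: "C > 0" "lam > 1" and exp: "\<And>x n. x \<in> K \<Longrightarrow> n \<ge> 1 \<Longrightarrow> C * lam ^ n \<le> (\<Prod>k<n. L ((T ^^ k) x))"
    and s: "0 \<le> s" "s < t" and H: "hausdorff_measure dist t K \<noteq> 0"
  shows "\<exists>\<Lambda> c. \<Lambda> \<subseteq> K \<and> hausdorff_measure dist s \<Lambda> \<noteq> 0 \<and> c > 0 \<and> (\<forall>x\<in>\<Lambda>. \<forall>n. c \<le> dist z0 ((T ^^ n) x))"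
proof -
  have it: "(T ^^ k) x \<in> K" if "x \<in> K" for k x using that by (induction k) (auto intro: TK)
  have Lpos: "(\<Prod>k<n. L ((T ^^ k) x)) > 0" if "x \<in> K" for x n
    using that by (auto intro!: prod_pos L it)
  note Tn = nearly_conformal_on_funpow[OF K T L TK]
  have "filterlim (\<lambda>n::nat. C * lam ^ n) at_top at_top" using C by real_asymp
  then have "\<forall>\<^sub>F n in at_top. 2 \<le> C * lam ^ n" by (simp add: filterlim_at_top)
  then have "\<forall>\<^sub>F n in at_top. 2 \<le> C * lam ^ n \<and> 1 \<le> n" by (intro eventually_conj eventually_ge_at_top)
  then obtain n0 where n0: "2 \<le> C * lam ^ n0" "1 \<le> n0" by (auto simp: eventually_at_top_linorder)
  define S where "S = T ^^ n0"
  define LS where "LS x = (\<Prod>k<n0. L ((T ^^ k) x))" for x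
  have SK: "S x \<in> K" if "x \<in> K" for x using it[OF that] by (simp add: S_def)
  obtain \<epsilon> where eps: "0 < \<epsilon>" "\<epsilon> \<le> 1/3" "(1 + \<epsilon>) powr (2 * t) < 2 powr (t - s)"
    by (rule powr_base_near_one[OF s])
  have S: "nearly_conformal_on K S LS" using Tn[of n0] unfolding S_def LS_def .
  obtain r0 where r0: "r0 > 0" "\<And>x y y'. x \<in> K \<Longrightarrow> y \<in> K \<Longrightarrow> y' \<in> K \<Longrightarrow> dist x y < r0 \<Longrightarrow> dist x y' < r0 \<Longrightarrow>
     LS x / (1 + \<epsilon>) * dist y y' \<le> dist (S y) (S y')"
    "\<And>x y y'. x \<in> K \<Longrightarrow> y \<in> K \<Longrightarrow> y' \<in> K \<Longrightarrow> dist x y < r0 \<Longrightarrow> dist x y' < r0 \<Longrightarrow>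
     dist (S y) (S y') \<le> (1 + \<epsilon>) * LS x * dist y y'"
    by (rule nearly_conformal_onE[OF S eps(1)]) blast
  have "uniformly_open_on K S" unfolding S_def by (rule uniformly_open_on_funpow[OF opn TK])
  then obtain \<eta> where \<eta>: "\<eta> > 0"
    "\<And>x w. x \<in> K \<Longrightarrow> w \<in> K \<Longrightarrow> dist (S x) w < \<eta> \<Longrightarrow> \<exists>\<xi>\<in>K. dist x \<xi> < r0 \<and> S \<xi> = w"
    unfolding uniformly_open_on_def using r0(1) by meson
  define \<rho> where "\<rho> = min (\<eta> / 2) (r0 / 2)"
  have \<rho>: "0 < \<rho>" "2 * \<rho> \<le> r0" "\<rho> < \<eta>" using \<eta>(1) r0(1) by (auto simp: \<rho>_def)
  obtain E where E: "finite E" "E \<subseteq> K" "K \<subseteq> (\<Union>x\<in>E. ball x (\<rho> / 3))"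
    using seq_compact_imp_totally_bounded[OF compact_imp_seq_compact[OF K], rule_format, of "\<rho> / 3"] \<rho>(1)
    by auto
  have "\<forall>x. \<exists>c. x \<in> K \<longrightarrow> c \<in> E \<and> dist x c \<le> \<rho> / 3"
    using E(3) by (fastforce simp: dist_commute less_imp_le)
  then obtain \<tau> where \<tau>: "\<And>x. x \<in> K \<Longrightarrow> \<tau> x \<in> E \<and> dist x (\<tau> x) \<le> \<rho> / 3" by metis
  interpret open_expanding_net K S LS \<epsilon> r0 \<rho> E \<tau>
  proof
    show "2 \<le> LS x" if "x \<in> K" for x using exp[OF that n0(2)] n0(1) by (simp add: LS_def)
    show "\<exists>\<xi>\<in>K. dist x \<xi> < r0 \<and> S \<xi> = w" if "x \<in> K" "w \<in> K" "dist (S x) w \<le> \<rho>" for x w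
      using \<eta>(2)[OF that(1,2)] that(3) \<rho>(3) by simp
  qed (use K SK eps r0 \<rho> E \<tau> in auto)
  obtain n where n: "n \<ge> 1" and av: "\<forall>Y. finite Y \<longrightarrow> (\<exists>\<Lambda> m. compact \<Lambda> \<and> \<Lambda> \<subseteq> K \<and> m \<ge> 1 \<and>
    ((S ^^ n) ^^ m) ` \<Lambda> \<subseteq> \<Lambda> \<and> (\<forall>a<m. ((S ^^ n) ^^ a) ` \<Lambda> \<inter> Y = {}) \<and> hausdorff_measure dist s \<Lambda> \<noteq> 0)"
    using avoiding_subset[OF s H eps(3)] by (elim exE conjE)
  define N where "N = n0 * n"
  have SN: "((S ^^ n) ^^ m) = T ^^ (N * m)" for m by (simp add: S_def N_def funpow_mult)
  have N: "N > 0" using n n0 by (simp add: N_def)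
  define Y where "Y = (\<Union>k<N. {y \<in> K. (T ^^ k) y = z0})"
  have "finite Y" unfolding Y_def
    by (intro finite_UN_I nearly_conformal_on_finite_fibre[OF K Tn Lpos]) auto
  from av[rule_format, OF this] obtain \<Lambda> m where \<Lambda>: "compact \<Lambda>" "\<Lambda> \<subseteq> K" "m \<ge> 1" "(T ^^ (N * m)) ` \<Lambda> \<subseteq> \<Lambda>"
    "\<And>a. a < m \<Longrightarrow> (T ^^ (N * a)) ` \<Lambda> \<inter> Y = {}" "hausdorff_measure dist s \<Lambda> \<noteq> 0"
    unfolding SN by blast
  \<comment> \<open>Since \<open>T ^^ (N * m)\<close> maps \<Lambda> into itself, these finitely
    many images contain all forward orbits.\<close>
  define \<Omega> where "\<Omega> = (\<Union>i<N * m. (T ^^ i) ` \<Lambda>)"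
  have "compact \<Omega>" unfolding \<Omega>_def
    by (intro compact_UN compact_continuous_image \<Lambda>(1)
        continuous_on_subset[OF nearly_conformal_on_imp_continuous_on[OF Tn Lpos] \<Lambda>(2)]) auto
  moreover have "z0 \<notin> \<Omega>"
  proof
    assume "z0 \<in> \<Omega>"
    then obtain i x where i: "i < N * m" "x \<in> \<Lambda>" "(T ^^ i) x = z0" unfolding \<Omega>_def by blast
    \<comment> \<open>Division with remainder: at the last multiple of \<open>N\<close> not after
      time \<open>i\<close>, the orbit would be in \<open>Y\<close>.\<close>
    define y where "y = (T ^^ (N * (i div N))) x"
    have "(T ^^ (i mod N)) y = z0"
      unfolding y_def i(3)[symmetric] using funpow_add[of "i mod N" "N * (i div N)" T] by simp
    moreover have "y \<in> K" using it i \<Lambda>(2) by (auto simp: y_def)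
    ultimately have "y \<in> Y" unfolding Y_def using N by auto
    moreover have "y \<in> (T ^^ (N * (i div N))) ` \<Lambda>" using i by (auto simp: y_def)
    moreover have "i div N < m" using i(1) N by (simp add: less_mult_imp_div_less mult.commute)
    ultimately show False using \<Lambda>(5) by blast
  qed
  ultimately obtain c where c: "c > 0" "ball z0 c \<subseteq> - \<Omega>"
    using open_contains_ball[of "- \<Omega>"] compact_imp_closed[of \<Omega>] by auto
  have orb: "(T ^^ j) x \<in> \<Omega>" if x: "x \<in> \<Lambda>" for j x
  proof -
    have inv: "(T ^^ (N * m * q)) x \<in> \<Lambda>" for q
    proof (induction q)
      case (Suc q)
      have "(T ^^ (N * m * Suc q)) x = (T ^^ (N * m)) ((T ^^ (N * m * q)) x)"
        by (simp add: funpow_add)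
      then show ?case using Suc \<Lambda>(4) by auto
    qed (use x in simp)
    have "(T ^^ j) x = (T ^^ (j mod (N * m))) ((T ^^ (N * m * (j div (N * m)))) x)"
      using funpow_add[of "j mod (N * m)" "N * m * (j div (N * m))" T] by simp
    moreover have "j mod (N * m) < N * m" using N \<Lambda>(3) by simp
    ultimately show ?thesis unfolding \<Omega>_def using inv by blast
  qed
  show ?thesis
  proof (intro exI[of _ \<Lambda>] exI[of _ c] conjI ballI allI \<Lambda>(2,6) c(1))
    fix x n assume "x \<in> \<Lambda>"
    then show "c \<le> dist z0 ((T ^^ n) x)" using orb[of x n] c(2) by (auto simp: not_le[symmetric] simp del: not_le)
  qed
qed

section \<open>The chordal metric\<close>

text \<open>Inverse stereographic projection onto the unit sphere. It turns \<open>chordal\<close>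
  into \<open>dist\<close> on \<open>complex \<times> real\<close>, where the results on compact
  sets above apply.\<close>

definition stereo :: "complex option \<Rightarrow> complex \<times> real" where
  "stereo x = (case x of None \<Rightarrow> (0, 1)
     | Some z \<Rightarrow> (2 * z / of_real (1 + (cmod z)\<^sup>2), ((cmod z)\<^sup>2 - 1) / (1 + (cmod z)\<^sup>2)))"

lemma stereo_simps:
  "stereo None = (0, 1)"
  "stereo (Some z) = (2 * z / of_real (1 + (cmod z)\<^sup>2), 1 - 2 / (1 + (cmod z)\<^sup>2))"
proof -
  have "1 + (cmod z)\<^sup>2 \<noteq> 0" by (smt (verit) zero_le_power2)
  then show "stereo (Some z) = (2 * z / of_real (1 + (cmod z)\<^sup>2), 1 - 2 / (1 + (cmod z)\<^sup>2))"
    by (simp add: stereo_def field_simps)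
qed (simp add: stereo_def)

text \<open>Clearing denominators reduces it to the polynomial identity
  \<open>|z B - w A|^2 + (A - B)^2 = A B |z - w|^2\<close>.\<close>

lemma stereo_identity:
  fixes z w :: complex
  defines "A \<equiv> 1 + (cmod z)\<^sup>2" and "B \<equiv> 1 + (cmod w)\<^sup>2"
  shows "(cmod (2 * z / of_real A - 2 * w / of_real B))\<^sup>2 + (2 / B - 2 / A)\<^sup>2 = (2 * cmod (z - w))\<^sup>2 / (A * B)"
proof -
  have A: "A > 0" and B: "B > 0" unfolding A_def B_def by (smt (verit) zero_le_power2)+
  have "2 * z / of_real A - 2 * w / of_real B = 2 * (z * of_real B - w * of_real A) / of_real (A * B)"
    using A B by (simp add: field_simps)
  then have 1: "(cmod (2 * z / of_real A - 2 * w / of_real B))\<^sup>2 = 4 * (cmod (z * of_real B - w * of_real A))\<^sup>2 / (A * B)\<^sup>2"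
    using A B by (simp add: norm_mult norm_divide power_divide power_mult_distrib del: right_diff_distrib_numeral)
  have 2: "(2 / B - 2 / A)\<^sup>2 = 4 * (A - B)\<^sup>2 / (A * B)\<^sup>2"
    using A B by (simp add: field_simps power2_eq_square)
  have "(cmod (z * of_real B - w * of_real A))\<^sup>2 + (A - B)\<^sup>2 = A * B * (cmod (z - w))\<^sup>2"
    unfolding cmod_power2 A_def B_def by (simp add: algebra_simps power2_eq_square)
  then have "4 * (cmod (z * of_real B - w * of_real A))\<^sup>2 / (A * B)\<^sup>2 + 4 * (A - B)\<^sup>2 / (A * B)\<^sup>2 =
      4 * (A * B * (cmod (z - w))\<^sup>2) / (A * B)\<^sup>2"
    by (simp add: add_divide_distrib[symmetric] distrib_left[symmetric])
  also have "\<dots> = (2 * cmod (z - w))\<^sup>2 / (A * B)" using A B by (simp add: power2_eq_square)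
  finally show ?thesis unfolding 1 2 .
qed

lemma dist_stereo: "dist (stereo x) (stereo y) = chordal x y"
proof -
  have inf: "(cmod (2 * z / of_real (1 + (cmod z)\<^sup>2)))\<^sup>2 + (2 / (1 + (cmod z)\<^sup>2))\<^sup>2 = 2\<^sup>2 / (1 + (cmod z)\<^sup>2)" for z
  proof -
    define A where "A = 1 + (cmod z)\<^sup>2"
    have A: "A > 0" unfolding A_def by (smt (verit) zero_le_power2)
    have "(cmod (2 * z / of_real A))\<^sup>2 + (2 / A)\<^sup>2 = 4 * ((cmod z)\<^sup>2 + 1) / A\<^sup>2"
      using A by (simp add: norm_mult norm_divide power_divide power_mult_distrib add_divide_distrib distrib_left)
    also have "(cmod z)\<^sup>2 + 1 = A" by (simp add: A_def)
    finally show ?thesis using A unfolding A_def[symmetric] by (simp add: power2_eq_square)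
  qed
  show ?thesis
  proof (cases x; cases y)
    fix z w assume xy: "x = Some z" "y = Some w"
    have "dist (stereo x) (stereo y) = sqrt ((2 * cmod (z - w))\<^sup>2 / ((1 + (cmod z)\<^sup>2) * (1 + (cmod w)\<^sup>2)))"
      unfolding xy stereo_simps dist_Pair_Pair dist_real_def unfolding dist_norm stereo_identity[symmetric] by simp
    also have "\<dots> = chordal x y" by (simp add: xy real_sqrt_divide real_sqrt_mult)
    finally show ?thesis .
  next
    fix z assume xy: "x = Some z" "y = None"
    have "dist (stereo x) (stereo y) = sqrt (2\<^sup>2 / (1 + (cmod z)\<^sup>2))"
      unfolding xy stereo_simps dist_Pair_Pair dist_real_def unfolding dist_norm inf[symmetric] by simp
    also have "\<dots> = chordal x y" by (simp add: xy real_sqrt_divide real_sqrt_mult)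
    finally show ?thesis .
  next
    fix z assume xy: "x = None" "y = Some z"
    have "dist (stereo x) (stereo y) = sqrt (2\<^sup>2 / (1 + (cmod z)\<^sup>2))"
      unfolding xy stereo_simps dist_Pair_Pair dist_real_def unfolding dist_norm inf[symmetric] by (simp add: norm_minus_commute)
    also have "\<dots> = chordal x y" by (simp add: xy real_sqrt_divide real_sqrt_mult)
    finally show ?thesis .
  qed simp
qed

lemma chordal_nonneg [simp]: "0 \<le> chordal x y"
  by (metis dist_stereo zero_le_dist)

lemma chordal_self [simp]: "chordal x x = 0"
  by (metis dist_stereo dist_self)

lemma chordal_commute: "chordal x y = chordal y x"
  by (metis dist_stereo dist_commute)

lemma chordal_triangle: "chordal x z \<le> chordal x y + chordal y z"
  by (metis dist_stereo dist_triangle)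

lemma chordal_eq_0_iff [simp]: "chordal x y = 0 \<longleftrightarrow> x = y"
proof
  have pos: "1 + (cmod z)\<^sup>2 \<noteq> 0" for z by (smt (verit) zero_le_power2)
  assume "chordal x y = 0"
  then show "x = y" using pos by (cases x; cases y) auto
qed simp

lemma inj_stereo: "inj stereo"
  by (rule injI) (metis chordal_eq_0_iff dist_stereo dist_self)

text \<open>Gives compactness of the whole space. A point \<open>(u, t)\<close> other than the north
  pole comes from \<open>u / (1 - t)\<close>.\<close>

lemma range_stereo: "range stereo = sphere 0 1"
proof (intro equalityI subsetI)
  fix p assume "p \<in> range stereo"
  then obtain x where x: "p = stereo x" by blast
  show "p \<in> sphere 0 1"
  proof (cases x)
    case (Some z)
    define A where "A = 1 + (cmod z)\<^sup>2"
    have A: "A > 0" unfolding A_def by (smt (verit) zero_le_power2)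
    have "(cmod (2 * z / of_real A))\<^sup>2 + (1 - 2 / A)\<^sup>2 = (4 * (cmod z)\<^sup>2 + (A - 2)\<^sup>2) / A\<^sup>2"
      using A by (simp add: norm_mult norm_divide power_divide power_mult_distrib field_simps)
    also have "4 * (cmod z)\<^sup>2 + (A - 2)\<^sup>2 = A\<^sup>2" by (simp add: A_def power2_eq_square algebra_simps)
    finally have "norm p = 1" using A unfolding x Some stereo_simps A_def[symmetric] norm_Pair by simp
    then show ?thesis by simp
  qed (simp add: x stereo_simps norm_Pair)
next
  fix p :: "complex \<times> real" assume "p \<in> sphere 0 1"
  then obtain u t where p: "p = (u, t)" and n: "(cmod u)\<^sup>2 + t\<^sup>2 = 1"
    by (cases p) (auto simp: norm_Pair)
  show "p \<in> range stereo"
  proof (cases "t = 1")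
    case True
    then have "p = stereo None" using n p by (simp add: stereo_simps)
    then show ?thesis by blast
  next
    case False
    have "t\<^sup>2 \<le> 1\<^sup>2" using n by (smt (verit) zero_le_power2 one_power2)
    then have "t \<le> 1" by (rule power2_le_imp_le) simp
    then have t: "1 - t > 0" using False by simp
    define z where "z = u / of_real (1 - t)"
    have "(cmod z)\<^sup>2 = (1 - t\<^sup>2) / (1 - t)\<^sup>2"
      using t n by (simp add: z_def norm_divide power_divide del: of_real_diff)
    then have "1 + (cmod z)\<^sup>2 = ((1 - t)\<^sup>2 + (1 - t\<^sup>2)) / (1 - t)\<^sup>2"
      using t by (simp add: add_divide_distrib)
    also have "(1 - t)\<^sup>2 + (1 - t\<^sup>2) = 2 * (1 - t)" by (simp add: power2_eq_square algebra_simps)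
    also have "2 * (1 - t) / (1 - t)\<^sup>2 = 2 / (1 - t)" using t by (simp add: power2_eq_square del: right_diff_distrib_numeral)
    finally have A: "1 + (cmod z)\<^sup>2 = 2 / (1 - t)" .
    have "complex_of_real (1 - t) \<noteq> 0" using t by (metis less_irrefl of_real_eq_0_iff)
    then have "2 * z / of_real (2 / (1 - t)) = u" by (simp add: z_def del: of_real_diff)
    then have "stereo (Some z) = p" unfolding stereo_simps A p using t by (simp add: diff_divide_distrib)
    then show ?thesis by (metis rangeI)
  qed
qed

text \<open>The device that makes pointwise choices of radii uniform over the sphere.\<close>

lemma chordal_finite_subcover:
  assumes "\<And>x. r x > (0::real)"
  obtains F where "finite F" "\<And>y. \<exists>x\<in>F. chordal x y < r x"
proof -
  have c: "compact (range stereo)" unfolding range_stereo by simp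
  have cov: "range stereo \<subseteq> (\<Union>x\<in>UNIV. ball (stereo x) (r x))"
  proof
    fix p assume "p \<in> range stereo"
    then obtain x where "p = stereo x" by blast
    then show "p \<in> (\<Union>x\<in>UNIV. ball (stereo x) (r x))" using assms[of x] by (intro UN_I[of x]) auto
  qed
  obtain F where F: "finite F" "range stereo \<subseteq> (\<Union>x\<in>F. ball (stereo x) (r x))"
    using compactE_image[OF c open_ball cov] by metis
  have "\<exists>x\<in>F. chordal x y < r x" for y
  proof -
    have "stereo y \<in> (\<Union>x\<in>F. ball (stereo x) (r x))" using F(2) by blast
    then show ?thesis by (auto simp: dist_stereo)
  qed
  with F(1) show thesis by (rule that)
qed

section \<open>Homogeneous coordinates and rotated charts of the sphere\<close>

definition wedge :: "complex \<times> complex \<Rightarrow> complex \<times> complex \<Rightarrow> complex" where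
  "wedge u v = fst u * snd v - snd u * fst v"

definition proj :: "complex \<times> complex \<Rightarrow> complex option" where
  "proj u = (if snd u = 0 then None else Some (fst u / snd u))"

definition hlift :: "complex option \<Rightarrow> complex \<times> complex" where
  "hlift x = (case x of None \<Rightarrow> (1, 0) | Some z \<Rightarrow> (z, 1))"

lemma proj_hlift [simp]: "proj (hlift x) = x"
  by (cases x) (auto simp: proj_def hlift_def)

lemma hlift_nonzero [simp]: "hlift x \<noteq> 0"
  by (cases x) (auto simp: hlift_def zero_prod_def)

lemma sqrt_one_plus_quotient:
  assumes "b \<noteq> 0"
  shows "sqrt (1 + (cmod (a / b))\<^sup>2) = norm (a, b) / cmod b"
proof -
  have "1 + (cmod (a / b))\<^sup>2 = ((cmod a)\<^sup>2 + (cmod b)\<^sup>2) / (cmod b)\<^sup>2"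
    using assms by (simp add: norm_divide power_divide field_simps)
  then show ?thesis by (simp add: real_sqrt_divide norm_Pair)
qed

text \<open>In homogeneous coordinates the chordal distance is a normalised determinant, which
  treats infinity like any other point. The four cases only match this with the case-based
  definition of \<open>chordal\<close>.\<close>

lemma chordal_proj:
  assumes "u \<noteq> 0" "v \<noteq> 0"
  shows "chordal (proj u) (proj v) = 2 * cmod (wedge u v) / (norm u * norm v)"
proof -
  obtain a b c e where uv: "u = (a, b)" "v = (c, e)" by (cases u; cases v)
  show ?thesis
  proof (cases "b = 0"; cases "e = 0")
    assume "b = 0" "e = 0"
    then show ?thesis by (simp add: uv proj_def wedge_def)
  next
    assume b: "b = 0" and e: "e \<noteq> 0"
    then have "a \<noteq> 0" using assms uv by (auto simp: zero_prod_def)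
    then show ?thesis using b e by (simp add: uv proj_def wedge_def sqrt_one_plus_quotient norm_mult)
  next
    assume b: "b \<noteq> 0" and e: "e = 0"
    then have "c \<noteq> 0" using assms uv by (auto simp: zero_prod_def)
    then show ?thesis using b e by (simp add: uv proj_def wedge_def sqrt_one_plus_quotient norm_mult)
  next
    assume b: "b \<noteq> 0" and e: "e \<noteq> 0"
    have "a / b - c / e = (a * e - b * c) / (b * e)" using b e by (simp add: field_simps)
    then have "cmod (a / b - c / e) = cmod (a * e - b * c) / (cmod b * cmod e)"
      by (simp add: norm_divide norm_mult)
    then show ?thesis using b e
      by (simp add: uv proj_def wedge_def real_sqrt_mult sqrt_one_plus_quotient)
  qed
qed

lemma proj_eq_iff_wedge:
  assumes "u \<noteq> 0" "v \<noteq> 0"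
  shows "proj u = proj v \<longleftrightarrow> wedge u v = 0"
  using chordal_proj[OF assms] assms chordal_eq_0_iff[of "proj u" "proj v"] by simp

text \<open>The chart centred at \<open>x\<close> which is obtained from the affine chart by a rotation of the sphere.\<close>

definition chart :: "complex option \<Rightarrow> complex \<Rightarrow> complex \<times> complex" where
  "chart x t = (fst (hlift x) - t * cnj (snd (hlift x)), snd (hlift x) + t * cnj (fst (hlift x)))"

lemma chart_0 [simp]: "chart x 0 = hlift x"
  by (simp add: chart_def)

lemma norm_sq_prod: "complex_of_real ((norm u)\<^sup>2) = fst u * cnj (fst u) + snd u * cnj (snd u)"
  for u :: "complex \<times> complex"
  by (cases u) (simp add: norm_Pair complex_norm_square[symmetric] real_sqrt_pow2)

lemma wedge_chart: "wedge (chart x s) (chart x t) = (t - s) * complex_of_real ((norm (hlift x))\<^sup>2)"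
  unfolding norm_sq_prod by (simp add: wedge_def chart_def algebra_simps)

text \<open>The vector multiplied by \<open>t\<close> in \<open>chart x t\<close> is orthogonal to
  \<open>hlift x\<close> and of the same length, so this is Pythagoras.\<close>

lemma norm_chart: "norm (chart x t) = norm (hlift x) * sqrt (1 + (cmod t)\<^sup>2)"
proof -
  have "complex_of_real ((norm (chart x t))\<^sup>2) = complex_of_real ((norm (hlift x))\<^sup>2 * (1 + (cmod t)\<^sup>2))"
    unfolding of_real_mult of_real_add norm_sq_prod complex_norm_square[of t]
    by (simp add: chart_def algebra_simps)
  then have "(norm (chart x t))\<^sup>2 = (norm (hlift x))\<^sup>2 * (1 + (cmod t)\<^sup>2)"
    by (simp only: of_real_eq_iff)
  then have "sqrt ((norm (chart x t))\<^sup>2) = sqrt ((norm (hlift x))\<^sup>2 * (1 + (cmod t)\<^sup>2))" by simp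
  then show ?thesis by (simp add: real_sqrt_mult)
qed

lemma one_plus_cmod_sq_pos: "0 < 1 + (cmod t)\<^sup>2"
  by (smt (verit) zero_le_power2)

lemma chart_nonzero [simp]: "chart x t \<noteq> 0"
proof -
  have "norm (chart x t) \<noteq> 0" unfolding norm_chart using one_plus_cmod_sq_pos[of t] by simp
  then show ?thesis by auto
qed

lemma continuous_chart: "continuous_on UNIV (chart x)"
  unfolding chart_def by (intro continuous_intros)

lemma chordal_chart: "chordal x (proj (chart x t)) = 2 * cmod t / sqrt (1 + (cmod t)\<^sup>2)"
proof -
  have "chordal x (proj (chart x t)) = 2 * cmod (wedge (chart x 0) (chart x t)) / (norm (chart x 0) * norm (chart x t))"
    using chordal_proj[of "chart x 0" "chart x t"] by (simp del: chart_0) (simp)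
  also have "\<dots> = 2 * cmod t / sqrt (1 + (cmod t)\<^sup>2)"
    unfolding wedge_chart norm_chart by (simp add: norm_mult power2_eq_square)
  finally show ?thesis .
qed

lemma chordal_chart_le: "chordal x (proj (chart x t)) \<le> 2 * cmod t"
proof -
  have "1 \<le> sqrt (1 + (cmod t)\<^sup>2)" by simp
  then have "2 * cmod t / sqrt (1 + (cmod t)\<^sup>2) \<le> 2 * cmod t / 1"
    by (rule divide_left_mono) (use one_plus_cmod_sq_pos[of t] in auto)
  then show ?thesis unfolding chordal_chart by simp
qed

lemma chordal_chart_pos: "t \<noteq> 0 \<Longrightarrow> 0 < chordal x (proj (chart x t))"
  unfolding chordal_chart
  by (rule divide_pos_pos) (use one_plus_cmod_sq_pos[of t] in auto)

text \<open>Without isolated points, limits of distance quotients are unique; this is used to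
  compare derivatives.\<close>

lemma sphere_perfect:
  assumes "r > 0"
  obtains y where "y \<noteq> x" "chordal x y < r"
proof -
  let ?y = "proj (chart x (of_real (r / 4)))"
  have "cmod (of_real (r / 4)) = r / 4" unfolding norm_of_real using assms by simp
  then have "chordal x ?y < r" using chordal_chart_le[of x "of_real (r / 4)"] assms by linarith
  moreover have "?y \<noteq> x" using chordal_chart_pos[of "of_real (r / 4)" x] assms by auto
  ultimately show thesis using that by blast
qed

text \<open>Expand \<open>v\<close> in the orthogonal basis \<open>u\<close>,
  \<open>(- cnj (snd u), cnj (fst u))\<close> with coefficients \<alpha> and \<beta>, and take
  \<open>t = \<beta> / \<alpha>\<close>. Only the antipode of \<open>x\<close>, at distance 2, has
  \<open>\<alpha> = 0\<close>, and the assumption excludes it.\<close>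

lemma chart_surj:
  assumes "chordal x y \<le> 1"
  obtains t where "cmod t \<le> chordal x y" "y = proj (chart x t)"
proof -
  define u where "u = hlift x"
  define v where "v = hlift y"
  define N where "N = complex_of_real ((norm u)\<^sup>2)"
  have u0: "u \<noteq> 0" by (simp add: u_def)
  have N: "N \<noteq> 0" using u0 by (simp add: N_def)
  define \<alpha> where "\<alpha> = (fst v * cnj (fst u) + snd v * cnj (snd u)) / N"
  define \<beta> where "\<beta> = wedge u v / N"
  have v1: "fst v = \<alpha> * fst u - \<beta> * cnj (snd u)"
  proof -
    have "\<alpha> * fst u - \<beta> * cnj (snd u) = fst v * (fst u * cnj (fst u) + snd u * cnj (snd u)) / N"
      by (simp add: \<alpha>_def \<beta>_def wedge_def diff_divide_distrib[symmetric] algebra_simps)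
    also have "fst u * cnj (fst u) + snd u * cnj (snd u) = N" unfolding N_def norm_sq_prod ..
    finally show ?thesis using N by simp
  qed
  have v2: "snd v = \<alpha> * snd u + \<beta> * cnj (fst u)"
  proof -
    have "\<alpha> * snd u + \<beta> * cnj (fst u) = snd v * (fst u * cnj (fst u) + snd u * cnj (snd u)) / N"
      by (simp add: \<alpha>_def \<beta>_def wedge_def add_divide_distrib[symmetric] algebra_simps)
    also have "fst u * cnj (fst u) + snd u * cnj (snd u) = N" unfolding N_def norm_sq_prod ..
    finally show ?thesis using N by simp
  qed
  have "\<alpha> \<noteq> 0"
  proof
    assume \<alpha>: "\<alpha> = 0"
    have v0: "v \<noteq> 0" by (simp add: v_def)
    have "complex_of_real ((norm v)\<^sup>2) = \<beta> * cnj \<beta> * N"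
      unfolding norm_sq_prod N_def using v1 v2 \<alpha> by (simp add: algebra_simps)
    also have "\<dots> = complex_of_real ((cmod \<beta> * norm u)\<^sup>2)"
      unfolding power_mult_distrib of_real_mult complex_norm_square N_def by simp
    finally have "(norm v)\<^sup>2 = (cmod \<beta> * norm u)\<^sup>2" by (simp only: of_real_eq_iff)
    then have nv: "norm v = cmod \<beta> * norm u" by (simp add: power2_eq_iff_nonneg)
    have "cmod (wedge u v) = cmod \<beta> * (norm u)\<^sup>2"
      using N by (simp add: \<beta>_def N_def norm_divide norm_mult norm_power)
    then have "chordal x y = 2 * (cmod \<beta> * (norm u)\<^sup>2) / (norm u * (cmod \<beta> * norm u))"
      using chordal_proj[OF u0 v0] nv by (simp add: u_def v_def)
    also have "\<dots> = 2"
    proof -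
      have "cmod \<beta> \<noteq> 0" using nv v0 by auto
      then show ?thesis using u0 by (simp add: power2_eq_square)
    qed
    finally show False using assms by simp
  qed
  define t where "t = \<beta> / \<alpha>"
  have "v = (\<alpha> * fst (chart x t), \<alpha> * snd (chart x t))"
    using v1 v2 \<open>\<alpha> \<noteq> 0\<close> by (intro prod_eqI) (auto simp: chart_def u_def[symmetric] t_def algebra_simps)
  then have "wedge v (chart x t) = 0" by (simp add: wedge_def)
  then have y: "y = proj (chart x t)"
    using proj_eq_iff_wedge[of v "chart x t"] by (simp add: v_def)
  \<comment> \<open>Turns the exact distance formula into
    \<open>2 * cmod t \<le> chordal x y + cmod t\<close>.\<close>
  have le: "sqrt (1 + (cmod t)\<^sup>2) \<le> 1 + cmod t"
    by (rule real_le_lsqrt) (auto simp: power2_eq_square algebra_simps)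
  have "2 * cmod t = chordal x y * sqrt (1 + (cmod t)\<^sup>2)"
    unfolding y chordal_chart using one_plus_cmod_sq_pos[of t] by simp
  also have "\<dots> \<le> chordal x y * (1 + cmod t)" by (rule mult_left_mono[OF le]) simp
  also have "\<dots> \<le> chordal x y + 1 * cmod t"
    using assms by (simp add: distrib_left mult_left_le_one_le)
  finally have "cmod t \<le> chordal x y" by simp
  then show thesis using y by (rule that)
qed

section \<open>Rational maps\<close>

text \<open>The homogenisation of \<open>p\<close> to degree \<open>d\<close>. Numerator and
  denominator get the same degree, so that their quotient depends only on the projective
  point.\<close>

definition homog :: "nat \<Rightarrow> complex poly \<Rightarrow> complex \<times> complex \<Rightarrow> complex" where
  "homog d p u = (\<Sum>k\<le>d. coeff p k * (fst u ^ k * snd u ^ (d - k)))"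

lemma homog_affine:
  assumes "degree p \<le> d" "snd u \<noteq> 0"
  shows "homog d p u = snd u ^ d * poly p (fst u / snd u)"
proof -
  have "snd u ^ d * poly p (fst u / snd u) = (\<Sum>k\<le>degree p. coeff p k * (snd u ^ d * (fst u / snd u) ^ k))"
    by (simp add: poly_altdef sum_distrib_left mult_ac)
  also have "\<dots> = (\<Sum>k\<le>d. coeff p k * (snd u ^ d * (fst u / snd u) ^ k))"
    by (rule sum.mono_neutral_left) (use assms in \<open>auto simp: coeff_eq_0\<close>)
  also have "\<dots> = homog d p u"
    unfolding homog_def
    by (intro sum.cong refl) (use assms in \<open>auto simp: power_divide power_diff\<close>)
  finally show ?thesis ..
qed

lemma homog_infinity:
  assumes "snd u = 0"
  shows "homog d p u = coeff p d * fst u ^ d"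
proof -
  have "homog d p u = (\<Sum>k\<le>d. if k = d then coeff p d * fst u ^ d else 0)"
    unfolding homog_def by (intro sum.cong refl) (use assms in \<open>auto simp: power_0_left\<close>)
  then show ?thesis by simp
qed

lemma continuous_homog: "continuous_on UNIV (homog d p)"
  unfolding homog_def by (intro continuous_intros)

text \<open>With \<open>k = l + j\<close>, a common monomial factor splits off and leaves
  \<open>x ^ j - y ^ j\<close> for \<open>x = fst u * snd v\<close> and
  \<open>y = snd u * fst v\<close>, which is divisible by \<open>x - y = wedge u v\<close>.\<close>

lemma monomial_wedge:
  assumes "l \<le> k" "k \<le> d"
  shows "\<exists>g. continuous_on UNIV g \<and> (\<forall>u v :: complex \<times> complex.
     (fst u ^ k * snd u ^ (d - k)) * (fst v ^ l * snd v ^ (d - l)) -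
     (fst u ^ l * snd u ^ (d - l)) * (fst v ^ k * snd v ^ (d - k)) = wedge u v * g (u, v))"
proof -
  define j where "j = k - l"
  have k: "k = l + j" and dl: "d - l = (d - k) + j" using assms by (auto simp: j_def)
  let ?g = "\<lambda>p :: (complex \<times> complex) \<times> (complex \<times> complex). case p of (u, v) \<Rightarrow> (fst u * fst v) ^ l * (snd u * snd v) ^ (d - k) *
      (\<Sum>i<j. (snd u * fst v) ^ (j - Suc i) * (fst u * snd v) ^ i)"
  have "continuous_on UNIV ?g"
    unfolding case_prod_unfold by (intro continuous_intros)
  moreover have "(fst u ^ k * snd u ^ (d - k)) * (fst v ^ l * snd v ^ (d - l)) -
     (fst u ^ l * snd u ^ (d - l)) * (fst v ^ k * snd v ^ (d - k)) = wedge u v * ?g (u, v)" for u v :: "complex \<times> complex"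
  proof -
    have "(fst u ^ k * snd u ^ (d - k)) * (fst v ^ l * snd v ^ (d - l)) -
     (fst u ^ l * snd u ^ (d - l)) * (fst v ^ k * snd v ^ (d - k)) =
      (fst u * fst v) ^ l * (snd u * snd v) ^ (d - k) * ((fst u * snd v) ^ j - (snd u * fst v) ^ j)"
      unfolding dl unfolding k by (simp add: power_add power_mult_distrib algebra_simps)
    then show ?thesis unfolding power_diff_sumr2 wedge_def by (simp add: mult_ac)
  qed
  ultimately show ?thesis by blast
qed

lemma monomial_wedge':
  assumes "l \<le> d" "k \<le> d"
  shows "\<exists>g. continuous_on UNIV g \<and> (\<forall>u v :: complex \<times> complex.
     (fst u ^ k * snd u ^ (d - k)) * (fst v ^ l * snd v ^ (d - l)) -
     (fst u ^ l * snd u ^ (d - l)) * (fst v ^ k * snd v ^ (d - k)) = wedge u v * g (u, v))"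
proof (cases "l \<le> k")
  case True
  then show ?thesis using assms by (intro monomial_wedge)
next
  case False
  then obtain g where g: "continuous_on UNIV g" "\<And>u v :: complex \<times> complex.
     (fst u ^ l * snd u ^ (d - l)) * (fst v ^ k * snd v ^ (d - k)) -
     (fst u ^ k * snd u ^ (d - k)) * (fst v ^ l * snd v ^ (d - l)) = wedge u v * g (u, v)"
    using monomial_wedge[of k l d] assms by auto
  have "(fst u ^ k * snd u ^ (d - k)) * (fst v ^ l * snd v ^ (d - l)) -
     (fst u ^ l * snd u ^ (d - l)) * (fst v ^ k * snd v ^ (d - k)) = wedge u v * - g (u, v)" for u v :: "complex \<times> complex"
    using g(2)[of u v] by (simp add: algebra_simps)
  then show ?thesis using g(1) by (intro exI[of _ "\<lambda>p. - g p"]) (auto intro: continuous_intros)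
qed

text \<open>Dividing by \<open>wedge u v\<close> leaves a factor that is continuous on the diagonal
  as well. Its diagonal values later give the derivative, without a separate treatment of poles and
  infinity.\<close>

lemma homog_wedge:
  obtains G where "continuous_on UNIV G"
    "\<And>u v. wedge (homog d p u, homog d q u) (homog d p v, homog d q v) = wedge u v * G (u, v)"
proof -
  define P where "P k l g \<longleftrightarrow> continuous_on UNIV g \<and> (\<forall>u v :: complex \<times> complex.
     (fst u ^ k * snd u ^ (d - k)) * (fst v ^ l * snd v ^ (d - l)) -
     (fst u ^ l * snd u ^ (d - l)) * (fst v ^ k * snd v ^ (d - k)) = wedge u v * g (u, v))" for k l g
  define g where "g k l = (SOME g. P k l g)" for k l
  have Pg: "P k l (g k l)" if "k \<in> {..d}" "l \<in> {..d}" for k l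
  proof -
    have "\<exists>g. P k l g" unfolding P_def by (rule monomial_wedge') (use that in auto)
    then show ?thesis unfolding g_def by (rule someI_ex)
  qed
  have g: "continuous_on UNIV (g k l)"
    "(fst u ^ k * snd u ^ (d - k)) * (fst v ^ l * snd v ^ (d - l)) -
     (fst u ^ l * snd u ^ (d - l)) * (fst v ^ k * snd v ^ (d - k)) = wedge u v * g k l (u, v)"
    if "k \<in> {..d}" "l \<in> {..d}" for k l u v
    using Pg[OF that] unfolding P_def by blast+
  let ?m = "\<lambda>k u. fst u ^ k * snd u ^ (d - k) :: complex"
  show thesis
  proof (rule that[of "\<lambda>x. \<Sum>k\<le>d. \<Sum>l\<le>d. coeff p k * coeff q l * g k l x"])
    show "continuous_on UNIV (\<lambda>x. \<Sum>k\<le>d. \<Sum>l\<le>d. coeff p k * coeff q l * g k l x)"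
      by (intro continuous_intros g)
    fix u v
    have "wedge (homog d p u, homog d q u) (homog d p v, homog d q v) =
        (\<Sum>k\<le>d. \<Sum>l\<le>d. (coeff p k * ?m k u) * (coeff q l * ?m l v)) -
        (\<Sum>l\<le>d. \<Sum>k\<le>d. (coeff q l * ?m l u) * (coeff p k * ?m k v))"
      by (simp only: wedge_def fst_conv snd_conv homog_def sum_product)
    also have "(\<Sum>l\<le>d. \<Sum>k\<le>d. (coeff q l * ?m l u) * (coeff p k * ?m k v)) =
        (\<Sum>k\<le>d. \<Sum>l\<le>d. (coeff q l * ?m l u) * (coeff p k * ?m k v))" by (rule sum.swap)
    also have "(\<Sum>k\<le>d. \<Sum>l\<le>d. (coeff p k * ?m k u) * (coeff q l * ?m l v)) -
        (\<Sum>k\<le>d. \<Sum>l\<le>d. (coeff q l * ?m l u) * (coeff p k * ?m k v)) =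
        (\<Sum>k\<le>d. \<Sum>l\<le>d. coeff p k * coeff q l * (?m k u * ?m l v - ?m l u * ?m k v))"
      by (simp add: sum_subtractf right_diff_distrib mult_ac)
    also have "\<dots> = (\<Sum>k\<le>d. \<Sum>l\<le>d. coeff p k * coeff q l * (wedge u v * g k l (u, v)))"
      by (intro sum.cong refl arg_cong2[where f = "(*)"] g)
    also have "\<dots> = wedge u v * (\<Sum>k\<le>d. \<Sum>l\<le>d. coeff p k * coeff q l * g k l (u, v))"
      by (simp add: sum_distrib_left mult_ac)
    finally show "wedge (homog d p u, homog d q u) (homog d p v, homog d q v) =
        wedge u v * (\<Sum>k\<le>d. \<Sum>l\<le>d. coeff p k * coeff q l * g k l (u, v))" .
  qed
qed

text \<open>Coprimality rules out common zeros at finite points, and at infinity the coefficient of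
  degree \<open>d\<close> is nonzero in \<open>p\<close> or in \<open>q\<close>. The holomorphy
  clause is for the openness argument.\<close>

lemma rational_map_homogeneous:
  assumes T: "is_rational_map T d"
  obtains H G where "\<And>u. u \<noteq> 0 \<Longrightarrow> H u \<noteq> 0" "\<And>u. u \<noteq> 0 \<Longrightarrow> T (proj u) = proj (H u)"
    "continuous_on UNIV H" "continuous_on UNIV G" "\<And>u v. wedge (H u) (H v) = wedge u v * G (u, v)"
    "\<And>x w. (\<lambda>t. wedge (H (chart x t)) w) holomorphic_on UNIV"
proof -
  obtain p q where q: "q \<noteq> 0" and cop: "coprime p q" and d: "max (degree p) (degree q) = d"
    and Tz: "\<And>z. T (Some z) = (if poly q z = 0 then None else Some (poly p z / poly q z))"
    and Tinf: "T None = (if degree p > degree q then None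
                  else if degree p = degree q then Some (lead_coeff p / lead_coeff q)
                  else Some 0)"
    using T unfolding is_rational_map_def by blast
  define H where "H u = (homog d p u, homog d q u)" for u
  obtain G where G: "continuous_on UNIV G" "\<And>u v. wedge (H u) (H v) = wedge u v * G (u, v)"
    unfolding H_def by (rule homog_wedge[of d p q]) blast
  have main: "H u \<noteq> 0 \<and> T (proj u) = proj (H u)" if u: "u \<noteq> 0" for u
  proof (cases "snd u = 0")
    case False
    have *: "homog d p u = snd u ^ d * poly p (fst u / snd u)" "homog d q u = snd u ^ d * poly q (fst u / snd u)"
      using d False by (auto intro!: homog_affine)
    have "poly p (fst u / snd u) \<noteq> 0 \<or> poly q (fst u / snd u) \<noteq> 0" by (rule coprime_poly_0[OF cop])
    then show ?thesis using False by (auto simp: H_def * zero_prod_def proj_def Tz)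
  next
    case True
    then have a: "fst u \<noteq> 0" using u by (cases u) (auto simp: zero_prod_def)
    have *: "homog d p u = coeff p d * fst u ^ d" "homog d q u = coeff q d * fst u ^ d"
      using homog_infinity[OF True] by auto
    consider "degree p > degree q" "d = degree p" | "degree p = degree q" "d = degree q" | "degree p < degree q" "d = degree q"
      using d by (cases "degree p" "degree q" rule: linorder_cases) auto
    then show ?thesis
    proof cases
      case 1
      then have "coeff q d = 0" "coeff p d \<noteq> 0" by (auto simp: coeff_eq_0)
      then have "homog d q u = 0" "homog d p u \<noteq> 0" using a by (auto simp: *)
      then show ?thesis using 1(1) True by (simp add: H_def zero_prod_def proj_def Tinf)
    next
      case 2
      then have "coeff q d \<noteq> 0" using q by simp
      then have "homog d q u \<noteq> 0" "homog d p u / homog d q u = lead_coeff p / lead_coeff q"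
        using a by (auto simp: * 2(1) 2(2)[symmetric])
      then show ?thesis using 2(1) True by (simp add: H_def zero_prod_def proj_def Tinf)
    next
      case 3
      then have "coeff q d \<noteq> 0" "coeff p d = 0" using q by (auto simp: coeff_eq_0)
      then have "homog d q u \<noteq> 0" "homog d p u = 0" using a by (auto simp: *)
      then show ?thesis using 3(1) True by (simp add: H_def zero_prod_def proj_def Tinf)
    qed
  qed
  have "continuous_on UNIV H" unfolding H_def by (intro continuous_on_Pair continuous_homog)
  moreover have "(\<lambda>t. wedge (H (chart x t)) w) holomorphic_on UNIV" for x w
    unfolding wedge_def H_def homog_def chart_def fst_conv snd_conv by (intro holomorphic_intros)
  ultimately show thesis using that main G by blast
qed

text \<open>Finite preimages are roots of \<open>q\<close> or of \<open>p - smult c q\<close>, and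
  infinity is simply added. The second polynomial vanishes only if \<open>q\<close> divides
  \<open>p\<close>, which for coprime \<open>p\<close> and \<open>q\<close> forces degree 0.\<close>

lemma rational_map_finite_fibre:
  assumes T: "is_rational_map T d" and d: "d \<ge> 1"
  shows "finite {x. T x = w}"
proof -
  obtain p q where q: "q \<noteq> 0" and cop: "coprime p q" and dd: "max (degree p) (degree q) = d"
    and Tz: "\<And>z. T (Some z) = (if poly q z = 0 then None else Some (poly p z / poly q z))"
    using T unfolding is_rational_map_def by blast
  have "\<exists>f. f \<noteq> 0 \<and> (\<forall>z. T (Some z) = w \<longrightarrow> poly f z = 0)"
  proof (cases w)
    case None
    then show ?thesis using q Tz by (intro exI[of _ q]) auto
  next
    case (Some c)
    have "p - smult c q \<noteq> 0"
    proof
      assume "p - smult c q = 0"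
      then have p: "p = smult c q" by simp
      then have "q dvd p" by (metis dvd_refl dvd_smult)
      then have "is_unit q" using cop by (metis coprime_common_divisor dvd_refl)
      then have "degree q = 0" using q by (simp add: is_unit_iff_degree)
      moreover have "degree p \<le> degree q" unfolding p by (rule degree_smult_le)
      ultimately show False using dd d by simp
    qed
    moreover have "poly (p - smult c q) z = 0" if "T (Some z) = w" for z
      using that Some Tz[of z] by (auto split: if_splits simp: field_simps)
    ultimately show ?thesis by blast
  qed
  then obtain f where f: "f \<noteq> 0" "\<And>z. T (Some z) = w \<Longrightarrow> poly f z = 0" by blast
  have "{x. T x = w} \<subseteq> insert None (Some ` {z. poly f z = 0})"
  proof
    fix x assume "x \<in> {x. T x = w}"
    then show "x \<in> insert None (Some ` {z. poly f z = 0})" using f(2) by (cases x) auto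
  qed
  moreover have "finite (insert None (Some ` {z. poly f z = 0}))" using poly_roots_finite[OF f(1)] by simp
  ultimately show ?thesis by (rule finite_subset)
qed

text \<open>In the chart at \<open>x\<close> the quotient of distances is a function \<Phi> that
  extends continuously to the diagonal, and \<open>l\<close> is its value at the centre. The error
  is additive because \<open>l\<close> can be 0, at critical points.\<close>

lemma rational_map_local_ratio:
  assumes T: "is_rational_map T d"
  shows "\<exists>l. \<forall>\<epsilon>>0. \<exists>r>0. \<forall>y y'. chordal x y < r \<longrightarrow> chordal x y' < r \<longrightarrow>
    \<bar>chordal (T y) (T y') - l * chordal y y'\<bar> \<le> \<epsilon> * chordal y y'"
proof -
  obtain H G where H: "\<And>u. u \<noteq> 0 \<Longrightarrow> H u \<noteq> 0" "\<And>u. u \<noteq> 0 \<Longrightarrow> T (proj u) = proj (H u)"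
    "continuous_on UNIV H" and G: "continuous_on UNIV G" "\<And>u v. wedge (H u) (H v) = wedge u v * G (u, v)"
    using rational_map_homogeneous[OF T] by metis
  define \<Phi> where "\<Phi> p = cmod (G (chart x (fst p), chart x (snd p))) * (norm (chart x (fst p)) * norm (chart x (snd p))) /
      (norm (H (chart x (fst p))) * norm (H (chart x (snd p))))" for p
  have ch: "continuous_on UNIV (\<lambda>p :: complex \<times> complex. chart x (fst p))" "continuous_on UNIV (\<lambda>p :: complex \<times> complex. chart x (snd p))"
    by (intro continuous_on_compose2[OF continuous_chart] continuous_intros; simp)+
  have Hch: "continuous_on UNIV (\<lambda>p :: complex \<times> complex. H (chart x (fst p)))" "continuous_on UNIV (\<lambda>p :: complex \<times> complex. H (chart x (snd p)))"
    by (intro continuous_on_compose2[OF H(3)] ch; simp)+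
  have Gch: "continuous_on UNIV (\<lambda>p. G (chart x (fst p), chart x (snd p)))"
    by (rule continuous_on_compose2[OF G(1)]) (intro continuous_on_Pair ch, simp)
  have cont: "continuous_on UNIV \<Phi>"
    unfolding \<Phi>_def by (intro continuous_intros ch Hch Gch) (simp add: H)
  have \<Phi>: "chordal (T (proj (chart x s))) (T (proj (chart x t))) =
      \<Phi> (s, t) * chordal (proj (chart x s)) (proj (chart x t))" for s t
    by (simp add: H(1,2) chordal_proj \<Phi>_def G(2) norm_mult)
  show ?thesis
  proof (rule exI[of _ "\<Phi> (0, 0)"], intro allI impI)
    fix \<epsilon> :: real assume "\<epsilon> > 0"
    then obtain \<delta> where \<delta>: "\<delta> > 0" "\<And>p. dist p (0, 0) < \<delta> \<Longrightarrow> dist (\<Phi> p) (\<Phi> (0, 0)) < \<epsilon>"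
      using cont unfolding continuous_on_iff by (metis UNIV_I)
    show "\<exists>r>0. \<forall>y y'. chordal x y < r \<longrightarrow> chordal x y' < r \<longrightarrow>
      \<bar>chordal (T y) (T y') - \<Phi> (0, 0) * chordal y y'\<bar> \<le> \<epsilon> * chordal y y'"
    proof (intro exI[of _ "min 1 (\<delta> / 2)"] conjI allI impI)
      fix y y' assume y: "chordal x y < min 1 (\<delta> / 2)" "chordal x y' < min 1 (\<delta> / 2)"
      obtain s where s: "cmod s \<le> chordal x y" "y = proj (chart x s)" using chart_surj[of x y] y by auto
      obtain t where t: "cmod t \<le> chordal x y'" "y' = proj (chart x t)" using chart_surj[of x y'] y by auto
      have "dist (s, t) (0, 0) \<le> dist s 0 + dist t 0"
        unfolding dist_Pair_Pair by (rule sqrt_sum_squares_le_sum) auto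
      also have "\<dots> < \<delta>" using s t y by simp
      finally have "\<bar>\<Phi> (s, t) - \<Phi> (0, 0)\<bar> \<le> \<epsilon>" using \<delta>(2) by (fastforce simp: dist_real_def)
      then have "\<bar>\<Phi> (s, t) - \<Phi> (0, 0)\<bar> * chordal y y' \<le> \<epsilon> * chordal y y'" by (rule mult_right_mono) simp
      moreover have "chordal (T y) (T y') - \<Phi> (0, 0) * chordal y y' = (\<Phi> (s, t) - \<Phi> (0, 0)) * chordal y y'"
        using \<Phi> s t by (simp add: algebra_simps)
      ultimately show "\<bar>chordal (T y) (T y') - \<Phi> (0, 0) * chordal y y'\<bar> \<le> \<epsilon> * chordal y y'"
        by (simp add: abs_mult)
    qed (use \<delta> in simp)
  qed
qed

text \<open>A finite subcover gives a uniform radius, but with the ratio \<open>L z\<close> at a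
  centre \<open>z\<close> of the cover. Testing it and \<open>L x\<close> on one nearby point
  \<open>y \<noteq> x\<close> shows that they differ by at most \<open>\<epsilon> / 2\<close>, and
  \<open>\<epsilon> / 4 + \<epsilon> / 2 \<le> \<epsilon>\<close>.\<close>

lemma rational_map_uniform_ratio:
  assumes T: "is_rational_map T d"
  obtains L where "\<And>\<epsilon>. \<epsilon> > 0 \<Longrightarrow> \<exists>r>0. \<forall>x y y'. chordal x y < r \<longrightarrow> chordal x y' < r \<longrightarrow>
    \<bar>chordal (T y) (T y') - L x * chordal y y'\<bar> \<le> \<epsilon> * chordal y y'"
proof -
  obtain L where L: "\<And>x \<epsilon>. \<epsilon> > 0 \<Longrightarrow> \<exists>r>0. \<forall>y y'. chordal x y < r \<longrightarrow> chordal x y' < r \<longrightarrow>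
    \<bar>chordal (T y) (T y') - L x * chordal y y'\<bar> \<le> \<epsilon> * chordal y y'"
    using rational_map_local_ratio[OF T] by metis
  show thesis
  proof (rule that[of L])
    fix \<epsilon> :: real assume \<epsilon>: "\<epsilon> > 0"
    then have "\<forall>x. \<exists>r>0. \<forall>y y'. chordal x y < r \<longrightarrow> chordal x y' < r \<longrightarrow>
      \<bar>chordal (T y) (T y') - L x * chordal y y'\<bar> \<le> \<epsilon> / 4 * chordal y y'"
      using L[of "\<epsilon> / 4"] by simp
    then obtain r where r: "\<And>x. r x > 0"
      "\<And>x y y'. chordal x y < r x \<Longrightarrow> chordal x y' < r x \<Longrightarrow>
        \<bar>chordal (T y) (T y') - L x * chordal y y'\<bar> \<le> \<epsilon> / 4 * chordal y y'"
      by metis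
    obtain F where F: "finite F" "\<And>y. \<exists>x\<in>F. chordal x y < r x / 2"
      using chordal_finite_subcover[of "\<lambda>x. r x / 2"] r(1) by (auto simp: half_gt_zero)
    have Lclose: "\<bar>L x - L z\<bar> \<le> \<epsilon> / 2" if x: "chordal z x < r z / 2" for x z
    proof -
      obtain y where y: "y \<noteq> x" "chordal x y < min (r x) (r z / 2)"
        using sphere_perfect[of "min (r x) (r z / 2)" x] r(1)[of x] r(1)[of z] by auto
      define D where "D = chordal x y"
      have D: "D > 0" using y(1) by (metis D_def chordal_eq_0_iff chordal_nonneg less_eq_real_def)
      have "chordal z y \<le> chordal z x + chordal x y" by (rule chordal_triangle)
      then have zy: "chordal z y < r z" using x y by linarith
      have zx: "chordal z x < r z" using x r(1)[of z] by linarith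
      have "\<bar>chordal (T x) (T y) - L z * D\<bar> \<le> \<epsilon> / 4 * D" using r(2)[OF zx zy] by (simp add: D_def)
      moreover have "\<bar>chordal (T x) (T y) - L x * D\<bar> \<le> \<epsilon> / 4 * D"
        using r(2)[of x x y] r(1)[of x] y by (simp add: D_def)
      ultimately have "\<bar>L x * D - L z * D\<bar> \<le> \<epsilon> / 4 * D + \<epsilon> / 4 * D" by linarith
      also have "\<bar>L x * D - L z * D\<bar> = \<bar>L x - L z\<bar> * D" using D by (simp add: abs_mult flip: left_diff_distrib)
      also have "\<epsilon> / 4 * D + \<epsilon> / 4 * D = \<epsilon> / 2 * D" by simp
      finally show ?thesis using D by (simp only: mult_le_cancel_right_pos)
    qed
    show "\<exists>r>0. \<forall>x y y'. chordal x y < r \<longrightarrow> chordal x y' < r \<longrightarrow>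
      \<bar>chordal (T y) (T y') - L x * chordal y y'\<bar> \<le> \<epsilon> * chordal y y'"
    proof (intro exI[of _ "Min (insert 1 ((\<lambda>x. r x / 2) ` F))"] conjI allI impI)
      show "0 < Min (insert 1 ((\<lambda>x. r x / 2) ` F))" using F(1) r(1) by auto
      fix x y y' assume y: "chordal x y < Min (insert 1 ((\<lambda>x. r x / 2) ` F))"
        "chordal x y' < Min (insert 1 ((\<lambda>x. r x / 2) ` F))"
      obtain z where z: "z \<in> F" "chordal z x < r z / 2" using F(2) by blast
      have "Min (insert 1 ((\<lambda>x. r x / 2) ` F)) \<le> r z / 2" using F(1) z by (intro Min_le) auto
      then have "chordal z y < r z" "chordal z y' < r z"
        using chordal_triangle[of z y x] chordal_triangle[of z y' x] z(2) y by linarith+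
      then have "\<bar>chordal (T y) (T y') - L z * chordal y y'\<bar> \<le> \<epsilon> / 4 * chordal y y'" by (rule r(2))
      moreover have "\<bar>L x - L z\<bar> * chordal y y' \<le> \<epsilon> / 2 * chordal y y'"
        by (rule mult_right_mono[OF Lclose[OF z(2)]]) simp
      moreover have "\<bar>L x - L z\<bar> * chordal y y' = \<bar>L x * chordal y y' - L z * chordal y y'\<bar>"
        by (simp add: abs_mult flip: left_diff_distrib)
      moreover have "0 \<le> \<epsilon> * chordal y y'" using \<epsilon> by simp
      ultimately show "\<bar>chordal (T y) (T y') - L x * chordal y y'\<bar> \<le> \<epsilon> * chordal y y'" by linarith
    qed
  qed
qed

text \<open>Openness: in charts, \<open>T \<xi> = w\<close> becomes an equation \<open>\<phi>\<^sub>w t = 0\<close> for a polynomial depending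
  continuously on \<open>w\<close>. For \<open>w = T x\<close> it vanishes at 0 but not on a small circle around 0, so for
  \<open>w\<close> nearby \<open>\<bar>\<phi>\<^sub>w\<bar>\<close> is smaller at 0 than on that circle, which forces a zero inside.\<close>

lemma rational_map_open:
  assumes T: "is_rational_map T d" and d: "d \<ge> 1" and \<epsilon>: "\<epsilon> > 0"
  shows "\<exists>\<eta>>0. \<forall>w. chordal (T x) w < \<eta> \<longrightarrow> (\<exists>\<xi>. chordal x \<xi> < \<epsilon> \<and> T \<xi> = w)"
proof -
  obtain H G where H: "\<And>u. u \<noteq> 0 \<Longrightarrow> H u \<noteq> 0" "\<And>u. u \<noteq> 0 \<Longrightarrow> T (proj u) = proj (H u)"
    "continuous_on UNIV H" "\<And>x w. (\<lambda>t. wedge (H (chart x t)) w) holomorphic_on UNIV"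
    using rational_map_homogeneous[OF T] by metis
  define F where "F p = wedge (H (chart x (snd p))) (chart (T x) (fst p))" for p
  have zero: "F (s, t) = 0 \<longleftrightarrow> T (proj (chart x t)) = proj (chart (T x) s)" for s t
    by (simp add: F_def H proj_eq_iff_wedge)
  have contF: "continuous_on UNIV F"
  proof -
    have 1: "continuous_on UNIV (\<lambda>p :: complex \<times> complex. chart (T x) (fst p))"
      by (intro continuous_on_compose2[OF continuous_chart] continuous_intros; simp)
    have 2: "continuous_on UNIV (\<lambda>p :: complex \<times> complex. H (chart x (snd p)))"
      by (intro continuous_on_compose2[OF H(3)] continuous_on_compose2[OF continuous_chart] continuous_intros; simp)
    show ?thesis unfolding F_def wedge_def by (intro continuous_intros 1 2)
  qed
  have inj: "inj (\<lambda>t. proj (chart x t))"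
  proof (rule injI)
    fix s t assume "proj (chart x s) = proj (chart x t)"
    then have "wedge (chart x s) (chart x t) = 0" by (simp add: proj_eq_iff_wedge)
    then show "s = t" by (simp add: wedge_chart)
  qed
  have "{t. F (0, t) = 0} = (\<lambda>t. proj (chart x t)) -` {y. T y = T x}"
    by (auto simp: zero)
  then have "finite {t. F (0, t) = 0}"
    using finite_vimageI[OF rational_map_finite_fibre[OF T d] inj] by simp
  then have "finite (cmod ` {t. F (0, t) = 0})" by simp
  \<comment> \<open>The radius \<open>e\<close> has to avoid the finitely many moduli of zeros. It
    is below \<open>\<epsilon> / 2\<close> because the chart parameter \<open>t\<close> gives a
    point at distance at most \<open>2 * cmod t\<close> from \<open>x\<close>.\<close>
  moreover have "infinite {0<..<\<epsilon> / 2}" using \<epsilon> by (simp add: infinite_Ioo)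
  ultimately obtain e where e: "e \<in> {0<..<\<epsilon> / 2}" "e \<notin> cmod ` {t. F (0, t) = 0}"
    by (metis finite_subset subsetI)
  have nz: "F (0, t) \<noteq> 0" if "cmod t = e" for t using e(2) that by blast
  have "\<exists>m>0. \<forall>t\<in>sphere 0 e. m \<le> cmod (F (0, t))"
  proof -
    have "continuous_on (sphere 0 e) (\<lambda>t. cmod (F (0, t)))"
      by (intro continuous_on_norm continuous_on_compose2[OF contF] continuous_intros) auto
    moreover have "sphere (0::complex) e \<noteq> {}" using e by auto
    ultimately obtain t0 where "t0 \<in> sphere 0 e" "\<forall>t\<in>sphere 0 e. cmod (F (0, t0)) \<le> cmod (F (0, t))"
      using continuous_attains_inf[of "sphere 0 e" "\<lambda>t. cmod (F (0, t))"] by auto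
    then show ?thesis using nz[of t0] by (intro exI[of _ "cmod (F (0, t0))"]) auto
  qed
  then obtain m where m: "m > 0" "\<And>t. cmod t = e \<Longrightarrow> m \<le> cmod (F (0, t))" by auto
  \<comment> \<open>For small \<open>s\<close> the modulus of \<open>F (s, t)\<close> exceeds
    \<open>m / 2\<close> on the circle, while it is below \<open>m / 2\<close> at
    \<open>t = 0\<close>.\<close>
  have "uniformly_continuous_on (cball 0 1 \<times> cball 0 e) F"
    by (intro compact_uniformly_continuous continuous_on_subset[OF contF] compact_Times) auto
  then obtain \<delta> where \<delta>: "\<delta> > 0"
    "\<And>p p'. p \<in> cball 0 1 \<times> cball 0 e \<Longrightarrow> p' \<in> cball 0 1 \<times> cball 0 e \<Longrightarrow> dist p' p < \<delta> \<Longrightarrow> dist (F p') (F p) < m / 2"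
    unfolding uniformly_continuous_on_def using m(1) by (meson half_gt_zero)
  show ?thesis
  proof (intro exI[of _ "min 1 \<delta>"] conjI allI impI)
    fix w assume w: "chordal (T x) w < min 1 \<delta>"
    obtain s where s: "cmod s \<le> chordal (T x) w" "w = proj (chart (T x) s)"
      using chart_surj[of "T x" w] w by auto
    have close: "cmod (F (s, t) - F (0, t)) < m / 2" if "cmod t \<le> e" for t
    proof -
      have "dist (F (s, t)) (F (0, t)) < m / 2"
        by (rule \<delta>(2)) (use s w that in \<open>auto simp: dist_Pair_Pair\<close>)
      then show ?thesis by (simp add: dist_norm)
    qed
    obtain t where t: "t \<in> ball 0 e" "F (s, t) = 0"
    proof (rule holomorphic_contract_to_zero[of 0 e "\<lambda>t. F (s, t)"])
      show "continuous_on (cball 0 e) (\<lambda>t. F (s, t))"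
        by (intro continuous_on_compose2[OF contF] continuous_intros) auto
      show "(\<lambda>t. F (s, t)) holomorphic_on ball 0 e"
        unfolding F_def fst_conv snd_conv by (rule holomorphic_on_subset[OF H(4)]) simp
      show "cmod (F (s, 0)) < cmod (F (s, t))" if "cmod (0 - t) = e" for t
      proof -
        have F00: "F (0, 0) = 0" by (simp add: zero)
        have "cmod (F (s, 0)) < m / 2" using close[of 0] e F00 by simp
        moreover have "m \<le> cmod (F (0, t))" using that by (intro m(2)) simp
        moreover have "cmod (F (0, t)) \<le> cmod (F (s, t)) + cmod (F (s, t) - F (0, t))"
          by (metis norm_minus_commute norm_triangle_sub)
        ultimately show ?thesis using close[of t] that by simp
      qed
    qed (use e in auto)
    have "T (proj (chart x t)) = w" using t(2) zero s by simp
    moreover have "chordal x (proj (chart x t)) < \<epsilon>"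
      using chordal_chart_le[of x t] t(1) e by (simp add: dist_norm)
    ultimately show "\<exists>\<xi>. chordal x \<xi> < \<epsilon> \<and> T \<xi> = w" by blast
  qed (use \<delta> in simp)
qed

section \<open>Fatou and Julia sets\<close>

lemma rational_map_continuous:
  assumes T: "is_rational_map T d" and e: "e > 0"
  shows "\<exists>h>0. \<forall>y. chordal x y < h \<longrightarrow> chordal (T x) (T y) < e"
proof -
  obtain l where "\<forall>\<epsilon>>0. \<exists>r>0. \<forall>y y'. chordal x y < r \<longrightarrow> chordal x y' < r \<longrightarrow>
    \<bar>chordal (T y) (T y') - l * chordal y y'\<bar> \<le> \<epsilon> * chordal y y'"
    using rational_map_local_ratio[OF T] by blast
  then obtain r where r: "r > 0" "\<And>y y'. chordal x y < r \<Longrightarrow> chordal x y' < r \<Longrightarrow>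
    \<bar>chordal (T y) (T y') - l * chordal y y'\<bar> \<le> 1 * chordal y y'"
    by (metis zero_less_one)
  define M where "M = \<bar>l\<bar> + 1"
  have M: "M > 0" by (simp add: M_def)
  show ?thesis
  proof (intro exI[of _ "min r (e / M)"] conjI allI impI)
    show "0 < min r (e / M)" using r(1) e M by simp
    fix y assume y: "chordal x y < min r (e / M)"
    have "l * chordal x y \<le> \<bar>l\<bar> * chordal x y" by (intro mult_right_mono) auto
    then have "chordal (T x) (T y) \<le> M * chordal x y"
      using r(2)[of x y] y r(1) by (simp add: M_def distrib_right)
    also have "\<dots> < e" using y M by (simp add: field_simps)
    finally show "chordal (T x) (T y) < e" .
  qed
qed

lemma fatou_set_open:
  assumes "z \<in> fatou_set T"
  shows "\<exists>r>0. \<forall>y. chordal z y < r \<longrightarrow> y \<in> fatou_set T"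
proof -
  obtain r where r: "r > 0" "\<And>x e. x \<in> sph_ball z r \<Longrightarrow> e > 0 \<Longrightarrow> \<exists>h>0. \<forall>y\<in>sph_ball z r.
       chordal x y < h \<longrightarrow> (\<forall>n. chordal ((T^^n) x) ((T^^n) y) < e)"
    using assms unfolding fatou_set_def by blast
  have "y \<in> fatou_set T" if y: "chordal z y < r" for y
    unfolding fatou_set_def
  proof (rule CollectI, rule exI[of _ "r - chordal z y"], intro conjI ballI allI impI)
    show "r - chordal z y > 0" using y by simp
    have sub: "w \<in> sph_ball z r" if "w \<in> sph_ball y (r - chordal z y)" for w
      using that chordal_triangle[of z w y] by (simp add: sph_ball_def)
    fix x and e :: real assume "x \<in> sph_ball y (r - chordal z y)" "e > 0"
    then obtain h where "h > 0" "\<forall>y\<in>sph_ball z r.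
       chordal x y < h \<longrightarrow> (\<forall>n. chordal ((T^^n) x) ((T^^n) y) < e)" using r(2) sub by blast
    then show "\<exists>h>0. \<forall>ya\<in>sph_ball y (r - chordal z y). chordal x ya < h \<longrightarrow> (\<forall>n. chordal ((T^^n) x) ((T^^n) ya) < e)"
      using sub by blast
  qed
  then show ?thesis using r(1) by blast
qed

lemma fatou_set_backward:
  assumes T: "is_rational_map T d" and z: "T z \<in> fatou_set T"
  shows "z \<in> fatou_set T"
proof -
  obtain r where r: "r > 0" "\<And>x e. x \<in> sph_ball (T z) r \<Longrightarrow> e > 0 \<Longrightarrow> \<exists>h>0. \<forall>y\<in>sph_ball (T z) r.
       chordal x y < h \<longrightarrow> (\<forall>n. chordal ((T^^n) x) ((T^^n) y) < e)"
    using z unfolding fatou_set_def by blast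
  obtain r1 where r1: "r1 > 0" "\<And>y. chordal z y < r1 \<Longrightarrow> chordal (T z) (T y) < r"
    using rational_map_continuous[OF T r(1)] by blast
  have img: "T x \<in> sph_ball (T z) r" if "x \<in> sph_ball z r1" for x
    using r1(2)[of x] that by (simp add: sph_ball_def)
  show ?thesis
    unfolding fatou_set_def
  proof (rule CollectI, rule exI[of _ r1], intro conjI ballI allI impI r1(1))
    fix x and e :: real assume x: "x \<in> sph_ball z r1" and e: "e > 0"
    obtain h where h: "h > 0" "\<And>y n. y \<in> sph_ball (T z) r \<Longrightarrow> chordal (T x) y < h \<Longrightarrow>
        chordal ((T^^n) (T x)) ((T^^n) y) < e"
      using r(2)[OF img[OF x] e] by blast
    obtain h' where h': "h' > 0" "\<And>y. chordal x y < h' \<Longrightarrow> chordal (T x) (T y) < h"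
      using rational_map_continuous[OF T h(1)] by blast
    show "\<exists>h>0. \<forall>y\<in>sph_ball z r1. chordal x y < h \<longrightarrow> (\<forall>n. chordal ((T^^n) x) ((T^^n) y) < e)"
    \<comment> \<open>The \<open>e\<close> in the minimum takes care of \<open>n = 0\<close>; every
      later iterate factors through \<open>T x\<close>.\<close>
    proof (intro exI[of _ "min e h'"] conjI ballI allI impI)
      fix y n assume y: "y \<in> sph_ball z r1" "chordal x y < min e h'"
      show "chordal ((T^^n) x) ((T^^n) y) < e"
      proof (cases n)
        case (Suc k)
        show ?thesis unfolding Suc funpow_Suc_right comp_apply
          by (rule h(2)[OF img[OF y(1)] h'(2)]) (use y in simp)
      qed (use y in simp)
    qed (use e h' in simp)
  qed
qed

text \<open>Openness lifts points near \<open>T z\<close> to points near \<open>z\<close>, where the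
  \<open>n\<close>-th iterate becomes the iterate of order \<open>n + 1\<close>.\<close>

lemma fatou_set_forward:
  assumes T: "is_rational_map T d" "d \<ge> 1" and z: "z \<in> fatou_set T"
  shows "T z \<in> fatou_set T"
proof -
  obtain r where r: "r > 0" "\<And>x e. x \<in> sph_ball z r \<Longrightarrow> e > 0 \<Longrightarrow> \<exists>h>0. \<forall>y\<in>sph_ball z r.
       chordal x y < h \<longrightarrow> (\<forall>n. chordal ((T^^n) x) ((T^^n) y) < e)"
    using z unfolding fatou_set_def by blast
  obtain \<eta> where \<eta>: "\<eta> > 0" "\<And>w. chordal (T z) w < \<eta> \<Longrightarrow> \<exists>\<xi>. chordal z \<xi> < r \<and> T \<xi> = w"
    using rational_map_open[OF T r(1)] by blast
  show ?thesis
    unfolding fatou_set_def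
  proof (rule CollectI, rule exI[of _ \<eta>], intro conjI ballI allI impI \<eta>(1))
    fix x and e :: real assume x: "x \<in> sph_ball (T z) \<eta>" and e: "e > 0"
    obtain x' where x': "chordal z x' < r" "T x' = x" using \<eta>(2)[of x] x by (auto simp: sph_ball_def)
    obtain h where h: "h > 0" "\<And>y n. y \<in> sph_ball z r \<Longrightarrow> chordal x' y < h \<Longrightarrow>
        chordal ((T^^n) x') ((T^^n) y) < e"
      using r(2)[of x' e] x' e by (auto simp: sph_ball_def)
    have "min h (r - chordal z x') > 0" using h x' by simp
    from rational_map_open[OF T this, of x'] obtain \<theta> where \<theta>: "\<theta> > 0"
      "\<And>w. chordal (T x') w < \<theta> \<Longrightarrow> \<exists>\<xi>. chordal x' \<xi> < min h (r - chordal z x') \<and> T \<xi> = w"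
      by blast
    show "\<exists>h>0. \<forall>y\<in>sph_ball (T z) \<eta>. chordal x y < h \<longrightarrow> (\<forall>n. chordal ((T^^n) x) ((T^^n) y) < e)"
    proof (intro exI[of _ \<theta>] conjI ballI allI impI \<theta>(1))
      fix y n assume "chordal x y < \<theta>"
      then obtain y' where y': "chordal x' y' < min h (r - chordal z x')" "T y' = y"
        using \<theta>(2)[of y] x' by auto
      have "chordal z y' < r" using chordal_triangle[of z y' x'] y' by simp
      then have "chordal ((T^^Suc n) x') ((T^^Suc n) y') < e"
        using y' by (intro h(2)) (auto simp: sph_ball_def)
      then show "chordal ((T^^n) x) ((T^^n) y) < e"
        using x' y' by (simp add: funpow_Suc_right del: funpow.simps)
    qed
  qed
qed

lemma compact_stereo_julia: "compact (stereo ` julia_set T)"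
proof -
  have "closed (stereo ` julia_set T)"
    unfolding closed_limpt
  proof (intro allI impI)
    fix p assume p: "p islimpt stereo ` julia_set T"
    have "closed (range stereo)" unfolding range_stereo by simp
    moreover have "p islimpt range stereo" by (rule islimpt_subset[OF p]) auto
    ultimately have "p \<in> range stereo" unfolding closed_limpt by blast
    then obtain x where x: "p = stereo x" by blast
    have "x \<in> julia_set T"
    proof (rule ccontr)
      assume "x \<notin> julia_set T"
      then obtain r where r: "r > 0" "\<And>y. chordal x y < r \<Longrightarrow> y \<in> fatou_set T"
        using fatou_set_open[of x T] by (auto simp: julia_set_def)
      obtain y where y: "y \<in> julia_set T" "dist (stereo y) p < r"
        using p r(1) unfolding islimpt_approachable by auto
      then show False using r(2)[of y] by (auto simp: x dist_stereo chordal_commute julia_set_def)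
    qed
    then show "p \<in> stereo ` julia_set T" using x by blast
  qed
  moreover have "stereo ` julia_set T \<subseteq> sphere 0 1" using range_stereo by auto
  ultimately show ?thesis by (metis compact_sphere compact_Int_closed Int_absorb1)
qed

text \<open>Stated additively, so that no case distinction on vanishing distances is needed.\<close>

lemma iterate_ratio:
  assumes T: "is_rational_map T d"
    and L: "\<And>x \<epsilon>. \<epsilon> > 0 \<Longrightarrow> \<exists>r>0. \<forall>y. chordal x y < r \<longrightarrow>
       \<bar>chordal (T x) (T y) - L x * chordal x y\<bar> \<le> \<epsilon> * chordal x y"
  shows "\<epsilon> > 0 \<Longrightarrow> \<exists>r>0. \<forall>y. chordal x y < r \<longrightarrow>
    \<bar>chordal ((T^^n) x) ((T^^n) y) - (\<Prod>k<n. L ((T^^k) x)) * chordal x y\<bar> \<le> \<epsilon> * chordal x y"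
proof (induction n arbitrary: \<epsilon>)
  case 0
  then show ?case by (intro exI[of _ 1]) auto
next
  case (Suc n)
  define P where "P = (\<Prod>k<n. L ((T^^k) x))"
  define l where "l = L ((T^^n) x)"
  \<comment> \<open>The total error is \<open>(D2 - l * D1) + l * (D1 - P * D)\<close>, and
    \<open>e1\<close>, \<open>e2\<close> give each part the share \<open>\<epsilon> / 2 * D\<close>.
    Capping \<open>e1\<close> at 1 yields \<open>D1 \<le> (|P| + 1) * D\<close>, which controls the
    first part.\<close>
  define e1 where "e1 = min 1 (\<epsilon> / (2 * (\<bar>l\<bar> + 1)))"
  define e2 where "e2 = \<epsilon> / (2 * (\<bar>P\<bar> + 1))"
  have e: "e1 > 0" "e1 \<le> 1" "e2 > 0" using Suc.prems by (auto simp: e1_def e2_def)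
  have "\<bar>l\<bar> * e1 \<le> (\<bar>l\<bar> + 1) * (\<epsilon> / (2 * (\<bar>l\<bar> + 1)))"
    using e by (intro mult_mono) (auto simp: e1_def)
  also have "\<dots> = \<epsilon> / 2" by (simp add: field_simps)
  finally have le: "\<bar>l\<bar> * e1 \<le> \<epsilon> / 2" .
  have Pe: "(\<bar>P\<bar> + 1) * e2 = \<epsilon> / 2" by (simp add: e2_def field_simps)
  obtain r where r: "r > 0" "\<And>y. chordal x y < r \<Longrightarrow>
      \<bar>chordal ((T^^n) x) ((T^^n) y) - P * chordal x y\<bar> \<le> e1 * chordal x y"
    using Suc.IH[OF e(1)] unfolding P_def by blast
  obtain q where q: "q > 0" "\<And>y. chordal ((T^^n) x) y < q \<Longrightarrow>
      \<bar>chordal (T ((T^^n) x)) (T y) - l * chordal ((T^^n) x) y\<bar> \<le> e2 * chordal ((T^^n) x) y"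
    using L[OF e(3), of "(T^^n) x"] unfolding l_def by blast
  show ?case
  proof (intro exI[of _ "min r (q / (\<bar>P\<bar> + 1))"] conjI allI impI)
    show "min r (q / (\<bar>P\<bar> + 1)) > 0" using r q by simp
    fix y assume y: "chordal x y < min r (q / (\<bar>P\<bar> + 1))"
    define D where "D = chordal x y"
    define D1 where "D1 = chordal ((T^^n) x) ((T^^n) y)"
    define D2 where "D2 = chordal (T ((T^^n) x)) (T ((T^^n) y))"
    have D: "D \<ge> 0" by (simp add: D_def)
    have 1: "\<bar>D1 - P * D\<bar> \<le> e1 * D" using r(2)[of y] y by (simp add: D_def D1_def)
    have "P * D \<le> \<bar>P\<bar> * D" by (rule mult_right_mono[OF abs_ge_self D])
    moreover have "e1 * D \<le> 1 * D" by (rule mult_right_mono[OF e(2) D])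
    ultimately have D1: "D1 \<le> (\<bar>P\<bar> + 1) * D" using 1 by (simp add: distrib_right)
    also have "\<dots> < q" using y by (simp add: D_def field_simps)
    finally have 2: "\<bar>D2 - l * D1\<bar> \<le> e2 * D1" using q(2)[of "(T^^n) y"] by (simp add: D1_def D2_def)
    have "e2 * D1 \<le> e2 * ((\<bar>P\<bar> + 1) * D)" using D1 e by (intro mult_left_mono) auto
    also have "\<dots> = \<epsilon> / 2 * D" unfolding Pe[symmetric] by simp
    finally have 3: "e2 * D1 \<le> \<epsilon> / 2 * D" .
    have "\<bar>l * D1 - l * (P * D)\<bar> = \<bar>l\<bar> * \<bar>D1 - P * D\<bar>" by (simp flip: right_diff_distrib abs_mult)
    also have "\<dots> \<le> \<bar>l\<bar> * (e1 * D)" using 1 by (intro mult_left_mono) auto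
    also have "\<dots> \<le> \<epsilon> / 2 * D" using mult_right_mono[OF le D] by simp
    finally have 4: "\<bar>l * D1 - l * (P * D)\<bar> \<le> \<epsilon> / 2 * D" .
    have "\<bar>D2 - l * (P * D)\<bar> \<le> \<epsilon> / 2 * D + \<epsilon> / 2 * D" using 2 3 4 by linarith
    then have "\<bar>D2 - (P * l) * D\<bar> \<le> \<epsilon> * D" by (simp add: mult_ac)
    then show "\<bar>chordal ((T^^Suc n) x) ((T^^Suc n) y) - (\<Prod>k<Suc n. L ((T^^k) x)) * chordal x y\<bar> \<le> \<epsilon> * chordal x y"
      by (simp add: D2_def D_def P_def l_def)
  qed
qed

text \<open>Identifies the derivative in \<open>expanding\<close> with the product of the ratios
  \<open>L\<close> along the orbit; both are tested on a point \<open>y \<noteq> z\<close> close to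
  \<open>z\<close>.\<close>

lemma has_sph_deriv_unique:
  assumes f: "has_sph_deriv f z a"
    and P: "\<And>\<epsilon>. \<epsilon> > 0 \<Longrightarrow> \<exists>r>0. \<forall>y. chordal z y < r \<longrightarrow> \<bar>chordal (f z) (f y) - P * chordal z y\<bar> \<le> \<epsilon> * chordal z y"
  shows "a = P"
proof (rule ccontr)
  assume "a \<noteq> P"
  define e where "e = \<bar>a - P\<bar> / 2"
  have e: "e > 0" using \<open>a \<noteq> P\<close> by (simp add: e_def)
  obtain h where h: "h > 0" "\<And>w. w \<noteq> z \<Longrightarrow> chordal w z < h \<Longrightarrow> \<bar>chordal (f w) (f z) / chordal w z - a\<bar> < e"
    using f e unfolding has_sph_deriv_def by blast
  obtain r where r: "r > 0" "\<And>y. chordal z y < r \<Longrightarrow> \<bar>chordal (f z) (f y) - P * chordal z y\<bar> \<le> e * chordal z y"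
    using P[OF e] by blast
  obtain y where y: "y \<noteq> z" "chordal z y < min h r" using sphere_perfect[of "min h r" z] h r by auto
  define D where "D = chordal z y"
  have D: "D > 0" using y(1) by (metis D_def chordal_eq_0_iff chordal_nonneg less_eq_real_def)
  define D1 where "D1 = chordal (f z) (f y)"
  have "\<bar>D1 / D - a\<bar> < e" using h(2)[of y] y by (simp add: D_def D1_def chordal_commute)
  moreover have "\<bar>D1 / D - P\<bar> \<le> e"
  proof -
    have "(D1 / D - P) * D = D1 - P * D" using D by (simp add: field_simps)
    then have "\<bar>D1 / D - P\<bar> * D = \<bar>D1 - P * D\<bar>" using D by (metis abs_mult abs_of_pos)
    also have "\<dots> \<le> e * D" using r(2)[of y] y by (simp add: D_def D1_def)
    finally show ?thesis using D by (simp only: mult_le_cancel_right_pos)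
  qed
  ultimately have "\<bar>a - P\<bar> < 2 * e" by linarith
  then show False by (simp add: e_def)
qed

section \<open>Badly approximable points\<close>

text \<open>Conjugation by \<open>stereo\<close> brings the Julia set into the setting of
  \<open>exists_large_subset_avoiding_point\<close>. What remains is a positive lower bound for
  \<open>L\<close>, near conformality, openness relative to the Julia set, and expansion along
  orbits.\<close>

lemma julia_hausdorff_measure_bad_set:
  assumes T: "is_rational_map T d" "d \<ge> 1" and exp: "expanding T"
    and s: "0 \<le> s" "s < t" and H: "hausdorff_measure chordal t (julia_set T) \<noteq> 0"
  shows "hausdorff_measure chordal s (bad_set T z0) \<noteq> 0"
proof -
  let ?J = "julia_set T"
  obtain L where L: "\<And>\<epsilon>. \<epsilon> > 0 \<Longrightarrow> \<exists>r>0. \<forall>x y y'. chordal x y < r \<longrightarrow> chordal x y' < r \<longrightarrow>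
    \<bar>chordal (T y) (T y') - L x * chordal y y'\<bar> \<le> \<epsilon> * chordal y y'"
    by (rule rational_map_uniform_ratio[OF T(1)]) blast
  have L1: "\<exists>r>0. \<forall>y. chordal x y < r \<longrightarrow> \<bar>chordal (T x) (T y) - L x * chordal x y\<bar> \<le> \<epsilon> * chordal x y"
    if "\<epsilon> > 0" for x \<epsilon>
    using L[OF that] by (metis chordal_self)
  obtain C lam where C: "C > 0" "lam > 1" and ex: "\<And>z n. z \<in> ?J \<Longrightarrow> n \<ge> 1 \<Longrightarrow>
       \<exists>l. has_sph_deriv (T^^n) z l \<and> l \<ge> C * lam ^ n"
    using exp unfolding expanding_def by blast
  have prodL: "C * lam ^ n \<le> (\<Prod>k<n. L ((T ^^ k) x))" if x: "x \<in> ?J" and n: "n \<ge> 1" for x n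
  proof -
    obtain l where l: "has_sph_deriv (T^^n) x l" "l \<ge> C * lam ^ n" using ex[OF x n] by blast
    have "l = (\<Prod>k<n. L ((T ^^ k) x))"
      by (rule has_sph_deriv_unique[OF l(1)]) (rule iterate_ratio[OF T(1) L1])
    then show ?thesis using l(2) by simp
  qed
  \<comment> \<open>Expansion for \<open>n = 1\<close> bounds \<open>L\<close> away from 0 on the
    Julia set, so that additive errors become relative ones.\<close>
  define c0 where "c0 = C * lam"
  have c0: "c0 > 0" using C by (simp add: c0_def)
  have Lc: "c0 \<le> L x" if "x \<in> ?J" for x using prodL[OF that, of 1] by (simp add: c0_def)
  have TJ: "T x \<in> ?J" if "x \<in> ?J" for x
    using that fatou_set_backward[OF T(1)] by (auto simp: julia_set_def)
  \<comment> \<open>Backward invariance keeps lifted points inside the Julia set, as openness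
    relative to \<open>K\<close> requires.\<close>
  have TJ': "x \<in> ?J" if "T x \<in> ?J" for x
    using that fatou_set_forward[OF T] by (auto simp: julia_set_def)
  define K where "K = stereo ` ?J"
  define S where "S = stereo \<circ> T \<circ> inv stereo"
  define LS where "LS = L \<circ> inv stereo"
  have inv [simp]: "inv stereo (stereo x) = x" for x by (rule inv_f_f[OF inj_stereo])
  have S_stereo: "S (stereo x) = stereo (T x)" for x by (simp add: S_def)
  have Sn: "(S ^^ n) (stereo x) = stereo ((T ^^ n) x)" for n x
    by (induction n) (auto simp: S_stereo)
  have LSs: "LS (stereo x) = L x" for x by (simp add: LS_def)
  have K: "compact K" unfolding K_def by (rule compact_stereo_julia)
  have SK: "S x \<in> K" if "x \<in> K" for x using that TJ by (auto simp: K_def S_stereo)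
  have LSpos: "LS x > 0" if "x \<in> K" for x
    using that Lc c0 by (force simp: K_def LSs)
  have conf: "nearly_conformal_on K S LS"
    unfolding nearly_conformal_on_def
  proof (intro allI impI)
    fix \<epsilon> :: real assume \<epsilon>: "\<epsilon> > 0"
    \<comment> \<open>The largest \<theta> for which
      \<open>L x / (1 + \<epsilon>) \<le> L x - \<theta>\<close> whenever
      \<open>L x \<ge> c0\<close>.\<close>
    define \<theta> where "\<theta> = c0 * \<epsilon> / (1 + \<epsilon>)"
    have \<theta>: "\<theta> > 0" using c0 \<epsilon> by (simp add: \<theta>_def)
    obtain r where r: "r > 0" "\<And>x y y'. chordal x y < r \<Longrightarrow> chordal x y' < r \<Longrightarrow>
        \<bar>chordal (T y) (T y') - L x * chordal y y'\<bar> \<le> \<theta> * chordal y y'"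
      using L[OF \<theta>] by blast
    have main: "L x / (1 + \<epsilon>) * chordal y y' \<le> chordal (T y) (T y') \<and> chordal (T y) (T y') \<le> (1 + \<epsilon>) * L x * chordal y y'"
      if x: "x \<in> ?J" and y: "chordal x y < r" "chordal x y' < r" for x y y'
    proof -
      define D where "D = chordal y y'"
      have D: "D \<ge> 0" by (simp add: D_def)
      have Lx: "L x \<ge> c0" "L x > 0" using Lc[OF x] c0 by auto
      have "\<theta> \<le> L x * \<epsilon> / (1 + \<epsilon>)" unfolding \<theta>_def using Lx \<epsilon> by (intro divide_right_mono mult_right_mono) auto
      also have "L x * \<epsilon> / (1 + \<epsilon>) = L x - L x / (1 + \<epsilon>)" using \<epsilon> by (simp add: field_simps)
      finally have 1: "L x / (1 + \<epsilon>) \<le> L x - \<theta>" by simp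
      have "c0 * \<epsilon> / (1 + \<epsilon>) \<le> c0 * \<epsilon> / 1" using c0 \<epsilon> by (intro divide_left_mono) auto
      also have "\<dots> \<le> L x * \<epsilon>" using Lx \<epsilon> by simp
      finally have 2: "L x + \<theta> \<le> (1 + \<epsilon>) * L x" by (simp add: \<theta>_def algebra_simps)
      have "L x / (1 + \<epsilon>) * D \<le> (L x - \<theta>) * D" "(L x + \<theta>) * D \<le> (1 + \<epsilon>) * L x * D"
        by (intro mult_right_mono 1 2 D)+
      moreover have "\<bar>chordal (T y) (T y') - L x * D\<bar> \<le> \<theta> * D" using r(2)[OF y] by (simp add: D_def)
      ultimately show ?thesis unfolding D_def[symmetric] by (simp add: algebra_simps) linarith
    qed
    show "\<exists>r>0. \<forall>x\<in>K. \<forall>y\<in>K. \<forall>y'\<in>K. dist x y < r \<longrightarrow> dist x y' < r \<longrightarrow>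
     LS x / (1 + \<epsilon>) * dist y y' \<le> dist (S y) (S y') \<and> dist (S y) (S y') \<le> (1 + \<epsilon>) * LS x * dist y y'"
      by (rule exI[of _ r]) (use r(1) main in \<open>auto simp: K_def dist_stereo S_stereo LSs\<close>)
  qed
  have opn: "uniformly_open_on K S"
    unfolding uniformly_open_on_def
  proof (intro allI impI)
    fix \<epsilon> :: real assume \<epsilon>: "\<epsilon> > 0"
    \<comment> \<open>Each point has its own radius of openness. Half of it is spent on the distance
      from \<open>T z\<close> to \<open>T x\<close>, where \<open>z\<close> is a nearby centre of a
      finite cover, the other half on the distance from \<open>T x\<close> to
      \<open>w\<close>.\<close>
    then have "\<forall>x. \<exists>\<eta>>0. \<forall>w. chordal (T x) w < \<eta> \<longrightarrow> (\<exists>\<xi>. chordal x \<xi> < \<epsilon> / 2 \<and> T \<xi> = w)"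
      using rational_map_open[OF T, of "\<epsilon> / 2"] by simp
    then obtain \<eta> where \<eta>: "\<And>x. \<eta> x > 0"
      "\<And>x w. chordal (T x) w < \<eta> x \<Longrightarrow> \<exists>\<xi>. chordal x \<xi> < \<epsilon> / 2 \<and> T \<xi> = w" by metis
    have "\<forall>x. \<exists>h>0. \<forall>y. chordal x y < h \<longrightarrow> chordal (T x) (T y) < \<eta> x / 2"
      by (intro allI rational_map_continuous[OF T(1)] half_gt_zero \<eta>(1))
    then obtain h where h: "\<And>x. h x > 0" "\<And>x y. chordal x y < h x \<Longrightarrow> chordal (T x) (T y) < \<eta> x / 2" by metis
    obtain F where F: "finite F" "\<And>y. \<exists>x\<in>F. chordal x y < min (h x) (\<epsilon> / 2)"
      using chordal_finite_subcover[of "\<lambda>x. min (h x) (\<epsilon> / 2)"] h(1) \<epsilon> by auto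
    define \<zeta> where "\<zeta> = Min (insert 1 ((\<lambda>x. \<eta> x / 2) ` F))"
    have \<zeta>: "\<zeta> > 0" unfolding \<zeta>_def using F(1) \<eta>(1) by auto
    have main: "\<exists>\<xi>. chordal x \<xi> < \<epsilon> \<and> T \<xi> = w" if w: "chordal (T x) w < \<zeta>" for x w
    proof -
      obtain z where z: "z \<in> F" "chordal z x < min (h z) (\<epsilon> / 2)" using F(2) by blast
      have "\<zeta> \<le> \<eta> z / 2" unfolding \<zeta>_def using F(1) z by (intro Min_le) auto
      moreover have "chordal (T z) (T x) < \<eta> z / 2" using h(2) z by simp
      ultimately have "chordal (T z) w < \<eta> z" using chordal_triangle[of "T z" w "T x"] w by linarith
      then obtain \<xi> where \<xi>: "chordal z \<xi> < \<epsilon> / 2" "T \<xi> = w" using \<eta>(2) by blast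
      have "chordal x \<xi> < \<epsilon>" using chordal_triangle[of x \<xi> z] chordal_commute[of x z] \<xi> z by linarith
      then show ?thesis using \<xi> by blast
    qed
    show "\<exists>\<eta>>0. \<forall>x\<in>K. \<forall>w\<in>K. dist (S x) w < \<eta> \<longrightarrow> (\<exists>\<xi>\<in>K. dist x \<xi> < \<epsilon> \<and> S \<xi> = w)"
    proof (rule exI[of _ \<zeta>], intro conjI ballI impI \<zeta>)
      fix p q assume pq: "p \<in> K" "q \<in> K" "dist (S p) q < \<zeta>"
      then obtain x w where x: "p = stereo x" "x \<in> ?J" "q = stereo w" "w \<in> ?J" unfolding K_def by blast
      then obtain \<xi> where "chordal x \<xi> < \<epsilon>" "T \<xi> = w" using main pq by (auto simp: S_stereo dist_stereo)
      then show "\<exists>\<xi>\<in>K. dist p \<xi> < \<epsilon> \<and> S \<xi> = q"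
        using x TJ'[of \<xi>] by (intro bexI[of _ "stereo \<xi>"]) (auto simp: K_def S_stereo dist_stereo)
    qed
  qed
  have t: "t \<ge> 0" using s by simp
  have "hausdorff_measure chordal t ?J \<le> hausdorff_measure dist t K"
    by (rule hausdorff_measure_isometric_le[where f = "inv stereo"])
      (use t in \<open>auto simp: K_def dist_stereo image_image\<close>)
  then have HK: "hausdorff_measure dist t K \<noteq> 0" using H by auto
  have prodS: "C * lam ^ n \<le> (\<Prod>k<n. LS ((S ^^ k) x))" if "x \<in> K" "n \<ge> 1" for x n
    using that prodL by (auto simp: K_def Sn LSs)
  have "\<exists>\<Lambda> c. \<Lambda> \<subseteq> K \<and> hausdorff_measure dist s \<Lambda> \<noteq> 0 \<and> c > 0 \<and>
      (\<forall>x\<in>\<Lambda>. \<forall>n. c \<le> dist (stereo z0) ((S ^^ n) x))"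
    by (rule exists_large_subset_avoiding_point[OF K conf LSpos SK opn C prodS s HK])
  then obtain \<Lambda> c where \<Lambda>: "\<Lambda> \<subseteq> K" "hausdorff_measure dist s \<Lambda> \<noteq> 0" "c > 0"
    "\<forall>x\<in>\<Lambda>. \<forall>n. c \<le> dist (stereo z0) ((S ^^ n) x)"
    by (elim exE conjE)
  have "\<Lambda> \<subseteq> stereo ` bad_set T z0"
  proof
    fix p assume p: "p \<in> \<Lambda>"
    then obtain x where x: "p = stereo x" "x \<in> ?J" using \<Lambda>(1) unfolding K_def by blast
    have "(T ^^ n) x \<notin> sph_ball z0 c" for n
      using \<Lambda>(4)[rule_format, OF p, of n] by (simp add: x Sn dist_stereo sph_ball_def)
    then have "x \<in> bad_set T z0" using x \<Lambda>(3) unfolding bad_set_def by blast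
    then show "p \<in> stereo ` bad_set T z0" using x by blast
  qed
  then have "hausdorff_measure dist s \<Lambda> \<le> hausdorff_measure chordal s (bad_set T z0)"
    by (intro hausdorff_measure_isometric_le[where f = stereo]) (use s in \<open>auto simp: dist_stereo\<close>)
  then show ?thesis using \<Lambda>(2) by auto
qed

theorem theorem8:
  fixes T :: "complex option \<Rightarrow> complex option" and d :: nat and z0 :: "complex option"
  assumes "is_rational_map T d" and "d \<ge> 2" and "expanding T" and "z0 \<in> julia_set T"
  shows "hausdorff_dim chordal (bad_set T z0) = hausdorff_dim chordal (julia_set T)"
proof -
  define DB where "DB = {s. s \<ge> 0 \<and> hausdorff_measure chordal s (bad_set T z0) = 0}"
  define DJ where "DJ = {s. s \<ge> 0 \<and> hausdorff_measure chordal s (julia_set T) = 0}"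
  have sub: "DJ \<subseteq> DB"
  proof
    fix s assume "s \<in> DJ"
    then have s: "s \<ge> 0" "hausdorff_measure chordal s (julia_set T) = 0" by (auto simp: DJ_def)
    have "hausdorff_measure chordal s (bad_set T z0) \<le> hausdorff_measure chordal s (julia_set T)"
      by (rule hausdorff_measure_isometric_le[where f = "\<lambda>x. x"]) (use s in \<open>auto simp: bad_set_def\<close>)
    then show "s \<in> DB" using s by (simp add: DB_def)
  qed
  \<comment> \<open>Together with \<open>DJ \<subseteq> DB\<close> this says that the two sets
    differ at most in the least element of \<open>DB\<close>, so their infima agree.\<close>
  have above: "t \<in> DJ" if "s \<in> DB" "s < t" for s t
  proof (rule ccontr)
    assume "t \<notin> DJ"
    then have "hausdorff_measure chordal t (julia_set T) \<noteq> 0" using that by (auto simp: DJ_def DB_def)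
    then have "hausdorff_measure chordal s (bad_set T z0) \<noteq> 0"
      using julia_hausdorff_measure_bad_set[OF assms(1) _ assms(3) _ that(2)] assms(2) that(1)
      by (simp add: DB_def)
    then show False using that(1) by (simp add: DB_def)
  qed
  have "Inf DB = Inf DJ"
  \<comment> \<open>\<open>Inf {}\<close> has no useful value, so the empty case rests on
    \<open>DJ\<close> being empty as well.\<close>
  proof (cases "DB = {}")
    case True
    then show ?thesis using sub by simp
  next
    case False
    then obtain s0 where s0: "s0 \<in> DB" by blast
    then have ne: "DJ \<noteq> {}" using above[of s0 "s0 + 1"] by auto
    have bdd: "bdd_below DB" "bdd_below DJ" by (auto simp: DB_def DJ_def bdd_below_def)
    show ?thesis
    proof (rule antisym)
      show "Inf DB \<le> Inf DJ" by (rule cInf_superset_mono[OF ne bdd(1) sub])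
      show "Inf DJ \<le> Inf DB"
      proof (rule cInf_greatest[OF False])
        fix s assume "s \<in> DB"
        then have "Inf DJ \<le> t" if "s < t" for t
          using above that bdd(2) by (intro cInf_lower) auto
        then show "Inf DJ \<le> s" by (rule dense_ge)
      qed
    qed
  qed
  then show ?thesis by (simp add: hausdorff_dim_def DB_def DJ_def)
qed

end
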